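(* Let $\Gamma$ be a finitely generated group equipped with the word metric of a finite generating set, and suppose $\operatorname{AN-asdim}\Gamma<\infty$. Then $\operatorname{AN-asdim}\Gamma=\dim\nu_L\Gamma$, where $\operatorname{AN-asdim}$ is the asymptotic Assouad-Nagata dimension, $\nu_L\Gamma$ is the sublinear Higson corona of $\Gamma$, and $\dim$ is the covering dimension.
   Context: Asymptotic Assouad-Nagata dimension of a metric space $X$: $\operatorname{AN-asdim} X\le n$ if there are $c>0$ and $r_0>0$ such that for every $r\ge r_0$ there is a cover $\mathcal U$ of $X$ with $\operatorname{mesh}\mathcal U=\sup_{U\in\mathcal U}\operatorname{diam}U\le cr$, Lebesgue number $L(\mathcal U)=\inf_{x\in X}\sup_{U\in\mathcal U}d(x,X\setminus U)>r$ (with $d(x,\emptyset)=\infty$), and multiplicity $\le n+1$ (every intersection of $n+2$ distinct elements of $\mathcal U$ is empty). $\operatorname{AN-asdim}X$ is the least such $n\in\{0,1,2,\dots\}$, or $\infty$ if there is none. Sublinear Higson corona: let $(X,d)$ be a proper metric space (closed bounded sets are compact) with basepoint $x_0$ and $\|x\|=d(x,x_0)$; a finitely generated group with word metric is such a (discrete) space. For $E\subset X\times X$ let $E^{-1}=\{(x,y):(y,x)\in E\}$, $E[K]=\{x': (x',x)\in E\text{ for some }x\in K\}$, $E_x=E[\{x\}]$, $E^x=E^{-1}[\{x\}]$. $E$ is proper if $E[K]$ and $E^{-1}[K]$ are relatively compact for each relatively compact $K\subset X$. The sublinear coarse structure $\mathcal E_L$ consists of all proper $E\subset X\times X$ with $\lim_{\|x\|\to\infty}\frac{\sup_{y\in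 E_x}d(y,x)}{\|x\|}=0=\lim_{\|x\|\to\infty}\frac{\sup_{y\in E^x}d(x,y)}{\|x\|}$ (sup over the empty set is $0$; it does not depend on $x_0$). A bounded continuous $f:X\to\mathbb C$ is a Higson function, $f\in C_h(X,\mathcal E_L)$, if for every $E\in\mathcal E_L$ and $\epsilon>0$ there is a compact $K\subset X$ with $|f(x)-f(y)|<\epsilon$ whenever $(y,x)\in E\setminus (K\times K)$. The sublinear Higson compactification $h_LX$ is the compactification of $X$ such that a bounded continuous function $X\to\mathbb C$ extends continuously to $h_LX$ iff it lies in $C_h(X,\mathcal E_L)$; $\nu_LX=h_LX\setminus X$. Convention: covering dimension takes values in $\{0,1,2,\dots\}\cup\{\infty\}$; in particular $\dim\emptyset=0$ (relevant only if $\Gamma$ is finite). *)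

theory Defs
  imports "HOL-Analysis.Analysis" "HOL-Algebra.Generated_Groups" "HOL-Library.Extended_Nat"
begin

section \<open>Covers and dimension\<close>

definition mult_le :: "'a set set \<Rightarrow> nat \<Rightarrow> bool" where
  "mult_le \<U> m \<longleftrightarrow> (\<forall>\<V>\<subseteq>\<U>. finite \<V> \<and> card \<V> = m + 1 \<longrightarrow> \<Inter>\<V> = {})"

text \<open>Covering dimension is defined by finite open covers and finite open refinements.  In \<^typ>\<open>enat\<close> the infimum of the empty set
  is \<^term>\<open>\<infinity>\<close>, and the empty space has dimension 0.\<close>

definition covering_dim_le :: "'a topology \<Rightarrow> nat \<Rightarrow> bool" where
  "covering_dim_le X n \<longleftrightarrow>
     (\<forall>\<U>. finite \<U> \<and> (\<forall>U\<in>\<U>. openin X U) \<and> \<Union>\<U> = topspace X \<longrightarrow>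
        (\<exists>\<V>. finite \<V> \<and> (\<forall>V\<in>\<V>. openin X V) \<and> \<Union>\<V> = topspace X \<and>
             (\<forall>V\<in>\<V>. \<exists>U\<in>\<U>. V \<subseteq> U) \<and> mult_le \<V> (n + 1)))"

definition covering_dim :: "'a topology \<Rightarrow> enat" where
  "covering_dim X = Inf {enat n |n. covering_dim_le X n}"


section \<open>Compactifications\<close>

definition compactification :: "'a topology \<Rightarrow> 'z topology \<Rightarrow> ('a \<Rightarrow> 'z) \<Rightarrow> bool" where
  "compactification X Z \<iota> \<longleftrightarrow>
     compact_space Z \<and> Hausdorff_space Z \<and> embedding_map X Z \<iota> \<and>
     Z closure_of (\<iota> ` topspace X) = topspace Z"

definition remainder :: "'a topology \<Rightarrow> 'z topology \<Rightarrow> ('a \<Rightarrow> 'z) \<Rightarrow> 'z topology" where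
  "remainder X Z \<iota> = subtopology Z (topspace Z - \<iota> ` topspace X)"


section \<open>Large-scale notions for metric spaces\<close>

text \<open>\<^term>\<open>coarse_section E K\<close> is E[K]; note that it collects \<^emph>\<open>first\<close> components.\<close>

definition coarse_section :: "('a \<times> 'a) set \<Rightarrow> 'a set \<Rightarrow> 'a set" where
  "coarse_section E K = {x'. \<exists>x\<in>K. (x', x) \<in> E}"

context Metric_space
begin

text \<open>Suprema and infima are taken in \<^typ>\<open>ennreal\<close>, so that the supremum of the empty set
  is 0 and the distance to the empty set is \<^term>\<open>\<infinity>\<close>.\<close>

definition ediam :: "'a set \<Rightarrow> ennreal" where
  "ediam U = (SUP x\<in>U. SUP y\<in>U. ennreal (d x y))"

definition esetdist :: "'a \<Rightarrow> 'a set \<Rightarrow> ennreal" where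
  "esetdist x A = (INF y\<in>A. ennreal (d x y))"

definition mesh :: "'a set set \<Rightarrow> ennreal" where
  "mesh \<U> = (SUP U\<in>\<U>. ediam U)"

definition lebesgue_number :: "'a set set \<Rightarrow> ennreal" where
  "lebesgue_number \<U> = (INF x\<in>M. SUP U\<in>\<U>. esetdist x (M - U))"

definition AN_asdim_le :: "nat \<Rightarrow> bool" where
  "AN_asdim_le n \<longleftrightarrow>
     (\<exists>c>0. \<exists>r0>0. \<forall>r\<ge>r0. \<exists>\<U>. \<U> \<subseteq> Pow M \<and> \<Union>\<U> = M \<and>
        mesh \<U> \<le> ennreal (c * r) \<and> lebesgue_number \<U> > ennreal r \<and> mult_le \<U> (n + 1))"

definition AN_asdim :: enat where
  "AN_asdim = Inf {enat n |n. AN_asdim_le n}"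

definition rel_compact :: "'a set \<Rightarrow> bool" where
  "rel_compact K \<longleftrightarrow> K \<subseteq> M \<and> compactin mtopology (mtopology closure_of K)"

definition proper_relation :: "('a \<times> 'a) set \<Rightarrow> bool" where
  "proper_relation E \<longleftrightarrow>
     (\<forall>K. rel_compact K \<longrightarrow>
        rel_compact (coarse_section E K) \<and> rel_compact (coarse_section (E\<inverse>) K))"

definition norm_at_infinity :: "'a \<Rightarrow> 'a filter" where
  "norm_at_infinity x0 = inf (filtercomap (\<lambda>x. d x x0) at_top) (principal M)"

definition sublinear_coarse_structure :: "'a \<Rightarrow> ('a \<times> 'a) set set" where
  "sublinear_coarse_structure x0 = {E. E \<subseteq> M \<times> M \<and> proper_relation E \<and>
     ((\<lambda>x. (SUP y\<in>coarse_section E {x}. ennreal (d y x)) / ennreal (d x x0)) \<longlongrightarrow> 0)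
        (norm_at_infinity x0) \<and>
     ((\<lambda>x. (SUP y\<in>coarse_section (E\<inverse>) {x}. ennreal (d x y)) / ennreal (d x x0)) \<longlongrightarrow> 0)
        (norm_at_infinity x0)}"

text \<open>Only the values on \<^term>\<open>M\<close> matter for the function classes below.\<close>

definition bounded_continuous :: "('a \<Rightarrow> complex) set" where
  "bounded_continuous = {f. continuous_map mtopology euclidean f \<and> bounded (f ` M)}"

definition higson_functions :: "('a \<times> 'a) set set \<Rightarrow> ('a \<Rightarrow> complex) set" where
  "higson_functions \<E> = {f \<in> bounded_continuous.
     \<forall>E\<in>\<E>. \<forall>\<epsilon>>0. \<exists>K. compactin mtopology K \<and>
       (\<forall>x y. (y, x) \<in> E - K \<times> K \<longrightarrow> cmod (f x - f y) < \<epsilon>)}"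

definition sublinear_higson_compactification :: "'a \<Rightarrow> 'z topology \<Rightarrow> ('a \<Rightarrow> 'z) \<Rightarrow> bool" where
  "sublinear_higson_compactification x0 Z \<iota> \<longleftrightarrow>
     compactification mtopology Z \<iota> \<and>
     (\<forall>f\<in>bounded_continuous.
        (\<exists>g. continuous_map Z euclidean g \<and> (\<forall>x\<in>M. g (\<iota> x) = f x)) \<longleftrightarrow>
        f \<in> higson_functions (sublinear_coarse_structure x0))"

end


section \<open>Word metrics\<close>

definition word_length :: "('a, 'b) monoid_scheme \<Rightarrow> 'a set \<Rightarrow> 'a \<Rightarrow> nat" where
  "word_length G S g =
     (LEAST n. \<exists>ws. length ws = n \<and> set ws \<subseteq> S \<union> (\<lambda>s. inv\<^bsub>G\<^esub> s) ` S \<and>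
        foldr (\<lambda>a b. a \<otimes>\<^bsub>G\<^esub> b) ws \<one>\<^bsub>G\<^esub> = g)"

text \<open>The value 0 outside the carrier is only there because the locale \<^locale>\<open>Metric_space\<close>
  demands symmetry and non-negativity on the whole type.\<close>

definition word_dist :: "('a, 'b) monoid_scheme \<Rightarrow> 'a set \<Rightarrow> 'a \<Rightarrow> 'a \<Rightarrow> real" where
  "word_dist G S g h =
     (if g \<in> carrier G \<and> h \<in> carrier G then real (word_length G S (inv\<^bsub>G\<^esub> g \<otimes>\<^bsub>G\<^esub> h)) else 0)"


section \<open>Existence of the sublinear Higson compactification\<close>

instance "fun" :: (type, t0_space) t0_space
proof
  fix x y :: "'a \<Rightarrow> 'b" assume "x \<noteq> y"
  then obtain i where i: "x i \<noteq> y i" by blast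
  obtain U where U: "open U" "\<not> (x i \<in> U \<longleftrightarrow> y i \<in> U)"
    using separation_t0[THEN iffD1, OF i] by blast
  have "open ((\<lambda>f. f i) -` U)"
    by (rule open_vimage[OF U(1) continuous_on_product_coordinates])
  moreover have "\<not> (x \<in> (\<lambda>f. f i) -` U \<longleftrightarrow> y \<in> (\<lambda>f. f i) -` U)"
    using U by auto
  ultimately show "\<exists>U. open U \<and> \<not> (x \<in> U \<longleftrightarrow> y \<in> U)" by blast
qed

instance "fun" :: (type, t1_space) t1_space
proof
  fix x y :: "'a \<Rightarrow> 'b" assume "x \<noteq> y"
  then obtain i where i: "x i \<noteq> y i" by blast
  obtain U where U: "open U" "x i \<in> U" "y i \<notin> U"
    using t1_space[OF i] by blast
  have "open ((\<lambda>f. f i) -` U)"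
    by (rule open_vimage[OF U(1) continuous_on_product_coordinates])
  moreover have "x \<in> (\<lambda>f. f i) -` U" "y \<notin> (\<lambda>f. f i) -` U"
    using U by auto
  ultimately show "\<exists>U. open U \<and> x \<in> U \<and> y \<notin> U" by blast
qed

instance "fun" :: (type, t2_space) t2_space
proof
  fix x y :: "'a \<Rightarrow> 'b" assume "x \<noteq> y"
  then obtain i where i: "x i \<noteq> y i" by blast
  obtain U V where UV: "open U" "open V" "x i \<in> U" "y i \<in> V" "U \<inter> V = {}"
    using hausdorff[OF i] by blast
  have "open ((\<lambda>f. f i) -` U)" "open ((\<lambda>f. f i) -` V)"
    by (rule open_vimage[OF UV(1) continuous_on_product_coordinates])
       (rule open_vimage[OF UV(2) continuous_on_product_coordinates])
  moreover have "x \<in> (\<lambda>f. f i) -` U" "y \<in> (\<lambda>f. f i) -` V"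
    "(\<lambda>f. f i) -` U \<inter> (\<lambda>f. f i) -` V = {}"
    using UV by auto
  ultimately show "\<exists>U V. open U \<and> open V \<and> x \<in> U \<and> y \<in> V \<and> U \<inter> V = {}" by blast
qed

lemma Hausdorff_space_t2: "Hausdorff_space (euclidean :: 'a::t2_space topology)"
  unfolding Hausdorff_space_def disjnt_def using hausdorff by (metis open_openin)

context Metric_space
begin

lemma rel_compact_compactin: "compactin mtopology K \<Longrightarrow> rel_compact K"
  unfolding rel_compact_def
  by (metis Hausdorff_space_mtopology closure_of_closedin compactin_imp_closedin
      compactin_subset_topspace topspace_mtopology)

lemma rel_compactD:
  assumes "rel_compact K"
  obtains K' where "compactin mtopology K'" "K \<subseteq> K'"
  using assms closure_of_subset unfolding rel_compact_def by (metis topspace_mtopology)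

lemma higsonI:
  assumes "f \<in> bounded_continuous"
    and "\<And>E e. E \<in> \<E> \<Longrightarrow> e > 0 \<Longrightarrow> \<exists>K. compactin mtopology K \<and>
       (\<forall>x y. (y, x) \<in> E - K \<times> K \<longrightarrow> cmod (f x - f y) < e)"
  shows "f \<in> higson_functions \<E>"
  using assms unfolding higson_functions_def by blast

lemma higsonE:
  assumes "f \<in> higson_functions \<E>" "E \<in> \<E>" "e > 0"
  obtains K where "compactin mtopology K" "\<And>x y. (y, x) \<in> E - K \<times> K \<Longrightarrow> cmod (f x - f y) < e"
  using assms unfolding higson_functions_def by blast

lemma higson_bounded:
  assumes "f \<in> higson_functions \<E>"
  obtains B where "B > 0" "\<And>x. x \<in> M \<Longrightarrow> cmod (f x) \<le> B"
proof -
  have "bounded (f ` M)"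
    using assms unfolding higson_functions_def bounded_continuous_def by blast
  then obtain B where "B > 0" "\<forall>z\<in>f ` M. cmod z \<le> B"
    unfolding bounded_pos by blast
  then show thesis using that by blast
qed

lemma higson_continuous:
  assumes "f \<in> higson_functions \<E>" shows "continuous_map mtopology euclidean f"
  using assms unfolding higson_functions_def bounded_continuous_def by blast

lemma higson_const: "(\<lambda>_. c) \<in> higson_functions \<E>"
  by (rule higsonI) (auto simp: bounded_continuous_def bounded_iff intro: exI[of _ "{}"])

lemma higson_combine:
  assumes f: "f \<in> higson_functions \<E>" and g: "g \<in> higson_functions \<E>"
    and h: "h \<in> bounded_continuous" and sub: "\<And>E. E \<in> \<E> \<Longrightarrow> E \<subseteq> M \<times> M"
    and C: "C > 0"
    and le: "\<And>x y. x \<in> M \<Longrightarrow> y \<in> M \<Longrightarrow>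
              cmod (h x - h y) \<le> C * cmod (f x - f y) + C * cmod (g x - g y)"
  shows "h \<in> higson_functions \<E>"
proof (rule higsonI[OF h])
  fix E and e :: real assume E: "E \<in> \<E>" and e: "e > 0"
  have e': "e / (2 * C) > 0" using e C by simp
  obtain K1 where K1: "compactin mtopology K1"
    "\<And>x y. (y, x) \<in> E - K1 \<times> K1 \<Longrightarrow> cmod (f x - f y) < e / (2 * C)"
    using higsonE[OF f E e'] by blast
  obtain K2 where K2: "compactin mtopology K2"
    "\<And>x y. (y, x) \<in> E - K2 \<times> K2 \<Longrightarrow> cmod (g x - g y) < e / (2 * C)"
    using higsonE[OF g E e'] by blast
  show "\<exists>K. compactin mtopology K \<and> (\<forall>x y. (y, x) \<in> E - K \<times> K \<longrightarrow> cmod (h x - h y) < e)"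
  proof (intro exI conjI allI impI)
    show "compactin mtopology (K1 \<union> K2)" using K1 K2 by (simp add: compactin_Un)
    fix x y assume xy: "(y, x) \<in> E - (K1 \<union> K2) \<times> (K1 \<union> K2)"
    have 1: "cmod (f x - f y) < e / (2 * C)" using xy K1(2) by blast
    have 2: "cmod (g x - g y) < e / (2 * C)" using xy K2(2) by blast
    have 3: "C * cmod (f x - f y) < e / 2" "C * cmod (g x - g y) < e / 2"
      using 1 2 C by (simp_all add: field_simps)
    have "x \<in> M" "y \<in> M" using sub[OF E] xy by auto
    then show "cmod (h x - h y) < e" using le[of x y] 3 by linarith
  qed
qed

lemma bounded_continuousI:
  assumes "continuous_map mtopology euclidean f" and "\<And>x. x \<in> M \<Longrightarrow> cmod (f x) \<le> B"
  shows "f \<in> bounded_continuous"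
  using assms unfolding bounded_continuous_def bounded_iff by blast

lemma higson_add:
  assumes f: "f \<in> higson_functions \<E>" and g: "g \<in> higson_functions \<E>"
    and sub: "\<And>E. E \<in> \<E> \<Longrightarrow> E \<subseteq> M \<times> M"
  shows "(\<lambda>x. f x + g x) \<in> higson_functions \<E>"
proof -
  obtain B where B: "\<And>x. x \<in> M \<Longrightarrow> cmod (f x) \<le> B" using higson_bounded[OF f] by blast
  obtain C where C: "\<And>x. x \<in> M \<Longrightarrow> cmod (g x) \<le> C" using higson_bounded[OF g] by blast
  show ?thesis
  proof (rule higson_combine[OF f g _ sub, where C = 1])
    show "(\<lambda>x. f x + g x) \<in> bounded_continuous"
    proof (rule bounded_continuousI)
      show "continuous_map mtopology euclidean (\<lambda>x. f x + g x)"
        by (intro continuous_map_add higson_continuous[OF f] higson_continuous[OF g])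
      show "cmod (f x + g x) \<le> B + C" if "x \<in> M" for x
        using B[OF that] C[OF that] norm_triangle_ineq[of "f x" "g x"] by linarith
    qed
    show "cmod (f x + g x - (f y + g y)) \<le> 1 * cmod (f x - f y) + 1 * cmod (g x - g y)" for x y
      using norm_triangle_ineq[of "f x - f y" "g x - g y"] by (simp add: algebra_simps)
  qed auto
qed

lemma continuous_map_mult_complex:
  fixes f g :: "'a \<Rightarrow> complex"
  assumes "continuous_map X euclidean f" "continuous_map X euclidean g"
  shows "continuous_map X euclidean (\<lambda>x. f x * g x)"
proof -
  have "continuous_map X (prod_topology euclidean euclidean) (\<lambda>x. (f x, g x))"
    by (rule continuous_map_pairedI[OF assms])
  then have "continuous_map X euclidean (\<lambda>x. (f x, g x))"
    by (simp only: prod_topology_euclidean)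
  moreover have "continuous_map euclidean euclidean (\<lambda>p. fst p * snd p :: complex)"
    by (simp add: continuous_intros)
  ultimately have "continuous_map X euclidean ((\<lambda>p. fst p * snd p) \<circ> (\<lambda>x. (f x, g x)))"
    by (rule continuous_map_compose)
  then show ?thesis by (simp add: o_def)
qed

lemma higson_mult:
  assumes f: "f \<in> higson_functions \<E>" and g: "g \<in> higson_functions \<E>"
    and sub: "\<And>E. E \<in> \<E> \<Longrightarrow> E \<subseteq> M \<times> M"
  shows "(\<lambda>x. f x * g x) \<in> higson_functions \<E>"
proof -
  obtain B where B: "B > 0" "\<And>x. x \<in> M \<Longrightarrow> cmod (f x) \<le> B" using higson_bounded[OF f] by blast
  obtain C where C: "C > 0" "\<And>x. x \<in> M \<Longrightarrow> cmod (g x) \<le> C" using higson_bounded[OF g] by blast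
  show ?thesis
  proof (rule higson_combine[OF f g _ sub, where C = "B + C"])
    show "(\<lambda>x. f x * g x) \<in> bounded_continuous"
    proof (rule bounded_continuousI)
      show "continuous_map mtopology euclidean (\<lambda>x. f x * g x)"
        by (intro continuous_map_mult_complex higson_continuous[OF f] higson_continuous[OF g])
      show "cmod (f x * g x) \<le> B * C" if "x \<in> M" for x
        using B C that by (simp add: norm_mult mult_mono')
    qed
    show "cmod (f x * g x - f y * g y) \<le> (B + C) * cmod (f x - f y) + (B + C) * cmod (g x - g y)"
      if xy: "x \<in> M" "y \<in> M" for x y
    proof -
      have "f x * g x - f y * g y = (f x - f y) * g x + f y * (g x - g y)"
        by (simp add: algebra_simps)
      then have "cmod (f x * g x - f y * g y) \<le> cmod (f x - f y) * cmod (g x) + cmod (f y) * cmod (g x - g y)"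
        by (metis norm_mult norm_triangle_ineq)
      also have "\<dots> \<le> cmod (f x - f y) * (B + C) + (B + C) * cmod (g x - g y)"
        using B C xy by (intro add_mono mult_left_mono mult_right_mono) (auto intro: order_trans[OF B(2)] order_trans[OF C(2)])
      finally show ?thesis by (simp add: mult.commute)
    qed
    show "B + C > 0" using B C by simp
  qed auto
qed

lemma higson_contraction:
  assumes f: "f \<in> higson_functions \<E>" and sub: "\<And>E. E \<in> \<E> \<Longrightarrow> E \<subseteq> M \<times> M"
    and p: "continuous_on UNIV p" and le: "\<And>z w. cmod (p z - p w) \<le> cmod (z - w)"
  shows "(\<lambda>x. p (f x)) \<in> higson_functions \<E>"
proof -
  obtain B where B: "\<And>x. x \<in> M \<Longrightarrow> cmod (f x) \<le> B" using higson_bounded[OF f] by blast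
  show ?thesis
  proof (rule higson_combine[OF f higson_const[of 0] _ sub, where C = 1])
    show "(\<lambda>x. p (f x)) \<in> bounded_continuous"
    proof (rule bounded_continuousI)
      show "continuous_map mtopology euclidean (\<lambda>x. p (f x))"
        using continuous_map_compose[OF higson_continuous[OF f], of euclidean p] p by (simp add: o_def)
      show "cmod (p (f x)) \<le> B + cmod (p 0)" if "x \<in> M" for x
        using B[OF that] le[of "f x" 0] norm_triangle_ineq[of "p (f x) - p 0" "p 0"] by simp
    qed
    show "cmod (p (f x) - p (f y)) \<le> 1 * cmod (f x - f y) + 1 * cmod (0 - 0)" for x y
      using le[of "f x" "f y"] by simp
  qed simp_all
qed

lemma higson_limit:
  assumes f: "f \<in> bounded_continuous" and sub: "\<And>E. E \<in> \<E> \<Longrightarrow> E \<subseteq> M \<times> M"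
    and app: "\<And>e. e > 0 \<Longrightarrow> \<exists>g\<in>higson_functions \<E>. \<forall>x\<in>M. cmod (f x - g x) < e"
  shows "f \<in> higson_functions \<E>"
proof (rule higsonI[OF f])
  fix E and e :: real assume E: "E \<in> \<E>" and e: "e > 0"
  obtain g where g: "g \<in> higson_functions \<E>" "\<And>x. x \<in> M \<Longrightarrow> cmod (f x - g x) < e / 3"
    using app[of "e/3"] e by auto
  obtain K where K: "compactin mtopology K"
    "\<And>x y. (y, x) \<in> E - K \<times> K \<Longrightarrow> cmod (g x - g y) < e / 3"
    using higsonE[OF g(1) E, of "e/3"] e by auto
  show "\<exists>K. compactin mtopology K \<and> (\<forall>x y. (y, x) \<in> E - K \<times> K \<longrightarrow> cmod (f x - f y) < e)"
  proof (intro exI conjI allI impI)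
    show "compactin mtopology K" by fact
    fix x y assume xy: "(y, x) \<in> E - K \<times> K"
    then have M: "x \<in> M" "y \<in> M" using sub[OF E] by auto
    have eq: "f x - f y = (f x - g x) + (g x - g y) - (f y - g y)" by simp
    have "cmod (f x - f y) \<le> cmod (f x - g x) + cmod (g x - g y) + cmod (f y - g y)"
      by (subst eq) (meson add_mono norm_triangle_ineq norm_triangle_ineq4 order_refl order_trans)
    with g(2)[OF M(1)] g(2)[OF M(2)] K(2)[OF xy] show "cmod (f x - f y) < e" by linarith
  qed
qed

definition bump :: "'a \<Rightarrow> real \<Rightarrow> 'a \<Rightarrow> complex" where
  "bump x r y = of_real (max 0 (1 - d x y / r))"

lemma bump_continuous:
  assumes "x \<in> M" "r > 0"
  shows "continuous_map mtopology euclidean (bump x r)"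
proof -
  have "continuous_map (mtopology_of Self) euclidean (\<lambda>y. mdist Self x y)"
    by (rule continuous_map_mdist) (use assms in auto)
  then have 1: "continuous_map mtopology euclideanreal (\<lambda>y. d x y)"
    by (simp add: mtopology_of_def)
  have "continuous_map euclideanreal euclidean (\<lambda>t. complex_of_real (max 0 (1 - t / r)))"
    using assms by (auto intro!: continuous_intros)
  from continuous_map_compose[OF 1 this] show ?thesis
    by (simp add: bump_def[abs_def] o_def)
qed

lemma bump_higson:
  assumes proper: "\<And>K. closedin mtopology K \<Longrightarrow> mbounded K \<Longrightarrow> compactin mtopology K"
    and x: "x \<in> M" and r: "r > 0"
    and \<E>: "\<And>E. E \<in> \<E> \<Longrightarrow> E \<subseteq> M \<times> M \<and> proper_relation E"
  shows "bump x r \<in> higson_functions \<E>"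
proof (rule higsonI)
  show "bump x r \<in> bounded_continuous"
    by (rule bounded_continuousI[OF bump_continuous[OF x r], of 1]) (use r in \<open>auto simp: bump_def\<close>)
  fix E and e :: real assume E: "E \<in> \<E>" and e: "e > 0"
  let ?B = "mcball x r"
  have B: "compactin mtopology ?B" by (simp add: proper mbounded_mcball)
  have z: "bump x r y = 0" if "y \<in> M" "y \<notin> ?B" for y
    using that x r by (auto simp: bump_def max_def field_simps)
  obtain K1 where K1: "compactin mtopology K1" "coarse_section E ?B \<subseteq> K1"
    using \<E>[OF E] rel_compact_compactin[OF B] rel_compactD unfolding proper_relation_def by metis
  obtain K2 where K2: "compactin mtopology K2" "coarse_section (E\<inverse>) ?B \<subseteq> K2"
    using \<E>[OF E] rel_compact_compactin[OF B] rel_compactD unfolding proper_relation_def by metis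
  show "\<exists>K. compactin mtopology K \<and>
     (\<forall>y z. (z, y) \<in> E - K \<times> K \<longrightarrow> cmod (bump x r y - bump x r z) < e)"
  proof (intro exI conjI allI impI)
    let ?K = "?B \<union> K1 \<union> K2"
    show "compactin mtopology ?K" using B K1 K2 by (simp add: compactin_Un)
    fix a b assume ab: "(b, a) \<in> E - ?K \<times> ?K"
    then have M: "a \<in> M" "b \<in> M" using \<E>[OF E] by auto
    have "a \<notin> ?B"
    proof
      assume a: "a \<in> ?B"
      then have "b \<in> coarse_section E ?B" using ab by (auto simp: coarse_section_def)
      then show False using a ab K1 by blast
    qed
    moreover have "b \<notin> ?B"
    proof
      assume b: "b \<in> ?B"
      then have "a \<in> coarse_section (E\<inverse>) ?B" using ab by (auto simp: coarse_section_def)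
      then show False using b ab K2 by blast
    qed
    ultimately show "cmod (bump x r a - bump x r b) < e" using z M e by simp
  qed
qed

text \<open>The evaluation embedding: its image closure realises the compactification of a proper
  metric space, so the hypothesis \<^const>\<open>sublinear_higson_compactification\<close> can be met.\<close>

definition higson_eval :: "'a \<Rightarrow> 'a \<Rightarrow> ('a \<Rightarrow> complex) \<Rightarrow> complex" where
  "higson_eval x0 x =
     (\<lambda>f. if f \<in> higson_functions (sublinear_coarse_structure x0) then f x else 0)"

lemma higson_eval_closure_compact: "compact (closure (higson_eval x0 ` M))"
proof -
  let ?C = "higson_functions (sublinear_coarse_structure x0)"
  obtain B where B: "\<And>f x. f \<in> ?C \<Longrightarrow> x \<in> M \<Longrightarrow> cmod (f x) \<le> B f" "\<And>f. f \<in> ?C \<Longrightarrow> B f > 0"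
    
  proof -
    have "\<forall>f\<in>?C. \<exists>B>0. \<forall>x\<in>M. cmod (f x) \<le> B" by (metis higson_bounded)
    then show thesis using that by metis
  qed
  let ?P = "PiE UNIV (\<lambda>f. cball (0::complex) (if f \<in> ?C then B f else 0))"
  have "compactin (product_topology (\<lambda>_. euclidean) UNIV) ?P"
    by (simp add: compactin_PiE compactin_euclidean_iff)
  then have cP: "compact ?P" by (simp add: euclidean_product_topology compactin_euclidean_iff)
  have "higson_eval x0 ` M \<subseteq> ?P" using B by (auto simp: higson_eval_def)
  then have "closure (higson_eval x0 ` M) \<subseteq> ?P"
    by (simp add: closure_minimal compact_imp_closed cP)
  then show ?thesis using compact_Int_closed[OF cP closed_closure, of "higson_eval x0 ` M"]
    by (simp add: inf.absorb2)
qed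

lemma higson_eval_embedding:
  assumes proper: "\<And>K. closedin mtopology K \<Longrightarrow> mbounded K \<Longrightarrow> compactin mtopology K"
  shows "embedding_map mtopology (top_of_set (closure (higson_eval x0 ` M))) (higson_eval x0)"
proof -
  let ?C = "higson_functions (sublinear_coarse_structure x0)"
  let ?e = "higson_eval x0"
  have bump: "bump x r \<in> ?C" if "x \<in> M" "r > 0" for x r
    by (rule bump_higson[OF proper that]) (auto simp: sublinear_coarse_structure_def)
  have cont0: "continuous_map mtopology (product_topology (\<lambda>_. euclidean) UNIV) ?e"
  proof (subst continuous_map_componentwise_UNIV, intro allI)
    fix f :: "'a \<Rightarrow> complex"
    show "continuous_map mtopology euclidean (\<lambda>x. ?e x f)"
      by (cases "f \<in> ?C") (auto simp: higson_eval_def higson_continuous)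
  qed
  then have cont: "continuous_map mtopology (top_of_set (?e ` M)) ?e"
    by (simp add: euclidean_product_topology continuous_map_in_subtopology)
  have sep: "?e y (bump x r) \<noteq> 0 \<longleftrightarrow> y \<in> mball x r" if "x \<in> M" "r > 0" "y \<in> M" for x y r
    using bump[OF that(1,2)] that by (auto simp: higson_eval_def bump_def max_def field_simps)
  have inj: "inj_on ?e M"
  proof (rule inj_onI, rule ccontr)
    fix x y assume xy: "x \<in> M" "y \<in> M" "?e x = ?e y" "x \<noteq> y"
    then have "d x y > 0" by simp
    then show False using sep[of x "d x y" x] sep[of x "d x y" y] xy by simp
  qed
  have opn: "open_map mtopology (top_of_set (?e ` M)) ?e"
    unfolding open_map_def
  proof (intro allI impI)
    fix U assume U: "openin mtopology U"
    define R where "R = {(x, r). x \<in> M \<and> r > 0 \<and> mball x r \<subseteq> U}"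
    define W where "W = (\<Union>(x, r)\<in>R. {p. p (bump x r) \<noteq> (0::complex)})"
    have "open {p. p (bump x r) \<noteq> (0::complex)}" for x r
      by (rule open_Collect_neq) (auto intro!: continuous_intros)
    then have "open W" unfolding W_def by auto
    moreover have "?e ` U = ?e ` M \<inter> W"
    proof
      show "?e ` U \<subseteq> ?e ` M \<inter> W"
      proof (rule image_subsetI)
        fix x assume x: "x \<in> U"
        then obtain r where r: "r > 0" "mball x r \<subseteq> U" using U by (auto simp: openin_mtopology)
        have xM: "x \<in> M" using U x openin_subset by fastforce
        then have "(x, r) \<in> R" "?e x (bump x r) \<noteq> 0" using r sep[of x r x] by (auto simp: R_def)
        then have "?e x \<in> W" unfolding W_def by blast
        then show "?e x \<in> ?e ` M \<inter> W" using xM by blast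
      qed
      show "?e ` M \<inter> W \<subseteq> ?e ` U"
      proof
        fix p assume p: "p \<in> ?e ` M \<inter> W"
        then obtain y where y: "y \<in> M" "p = ?e y" by auto
        then obtain x r where xr: "(x, r) \<in> R" "?e y (bump x r) \<noteq> 0"
          using p unfolding W_def by auto
        then have "y \<in> U" using sep[of x r y] y by (auto simp: R_def)
        then show "p \<in> ?e ` U" using y by simp
      qed
    qed
    ultimately show "openin (top_of_set (?e ` M)) (?e ` U)"
      by (metis openin_open)
  qed
  have "embedding_map mtopology (top_of_set (?e ` M)) ?e"
    by (rule injective_open_imp_embedding_map) (use cont opn inj in auto)
  then have "homeomorphic_map mtopology (top_of_set (?e ` M)) ?e"
    by (simp add: embedding_map_def subtopology_subtopology)
  then show ?thesis
    by (simp add: embedding_map_def subtopology_subtopology inf.absorb2 closure_subset)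
qed

lemma higson_eval_restrict:
  assumes g: "continuous_on (closure (higson_eval x0 ` M)) (g :: _ \<Rightarrow> real)"
    and bc: "(\<lambda>x. complex_of_real (g (higson_eval x0 x))) \<in> bounded_continuous"
  shows "(\<lambda>x. complex_of_real (g (higson_eval x0 x))) \<in>
           higson_functions (sublinear_coarse_structure x0)"
proof -
  let ?C = "higson_functions (sublinear_coarse_structure x0)"
  let ?e = "higson_eval x0"
  let ?Z = "closure (?e ` M)"
  have sub: "E \<subseteq> M \<times> M" if "E \<in> sublinear_coarse_structure x0" for E
    using that by (auto simp: sublinear_coarse_structure_def)
  define P where "P = (\<lambda>h :: (('a \<Rightarrow> complex) \<Rightarrow> complex) \<Rightarrow> real.
     continuous_on ?Z h \<and> (\<lambda>x. complex_of_real (h (?e x))) \<in> ?C)"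
  show ?thesis
  proof (rule higson_limit[OF bc sub])
    fix e :: real assume e: "e > 0"
    have "\<exists>h. P h \<and> (\<forall>z\<in>?Z. \<bar>g z - h z\<bar> < e)"
    proof (rule Stone_Weierstrass_HOL[where P = P, OF higson_eval_closure_compact _ _ _ _ _ g e])
      show "P (\<lambda>x. c)" for c by (simp add: P_def higson_const)
      show "continuous_on ?Z f" if "P f" for f using that by (simp add: P_def)
      show "P (\<lambda>x. f x + h x)" if "P f \<and> P h" for f h
        using that higson_add[OF _ _ sub] by (simp add: P_def continuous_on_add)
      show "P (\<lambda>x. f x * h x)" if "P f \<and> P h" for f h
        using that higson_mult[OF _ _ sub] by (simp add: P_def continuous_on_mult)
      show "\<exists>f. P f \<and> f x \<noteq> f y" if xy: "x \<in> ?Z \<and> y \<in> ?Z \<and> x \<noteq> y" for x y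
      proof -
        obtain f where f: "x f \<noteq> y f" using xy by blast
        have fC: "f \<in> ?C"
        proof (rule ccontr)
          assume nf: "f \<notin> ?C"
          have "closed {p. p f = (0::complex)}"
            by (rule closed_Collect_eq) (auto intro!: continuous_intros)
          moreover have "?e ` M \<subseteq> {p. p f = 0}" using nf by (auto simp: higson_eval_def)
          ultimately have "?Z \<subseteq> {p. p f = 0}" by (rule closure_minimal[rotated])
          then have "x f = 0" "y f = 0" using xy by blast+
          then show False using f by simp
        qed
        have cf: "continuous_on ?Z (\<lambda>p. p f)"
          by (rule continuous_on_subset[OF continuous_on_product_coordinates]) simp
        have R: "P (\<lambda>p. Re (p f))"
          unfolding P_def
        proof
          show "continuous_on ?Z (\<lambda>p. Re (p f))" by (rule continuous_on_Re[OF cf])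
          have "(\<lambda>x. complex_of_real (Re (f x))) \<in> ?C"
          proof (rule higson_contraction[OF fC sub, of "\<lambda>z. complex_of_real (Re z)"])
            show "continuous_on UNIV (\<lambda>z. complex_of_real (Re z))" by (intro continuous_intros)
            show "cmod (complex_of_real (Re z) - complex_of_real (Re w)) \<le> cmod (z - w)" for z w
              using abs_Re_le_cmod[of "z - w"] by (simp flip: of_real_diff)
          qed
          then show "(\<lambda>x. complex_of_real (Re (?e x f))) \<in> ?C"
            using fC by (simp add: higson_eval_def)
        qed
        have I: "P (\<lambda>p. Im (p f))"
          unfolding P_def
        proof
          show "continuous_on ?Z (\<lambda>p. Im (p f))" by (rule continuous_on_Im[OF cf])
          have "(\<lambda>x. complex_of_real (Im (f x))) \<in> ?C"
          proof (rule higson_contraction[OF fC sub, of "\<lambda>z. complex_of_real (Im z)"])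
            show "continuous_on UNIV (\<lambda>z. complex_of_real (Im z))" by (intro continuous_intros)
            show "cmod (complex_of_real (Im z) - complex_of_real (Im w)) \<le> cmod (z - w)" for z w
              using abs_Im_le_cmod[of "z - w"] by (simp flip: of_real_diff)
          qed
          then show "(\<lambda>x. complex_of_real (Im (?e x f))) \<in> ?C"
            using fC by (simp add: higson_eval_def)
        qed
        show ?thesis using R I f complex_eqI by metis
      qed
    qed
    then obtain h where h: "P h" "\<And>z. z \<in> ?Z \<Longrightarrow> \<bar>g z - h z\<bar> < e" by blast
    have "\<forall>x\<in>M. cmod (complex_of_real (g (?e x)) - complex_of_real (h (?e x))) < e"
    proof
      fix x assume "x \<in> M"
      then have "?e x \<in> ?Z" by (simp add: closure_subset[THEN subsetD])
      then show "cmod (complex_of_real (g (?e x)) - complex_of_real (h (?e x))) < e"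
        using h(2) by (metis norm_of_real of_real_diff)
    qed
    then show "\<exists>k\<in>?C. \<forall>x\<in>M. cmod (complex_of_real (g (?e x)) - k x) < e"
      using h(1) unfolding P_def by (intro bexI[of _ "\<lambda>x. complex_of_real (h (?e x))"]) auto
  qed
qed

lemma sublinear_higson_compactification_exists:
  assumes proper: "\<And>K. closedin mtopology K \<Longrightarrow> mbounded K \<Longrightarrow> compactin mtopology K"
  shows "sublinear_higson_compactification x0
           (top_of_set (closure (higson_eval x0 ` M))) (higson_eval x0)"
  unfolding sublinear_higson_compactification_def
proof (intro conjI ballI)
  let ?C = "higson_functions (sublinear_coarse_structure x0)"
  let ?e = "higson_eval x0"
  let ?Z = "closure (?e ` M)"
  have sub: "E \<subseteq> M \<times> M" if "E \<in> sublinear_coarse_structure x0" for E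
    using that by (auto simp: sublinear_coarse_structure_def)
  show "compactification mtopology (top_of_set ?Z) ?e"
    unfolding compactification_def
  proof (intro conjI)
    show "compact_space (top_of_set ?Z)"
      using higson_eval_closure_compact
      by (metis compact_space_subtopology compactin_euclidean_iff)
    show "Hausdorff_space (top_of_set ?Z)"
      by (simp add: Hausdorff_space_subtopology Hausdorff_space_t2)
    show "embedding_map mtopology (top_of_set ?Z) ?e"
      by (rule higson_eval_embedding[OF proper])
    show "top_of_set ?Z closure_of ?e ` topspace mtopology = topspace (top_of_set ?Z)"
      by (simp add: closure_of_subtopology inf.absorb2 closure_subset)
  qed
  fix f assume f: "f \<in> bounded_continuous"
  show "(\<exists>g. continuous_map (top_of_set ?Z) euclidean g \<and> (\<forall>x\<in>M. g (?e x) = f x)) \<longleftrightarrow> f \<in> ?C"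
  proof
    assume "f \<in> ?C"
    moreover have "continuous_on ?Z (\<lambda>p. p f)"
      by (rule continuous_on_subset[OF continuous_on_product_coordinates]) simp
    ultimately show "\<exists>g. continuous_map (top_of_set ?Z) euclidean g \<and> (\<forall>x\<in>M. g (?e x) = f x)"
      by (intro exI[of _ "\<lambda>p. p f"]) (simp add: higson_eval_def)
  next
    assume "\<exists>g. continuous_map (top_of_set ?Z) euclidean g \<and> (\<forall>x\<in>M. g (?e x) = f x)"
    then obtain g where g: "continuous_on ?Z g" "\<And>x. x \<in> M \<Longrightarrow> g (?e x) = f x" by auto
    have emb: "continuous_map mtopology (top_of_set ?Z) ?e"
    proof -
      have "embedding_map mtopology (top_of_set ?Z) ?e"
        by (rule higson_eval_embedding[OF proper])
      then have "continuous_map mtopology (subtopology (top_of_set ?Z) (?e ` topspace mtopology)) ?e"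
        unfolding embedding_map_def by (rule homeomorphic_imp_continuous_map)
      then show ?thesis by (rule continuous_map_into_fulltopology)
    qed
    obtain B where B: "\<And>x. x \<in> M \<Longrightarrow> cmod (f x) \<le> B"
      using f unfolding bounded_continuous_def bounded_iff by blast
    have bc: "(\<lambda>x. complex_of_real (u (g (?e x)))) \<in> bounded_continuous"
      if u: "continuous_on UNIV u" "\<And>z. \<bar>u z\<bar> \<le> cmod z" for u
    proof (rule bounded_continuousI)
      have "continuous_on ?Z (\<lambda>z. complex_of_real (u (g z)))"
        using g(1) u(1) by (intro continuous_on_of_real continuous_on_compose2[OF u(1)]) auto
      then have "continuous_map mtopology euclidean ((\<lambda>z. complex_of_real (u (g z))) \<circ> ?e)"
        by (intro continuous_map_compose[OF emb]) simp
      then show "continuous_map mtopology euclidean (\<lambda>x. complex_of_real (u (g (?e x))))"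
        by (simp add: o_def)
      show "cmod (complex_of_real (u (g (?e x)))) \<le> B" if "x \<in> M" for x
        using u(2)[of "f x"] B[OF that] g(2)[OF that] by simp
    qed
    have 1: "(\<lambda>x. complex_of_real (Re (g (?e x)))) \<in> ?C"
      by (rule higson_eval_restrict[where g = "\<lambda>z. Re (g z)"])
         (intro continuous_intros g(1) bc abs_Re_le_cmod)+
    have 2: "(\<lambda>x. complex_of_real (Im (g (?e x)))) \<in> ?C"
      by (rule higson_eval_restrict[where g = "\<lambda>z. Im (g z)"])
         (intro continuous_intros g(1) bc abs_Im_le_cmod)+
    have 3: "(\<lambda>x. complex_of_real (Re (g (?e x))) + \<i> * complex_of_real (Im (g (?e x)))) \<in> ?C"
      by (rule higson_add[OF 1 higson_mult[OF higson_const 2 sub] sub])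
    show "f \<in> ?C"
    proof (rule higson_limit[OF f sub])
      fix e :: real assume "e > 0"
      then show "\<exists>h\<in>?C. \<forall>x\<in>M. cmod (f x - h x) < e"
        by (intro bexI[OF _ 3]) (simp add: g(2) flip: complex_eq)
    qed
  qed
qed

end

section \<open>Word metrics are proper\<close>

context group
begin

lemma foldr_mult_closed: "set ws \<subseteq> carrier G \<Longrightarrow> foldr (\<otimes>) ws \<one> \<in> carrier G"
  by (induction ws) auto

lemma foldr_mult_append:
  "set vs \<subseteq> carrier G \<Longrightarrow> set ws \<subseteq> carrier G \<Longrightarrow>
     foldr (\<otimes>) (vs @ ws) \<one> = foldr (\<otimes>) vs \<one> \<otimes> foldr (\<otimes>) ws \<one>"
proof (induction vs)
  case Nil
  then show ?case using foldr_mult_closed by simp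
next
  case (Cons v vs)
  then show ?case
    using foldr_mult_closed[of vs] foldr_mult_closed[of ws] by (simp add: m_assoc)
qed

lemma foldr_mult_inv:
  "set ws \<subseteq> carrier G \<Longrightarrow> foldr (\<otimes>) (rev (map (\<lambda>s. inv s) ws)) \<one> = inv (foldr (\<otimes>) ws \<one>)"
proof (induction ws)
  case Nil
  then show ?case by simp
next
  case (Cons w ws)
  have "foldr (\<otimes>) (rev (map (\<lambda>s. inv s) ws) @ [inv w]) \<one> =
        foldr (\<otimes>) (rev (map (\<lambda>s. inv s) ws)) \<one> \<otimes> foldr (\<otimes>) [inv w] \<one>"
    using Cons.prems by (intro foldr_mult_append) auto
  with Cons show ?case using foldr_mult_closed[of ws] by (simp add: inv_mult_group)
qed

context
  fixes S assumes S: "S \<subseteq> carrier G" and gen: "generate G S = carrier G"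
begin

abbreviation (input) letters where "letters \<equiv> S \<union> (\<lambda>s. inv s) ` S"

lemma letters_carrier: "letters \<subseteq> carrier G"
  using S by auto

lemma word_exists:
  assumes "g \<in> carrier G"
  obtains ws where "set ws \<subseteq> letters" "foldr (\<otimes>) ws \<one> = g"
proof -
  have "g \<in> generate G S" using assms gen by simp
  then have "\<exists>ws. set ws \<subseteq> letters \<and> foldr (\<otimes>) ws \<one> = g"
  proof induction
    case one
    show ?case by (rule exI[of _ "[]"]) simp
  next
    case (incl h)
    then show ?case using S by (intro exI[of _ "[h]"]) auto
  next
    case (inv h)
    then show ?case using S by (intro exI[of _ "[inv h]"]) auto
  next
    case (eng h1 h2)
    then obtain vs ws where *: "set vs \<subseteq> letters" "foldr (\<otimes>) vs \<one> = h1"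
      "set ws \<subseteq> letters" "foldr (\<otimes>) ws \<one> = h2" by blast
    have "foldr (\<otimes>) (vs @ ws) \<one> = h1 \<otimes> h2"
      using foldr_mult_append[of vs ws] * letters_carrier by blast
    with * show ?case by (intro exI[of _ "vs @ ws"]) auto
  qed
  then show thesis using that by blast
qed

lemma word_length_le:
  assumes "set ws \<subseteq> letters"
  shows "word_length G S (foldr (\<otimes>) ws \<one>) \<le> length ws"
  unfolding word_length_def by (rule Least_le) (use assms in blast)

lemma word_length_witness:
  assumes "g \<in> carrier G"
  obtains ws where "length ws = word_length G S g" "set ws \<subseteq> letters" "foldr (\<otimes>) ws \<one> = g"
proof -
  let ?P = "\<lambda>n. \<exists>ws. length ws = n \<and> set ws \<subseteq> letters \<and> foldr (\<otimes>) ws \<one> = g"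
  obtain ws where "set ws \<subseteq> letters" "foldr (\<otimes>) ws \<one> = g"
    using word_exists[OF assms] .
  then have "?P (length ws)" by blast
  then have "?P (LEAST n. ?P n)" by (rule LeastI)
  then show thesis using that unfolding word_length_def by blast
qed

lemma word_length_one: "word_length G S \<one> = 0"
  using word_length_le[of "[]"] by simp

lemma word_length_eq_0: "g \<in> carrier G \<Longrightarrow> word_length G S g = 0 \<Longrightarrow> g = \<one>"
  by (rule word_length_witness[of g]) auto

lemma word_length_mult:
  assumes "g \<in> carrier G" "h \<in> carrier G"
  shows "word_length G S (g \<otimes> h) \<le> word_length G S g + word_length G S h"
proof -
  obtain vs where vs: "length vs = word_length G S g" "set vs \<subseteq> letters" "foldr (\<otimes>) vs \<one> = g"
    using word_length_witness[OF assms(1)] .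
  obtain ws where ws: "length ws = word_length G S h" "set ws \<subseteq> letters" "foldr (\<otimes>) ws \<one> = h"
    using word_length_witness[OF assms(2)] .
  have "foldr (\<otimes>) (vs @ ws) \<one> = g \<otimes> h"
    using foldr_mult_append[of vs ws] vs ws letters_carrier by blast
  then show ?thesis using word_length_le[of "vs @ ws"] vs ws by auto
qed

lemma word_length_inv_le:
  assumes "g \<in> carrier G"
  shows "word_length G S (inv g) \<le> word_length G S g"
proof -
  obtain vs where vs: "length vs = word_length G S g" "set vs \<subseteq> letters" "foldr (\<otimes>) vs \<one> = g"
    using word_length_witness[OF assms(1)] .
  have "inv (inv s) = s" if "s \<in> S" for s using that S by auto
  then have "(\<lambda>s. inv s) ` letters \<subseteq> letters" by (auto simp: image_iff)
  then have "set (rev (map (\<lambda>s. inv s) vs)) \<subseteq> letters"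
    using vs(2) by (metis image_mono order_trans set_map set_rev)
  from word_length_le[OF this] show ?thesis
    using foldr_mult_inv[of vs] vs letters_carrier by auto
qed

lemma word_length_inv:
  assumes "g \<in> carrier G"
  shows "word_length G S (inv g) = word_length G S g"
  using word_length_inv_le[OF assms] word_length_inv_le[of "inv g"] assms by simp

lemma Metric_space_word_dist: "Metric_space (carrier G) (word_dist G S)"
proof
  show "0 \<le> word_dist G S x y" for x y by (simp add: word_dist_def)
  show "word_dist G S x y = word_dist G S y x" for x y
  proof (cases "x \<in> carrier G \<and> y \<in> carrier G")
    case True
    then have "inv (inv x \<otimes> y) = inv y \<otimes> x" by (simp add: inv_mult_group)
    then show ?thesis using True word_length_inv[of "inv x \<otimes> y"] by (simp add: word_dist_def)
  qed (auto simp: word_dist_def)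
  show "word_dist G S x y = 0 \<longleftrightarrow> x = y" if xy: "x \<in> carrier G" "y \<in> carrier G" for x y
  proof
    assume "word_dist G S x y = 0"
    then have "inv x \<otimes> y = \<one>" using xy by (intro word_length_eq_0) (auto simp: word_dist_def)
    then show "x = y" using xy by (metis inv_closed inv_equality inv_inv)
  qed (use xy in \<open>simp add: word_dist_def word_length_one\<close>)
  show "word_dist G S x z \<le> word_dist G S x y + word_dist G S y z"
    if xyz: "x \<in> carrier G" "y \<in> carrier G" "z \<in> carrier G" for x y z
  proof -
    have "inv x \<otimes> z = (inv x \<otimes> y) \<otimes> (inv y \<otimes> z)"
      using xyz by (metis inv_closed inv_solve_left m_assoc m_closed)
    then show ?thesis
      using word_length_mult[of "inv x \<otimes> y" "inv y \<otimes> z"] xyz by (simp add: word_dist_def)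
  qed
qed

lemma word_dist_proper:
  assumes fin: "finite S" and K: "Metric_space.mbounded (carrier G) (word_dist G S) K"
  shows "finite K"
    and "compactin (Metric_space.mtopology (carrier G) (word_dist G S)) K"
proof -
  interpret W: Metric_space "carrier G" "word_dist G S" by (rule Metric_space_word_dist)
  show fK: "finite K"
  proof (cases "K = {}")
    case False
    then obtain x B where xB: "x \<in> carrier G" "K \<subseteq> carrier G" "\<And>y. y \<in> K \<Longrightarrow> word_dist G S x y \<le> B"
      using K unfolding W.mbounded by auto
    obtain n :: nat where n: "B \<le> real n" using real_arch_simple by blast
    have "K \<subseteq> (\<lambda>ws. x \<otimes> foldr (\<otimes>) ws \<one>) ` {ws. set ws \<subseteq> letters \<and> length ws \<le> n}"
    proof
      fix y assume y: "y \<in> K"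
      then have yG: "y \<in> carrier G" using xB by blast
      obtain ws where ws: "length ws = word_length G S (inv x \<otimes> y)" "set ws \<subseteq> letters"
        "foldr (\<otimes>) ws \<one> = inv x \<otimes> y"
        using word_length_witness[of "inv x \<otimes> y"] xB(1) yG by auto
      have "real (length ws) \<le> n" using xB(3)[OF y] xB(1) yG ws n by (simp add: word_dist_def)
      moreover have "y = x \<otimes> foldr (\<otimes>) ws \<one>"
        using ws(3) xB(1) yG by (metis inv_solve_left' m_closed inv_closed)
      ultimately show "y \<in> (\<lambda>ws. x \<otimes> foldr (\<otimes>) ws \<one>) ` {ws. set ws \<subseteq> letters \<and> length ws \<le> n}"
        using ws(2) by auto
    qed
    moreover have "finite {ws. set ws \<subseteq> letters \<and> length ws \<le> n}"
      using fin by (intro finite_lists_length_le) auto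
    ultimately show ?thesis by (meson finite_imageI finite_subset)
  qed simp
  show "compactin W.mtopology K"
    using fK K by (simp add: finite_imp_compactin W.mbounded_subset_mspace)
qed

text \<open>So every finitely generated group has a sublinear Higson compactification.\<close>

lemma word_dist_higson_compactification:
  assumes "finite S"
  shows "\<exists>(Z :: (('a \<Rightarrow> complex) \<Rightarrow> complex) topology) \<iota>.
    Metric_space.sublinear_higson_compactification (carrier G) (word_dist G S) x0 Z \<iota>"
  using Metric_space.sublinear_higson_compactification_exists[OF Metric_space_word_dist
      word_dist_proper(2)[OF assms]] by blast

end

end

end

(* Write |x| for the distance to the base point.  Distances are measured relative to it by
   jdist x y = ln (1 + d x y / min |x| |y|), which is a metric off the base point; the sublinear
   Higson functions are the bounded functions that are uniformly continuous at infinity for it.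
   Covers of multiplicity n + 1 are traded for colourings by n + 1 colours in which chains of short
   steps through points of one colour stay bounded: such colourings can be merged without a
   further colour when the scales are far enough apart.

   Call (C n) the existence, for every delta, of an (n+1)-colouring of the complement of some ball in
   which the monochromatic jdist-chains of sufficiently short steps have diameter at most delta.
   AN-asdim <= n implies (C n) by merging dyadic annuli, and (C n) implies dim <= n because the extensions
   of uniformly continuous functions separate colour classes in the corona.  If dim <= n and (C N)
   holds for some N, then a finite cover of the corona made from the N + 1 colours has an open
   refinement of multiplicity n + 1, which pulls back to (C n).  Finally, if the group is infinite,
   any ball of radius r can be translated to distance about 2r from the base point, where jdist is
   comparable to d / r, so (C n) controls all balls at scales proportional to their radius;
   these local colourings are merged along the N + 1 colours of a colouring for AN-asdim <= N. *)
theory Submission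
  imports Defs
begin

section \<open>Chains and colourings\<close>

text \<open>Covers of the corona carry no notion of size, so a refinement of multiplicity n + 1 by
  itself bounds nothing in the group. This is where finiteness of the dimension enters: (C N)
  supplies a finite cover whose members already fall into small pieces, and every refinement
  inherits that smallness. The same N bounds the number of merges at the end. Each merge costs an
  unspecified constant, because (C n) ties the step \<eta> to the bound \<delta> in no particular
  way; since N + 1 merges are made at every scale, the total loss is still a constant independent of
  the scale. Linear control is therefore not read off from the corona: it comes from translating
  finitely many pairs (\<eta>, \<delta>) to all scales, and this is where left invariance of the
  word metric is used.\<close>

definition chain_step :: "('a \<Rightarrow> 'a \<Rightarrow> real) \<Rightarrow> real \<Rightarrow> 'a set \<Rightarrow> ('a \<times> 'a) set" where
  "chain_step d r A = {(x, y). x \<in> A \<and> y \<in> A \<and> d x y \<le> r}"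

text \<open>The sets reached by such chains are the \<open>r\<close>-components of \<open>A\<close>;
  leaving them implicit avoids choosing families of \<open>r\<close>-disjoint sets. The distance is
  an argument because both \<open>d\<close> and \<open>jdist x0\<close> are used.\<close>

definition chain_bounded :: "('a \<Rightarrow> 'a \<Rightarrow> real) \<Rightarrow> real \<Rightarrow> real \<Rightarrow> 'a set \<Rightarrow> bool" where
  "chain_bounded d r D A \<longleftrightarrow> (\<forall>x\<in>A. \<forall>y. (x, y) \<in> (chain_step d r A)\<^sup>* \<longrightarrow> d x y \<le> D)"

definition chain_colorable ::
  "('a \<Rightarrow> 'a \<Rightarrow> real) \<Rightarrow> nat \<Rightarrow> real \<Rightarrow> real \<Rightarrow> 'a set \<Rightarrow> bool" where
  "chain_colorable d n r D A \<longleftrightarrow>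
     (\<exists>C. (\<forall>x\<in>A. C x \<le> n) \<and> (\<forall>i\<le>n. chain_bounded d r D {x \<in> A. C x = i}))"

lemma chain_boundedI:
  assumes "\<And>x y. x \<in> A \<Longrightarrow> (x, y) \<in> (chain_step d r A)\<^sup>* \<Longrightarrow> d x y \<le> D"
  shows "chain_bounded d r D A"
  using assms unfolding chain_bounded_def by blast

lemma chain_boundedD:
  "chain_bounded d r D A \<Longrightarrow> x \<in> A \<Longrightarrow> (x, y) \<in> (chain_step d r A)\<^sup>* \<Longrightarrow> d x y \<le> D"
  unfolding chain_bounded_def by blast

lemma chain_step_mono: "r \<le> r' \<Longrightarrow> A \<subseteq> A' \<Longrightarrow> chain_step d r A \<subseteq> chain_step d r' A'"
  unfolding chain_step_def by auto

lemma chain_end: "(x, y) \<in> (chain_step d r A)\<^sup>* \<Longrightarrow> x \<in> A \<Longrightarrow> y \<in> A"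
  by (induction rule: rtrancl_induct) (auto simp: chain_step_def)

lemma chain_map:
  assumes "(x, y) \<in> (chain_step d r A)\<^sup>*" "x \<in> A"
    and "\<And>x y. x \<in> A \<Longrightarrow> y \<in> A \<Longrightarrow> d x y \<le> r \<Longrightarrow> e (f x) (f y) \<le> s"
    and "f ` A \<subseteq> B"
  shows "(f x, f y) \<in> (chain_step e s B)\<^sup>*"
  using assms(1)
proof (induction rule: rtrancl_induct)
  case (step y z)
  then have "(f y, f z) \<in> chain_step e s B"
    using assms(3,4) unfolding chain_step_def by auto
  then show ?case using step by (meson rtrancl.rtrancl_into_rtrancl)
qed simp

lemma chain_bounded_mono:
  assumes "chain_bounded d r D A" "r' \<le> r" "D \<le> D'" "A' \<subseteq> A"
  shows "chain_bounded d r' D' A'"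
proof (rule chain_boundedI)
  fix x y assume "x \<in> A'" "(x, y) \<in> (chain_step d r' A')\<^sup>*"
  then show "d x y \<le> D'"
    using chain_boundedD[OF assms(1), of x y] rtrancl_mono[OF chain_step_mono[OF assms(2,4), of d]]
      assms(3,4) by fastforce
qed

lemma chain_bounded_diam:
  "(\<And>x y. x \<in> A \<Longrightarrow> y \<in> A \<Longrightarrow> d x y \<le> D) \<Longrightarrow> chain_bounded d r D A"
  by (rule chain_boundedI) (auto dest: chain_end)

lemma chain_bounded_map:
  assumes "chain_bounded e s D' B"
    and "\<And>x y. x \<in> A \<Longrightarrow> y \<in> A \<Longrightarrow> d x y \<le> r \<Longrightarrow> e (f x) (f y) \<le> s"
    and "\<And>x y. x \<in> A \<Longrightarrow> y \<in> A \<Longrightarrow> e (f x) (f y) \<le> D' \<Longrightarrow> d x y \<le> D"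
    and "f ` A \<subseteq> B"
  shows "chain_bounded d r D A"
proof (rule chain_boundedI)
  fix x y assume xy: "x \<in> A" "(x, y) \<in> (chain_step d r A)\<^sup>*"
  have "(f x, f y) \<in> (chain_step e s B)\<^sup>*"
    by (rule chain_map[where d = d and e = e and f = f, OF xy(2,1) assms(2,4)])
  then have "e (f x) (f y) \<le> D'" using chain_boundedD[OF assms(1)] xy(1) assms(4) by blast
  then show "d x y \<le> D" using assms(3) xy chain_end by metis
qed

text \<open>A chain cannot leave the label class of its first point, so chains inside a single class
  are all that must be bounded.\<close>

lemma chain_bounded_labels:
  assumes lab: "\<And>x y. x \<in> A \<Longrightarrow> y \<in> A \<Longrightarrow> d x y \<le> r \<Longrightarrow> lab x = lab y"
    and "\<And>l. chain_bounded d r D {x \<in> A. lab x = l}"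
  shows "chain_bounded d r D A"
proof (rule chain_boundedI)
  fix x y assume x: "x \<in> A" and "(x, y) \<in> (chain_step d r A)\<^sup>*"
  from this(2) have "(x, y) \<in> (chain_step d r {z \<in> A. lab z = lab x})\<^sup>* \<and> y \<in> A \<and> lab y = lab x"
  proof (induction rule: rtrancl_induct)
    case (step y z)
    then have "z \<in> A" "lab z = lab x" using lab[of y z] by (auto simp: chain_step_def)
    moreover from this have "(y, z) \<in> chain_step d r {z \<in> A. lab z = lab x}"
      using step by (auto simp: chain_step_def)
    ultimately show ?case using step by (meson rtrancl.rtrancl_into_rtrancl)
  qed (use x in simp)
  then show "d x y \<le> D" using chain_boundedD[OF assms(2)[of "lab x"], of x y] x by blast
qed

lemma chain_colorableE:
  assumes "chain_colorable d n r D A"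
  obtains C where "\<And>x. x \<in> A \<Longrightarrow> C x \<le> n"
    "\<And>i. i \<le> n \<Longrightarrow> chain_bounded d r D {x \<in> A. C x = i}"
  using assms unfolding chain_colorable_def by blast

lemma chain_colorableI:
  assumes "\<And>x. x \<in> A \<Longrightarrow> C x \<le> n"
    "\<And>i. i \<le> n \<Longrightarrow> chain_bounded d r D {x \<in> A. C x = i}"
  shows "chain_colorable d n r D A"
  using assms unfolding chain_colorable_def by blast

lemma chain_colorable_empty: "chain_colorable d n r D {}"
  by (rule chain_colorableI[where C = "\<lambda>_. 0"]) (auto simp: chain_bounded_def)

lemma chain_colorable_map:
  assumes "chain_colorable e n s D' B"
    and "\<And>x y. x \<in> A \<Longrightarrow> y \<in> A \<Longrightarrow> d x y \<le> r \<Longrightarrow> e (f x) (f y) \<le> s"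
    and "\<And>x y. x \<in> A \<Longrightarrow> y \<in> A \<Longrightarrow> e (f x) (f y) \<le> D' \<Longrightarrow> d x y \<le> D"
    and "f ` A \<subseteq> B"
  shows "chain_colorable d n r D A"
proof -
  obtain C where C: "\<And>x. x \<in> B \<Longrightarrow> C x \<le> n"
    "\<And>i. i \<le> n \<Longrightarrow> chain_bounded e s D' {x \<in> B. C x = i}"
    using chain_colorableE[OF assms(1)] by blast
  show ?thesis
  proof (rule chain_colorableI[where C = "C \<circ> f"])
    fix i assume "i \<le> n"
    show "chain_bounded d r D {x \<in> A. (C \<circ> f) x = i}"
      by (rule chain_bounded_map[where f = f, OF C(2)[OF \<open>i \<le> n\<close>]]) (use assms(2-4) in auto)
  qed (use C(1) assms(4) in auto)
qed

lemma chain_colorable_mono: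
  assumes "chain_colorable d n r D A" "r' \<le> r" "D \<le> D'" "A' \<subseteq> A"
  shows "chain_colorable d n r' D' A'"
  by (rule chain_colorable_map[where f = "\<lambda>x. x", OF assms(1)]) (use assms(2-4) in auto)

text \<open>Steps of length at most \<open>r\<close> never join different label classes, so the
  classes can be coloured independently with the same colours.\<close>

lemma chain_colorable_labels:
  assumes lab: "\<And>x y. x \<in> A \<Longrightarrow> y \<in> A \<Longrightarrow> d x y \<le> r \<Longrightarrow> lab x = lab y"
    and "\<And>l. chain_colorable d n r D {x \<in> A. lab x = l}"
  shows "chain_colorable d n r D A"
proof -
  have "\<forall>l. \<exists>C. (\<forall>x\<in>{x \<in> A. lab x = l}. C x \<le> n) \<and>
      (\<forall>i\<le>n. chain_bounded d r D {x \<in> {x \<in> A. lab x = l}. C x = i})"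
    using assms(2) unfolding chain_colorable_def by blast
  from choice[OF this] obtain C where
    C: "\<And>l. (\<forall>x\<in>{x \<in> A. lab x = l}. C l x \<le> n) \<and>
      (\<forall>i\<le>n. chain_bounded d r D {x \<in> {x \<in> A. lab x = l}. C l x = i})" by blast
  show ?thesis
  proof (rule chain_colorableI[where C = "\<lambda>x. C (lab x) x"])
    fix i assume i: "i \<le> n"
    show "chain_bounded d r D {x \<in> A. C (lab x) x = i}"
    proof (rule chain_bounded_labels[where lab = lab])
      have "{x \<in> {x \<in> A. lab x = l}. C l x = i} = {x \<in> {x \<in> A. C (lab x) x = i}. lab x = l}" for l
        by blast
      then show "chain_bounded d r D {x \<in> {x \<in> A. C (lab x) x = i}. lab x = l}" for l
        using C[of l] i by metis
    qed (use lab in blast)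
  qed (use C in blast)
qed

section \<open>Merging, thickening and refining chain-bounded sets\<close>

context Metric_space
begin

lemma chain_class_eq:
  assumes "(x, y) \<in> chain_step d r A"
  shows "{z. (x, z) \<in> (chain_step d r A)\<^sup>*} = {z. (y, z) \<in> (chain_step d r A)\<^sup>*}"
proof -
  have "(y, x) \<in> chain_step d r A" using assms by (auto simp: chain_step_def commute)
  then show ?thesis using assms by (auto intro: converse_rtrancl_into_rtrancl)
qed

text \<open>Follow a \<open>t\<close>-chain in the union. Between two successive visits to
  \<open>B\<close> it stays in \<open>A\<close> and moves by at most \<open>D\<close>, so the visits
  are at most \<open>D + 2 * t\<close> apart and form a \<open>T\<close>-chain in \<open>B\<close>,
  which is \<open>m\<close>-bounded. The parts before the first and after the last visit contribute
  at most \<open>D + t\<close> each.\<close>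

lemma chain_bounded_union:
  assumes AB: "A \<subseteq> M" "B \<subseteq> M" and A: "chain_bounded d t D A" and B: "chain_bounded d T m B"
    and T: "D + 2 * t \<le> T" and t: "0 \<le> t" and D: "0 \<le> D" and m: "0 \<le> m"
  shows "chain_bounded d t (m + 2 * (D + t)) (A \<union> B)"
proof (rule chain_boundedI)
  fix x y assume x: "x \<in> A \<union> B" and xy: "(x, y) \<in> (chain_step d t (A \<union> B))\<^sup>*"
  \<comment> \<open>\<open>near b y\<close> records the tail after the last visit \<open>b\<close>
    to \<open>B\<close>: either the chain is still at \<open>b\<close>, or it has stepped into
    \<open>A\<close> and stayed there. Points of both sets count as points of
    \<open>A\<close>.\<close>
  define near where "near b y \<longleftrightarrow> b = y \<or> (\<exists>a\<in>A. d b a \<le> t \<and> (a, y) \<in> (chain_step d t A)\<^sup>*)" for b y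
  have nearD: "d b y \<le> D + t" if n: "near b y" and b: "b \<in> B" for b y
  proof (cases "b = y")
    case True
    then show ?thesis using b AB t D by auto
  next
    case False
    then obtain a where a: "a \<in> A" "d b a \<le> t" "(a, y) \<in> (chain_step d t A)\<^sup>*"
      using n near_def by blast
    have "y \<in> A" using chain_end[OF a(3,1)] .
    then have "d b y \<le> d b a + d a y" using AB a(1) b by (intro triangle) auto
    also have "\<dots> \<le> t + D" using a chain_boundedD[OF A] by (intro add_mono) auto
    finally show ?thesis by simp
  qed
  from xy have "(x \<in> A \<and> (x, y) \<in> (chain_step d t A)\<^sup>*) \<or>
    (\<exists>b1\<in>B. \<exists>b2\<in>B. (b1, b2) \<in> (chain_step d T B)\<^sup>* \<and> d x b1 \<le> D + t \<and> near b2 y)"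
  proof (induction rule: rtrancl_induct)
    case base
    show ?case
    proof (cases "x \<in> A")
      case False
      then show ?thesis using x AB t D unfolding near_def by (intro disjI2 bexI[of _ x]) auto
    qed auto
  next
    case (step y z)
    have yz: "y \<in> A \<union> B" "z \<in> A \<union> B" "d y z \<le> t" using step.hyps by (auto simp: chain_step_def)
    have M: "x \<in> M" "y \<in> M" "z \<in> M" using x yz AB by auto
    from step.IH show ?case
    proof (elim disjE conjE bexE)
      assume xA: "x \<in> A" and ch: "(x, y) \<in> (chain_step d t A)\<^sup>*"
      then have yA: "y \<in> A" by (rule chain_end[rotated])
      show ?thesis
      proof (cases "z \<in> A")
        case True
        then have "(y, z) \<in> chain_step d t A" using yA yz by (auto simp: chain_step_def)
        then show ?thesis using xA ch by (meson rtrancl.rtrancl_into_rtrancl)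
      next
        case False
        then have "z \<in> B" using yz by auto
        moreover have "d x z \<le> D + t"
          using chain_boundedD[OF A xA ch] triangle[OF M(1,2,3)] yz(3) by linarith
        ultimately show ?thesis unfolding near_def by (intro disjI2 bexI[of _ z]) auto
      qed
    next
      fix b1 b2 assume b: "b1 \<in> B" "b2 \<in> B" "(b1, b2) \<in> (chain_step d T B)\<^sup>*"
        "d x b1 \<le> D + t" "near b2 y"
      show ?thesis
      proof (cases "z \<in> A")
        case True
        have "near b2 z"
        proof (cases "b2 = y")
          case True
          then show ?thesis using \<open>z \<in> A\<close> yz(3) unfolding near_def by auto
        next
          case False
          then obtain a where a: "a \<in> A" "d b2 a \<le> t" "(a, y) \<in> (chain_step d t A)\<^sup>*"
            using b(5) unfolding near_def by blast
          have "(y, z) \<in> chain_step d t A"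
            using chain_end[OF a(3,1)] True yz by (auto simp: chain_step_def)
          then show ?thesis using a unfolding near_def by (meson rtrancl.rtrancl_into_rtrancl)
        qed
        then show ?thesis using b by blast
      next
        case False
        then have z: "z \<in> B" using yz by auto
        have "b2 \<in> M" using b(2) AB by auto
        then have "d b2 z \<le> T"
          using nearD[OF b(5,2)] triangle[OF _ M(2,3), of b2] yz(3) T by linarith
        then have "(b2, z) \<in> chain_step d T B" using b(2) z by (auto simp: chain_step_def)
        then have "(b1, z) \<in> (chain_step d T B)\<^sup>*" using b(3) by simp
        then show ?thesis using b z unfolding near_def by blast
      qed
    qed
  qed
  then show "d x y \<le> m + 2 * (D + t)"
  proof (elim disjE conjE bexE)
    assume "x \<in> A" "(x, y) \<in> (chain_step d t A)\<^sup>*"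
    then show ?thesis using chain_boundedD[OF A] m D t by fastforce
  next
    fix b1 b2 assume b: "b1 \<in> B" "b2 \<in> B" "(b1, b2) \<in> (chain_step d T B)\<^sup>*"
      "d x b1 \<le> D + t" "near b2 y"
    have M: "x \<in> M" "b1 \<in> M" "b2 \<in> M" "y \<in> M" using x b AB chain_end[OF xy x] by auto
    show ?thesis
      using triangle[OF M(1,2,4)] triangle[OF M(2,3,4)] nearD[OF b(5,2)] b(4)
        chain_boundedD[OF B b(1,3)] by (simp add: distrib_left)
  qed
qed

text \<open>Equal colours of the two parts are united instead of being separated by a new colour;
  the gap between \<open>D\<close> and \<open>T\<close> pays for this.\<close>

lemma chain_colorable_union:
  assumes AB: "A \<subseteq> M" "B \<subseteq> M" and A: "chain_colorable d n t D A" and B: "chain_colorable d n T m B"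
    and T: "D + 2 * t \<le> T" and t: "0 \<le> t" and D: "0 \<le> D" and m: "0 \<le> m"
  shows "chain_colorable d n t (m + 2 * (D + t)) (A \<union> B)"
proof -
  obtain C1 where C1: "\<And>x. x \<in> A \<Longrightarrow> C1 x \<le> n"
    "\<And>i. i \<le> n \<Longrightarrow> chain_bounded d t D {x \<in> A. C1 x = i}"
    using chain_colorableE[OF A] by blast
  obtain C2 where C2: "\<And>x. x \<in> B \<Longrightarrow> C2 x \<le> n"
    "\<And>i. i \<le> n \<Longrightarrow> chain_bounded d T m {x \<in> B. C2 x = i}"
    using chain_colorableE[OF B] by blast
  define C where "C x = (if x \<in> A then C1 x else C2 x)" for x
  show ?thesis
  proof (rule chain_colorableI[where C = C])
    fix i assume i: "i \<le> n"
    have "chain_bounded d t (m + 2 * (D + t)) ({x \<in> A. C1 x = i} \<union> {x \<in> B. C2 x = i})"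
      by (rule chain_bounded_union[OF _ _ C1(2)[OF i] C2(2)[OF i] T t D m]) (use AB in auto)
    then show "chain_bounded d t (m + 2 * (D + t)) {x \<in> A \<union> B. C x = i}"
      by (rule chain_bounded_mono) (auto simp: C_def)
  qed (auto simp: C_def C1 C2)
qed

text \<open>Replacing each point by a point of \<open>A\<close> within \<open>\<rho>\<close> turns a
  step of length \<open>\<rho>\<close> into one of length at most \<open>3 * \<rho>\<close> and
  changes distances by at most \<open>2 * \<rho>\<close>.\<close>

lemma chain_bounded_thickening:
  assumes A: "A \<subseteq> M" and bd: "chain_bounded d (3 * \<rho>) D A"
  shows "chain_bounded d \<rho> (D + 2 * \<rho>) {y \<in> M. \<exists>x\<in>A. d x y \<le> \<rho>}"
proof -
  let ?N = "{y \<in> M. \<exists>x\<in>A. d x y \<le> \<rho>}"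
  define f where "f y = (SOME x. x \<in> A \<and> d x y \<le> \<rho>)" for y
  have f: "f y \<in> A" "f y \<in> M" "d (f y) y \<le> \<rho>" if "y \<in> ?N" for y
    using that someI_ex[of "\<lambda>x. x \<in> A \<and> d x y \<le> \<rho>"] A unfolding f_def by auto
  show ?thesis
  proof (rule chain_bounded_map[where f = f, OF bd])
    fix x y assume x: "x \<in> ?N" and y: "y \<in> ?N"
    have xM: "x \<in> M" and yM: "y \<in> M" using x y by auto
    show "d (f x) (f y) \<le> 3 * \<rho>" if "d x y \<le> \<rho>"
      using triangle[OF f(2)[OF x] xM f(2)[OF y]] triangle[OF xM yM f(2)[OF y]]
        f(3)[OF x] f(3)[OF y] commute[of y "f y"] that by linarith
    show "d x y \<le> D + 2 * \<rho>" if "d (f x) (f y) \<le> D"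
      using triangle[OF xM f(2)[OF x] yM] triangle[OF f(2)[OF x] f(2)[OF y] yM]
        f(3)[OF x] f(3)[OF y] commute[of x "f x"] that by linarith
  qed (use f in auto)
qed

text \<open>Given the sets containing the closed balls of radius \<open>k\<rho>/(n+2)\<close> around \<open>x\<close>, at most \<open>n + 1\<close> and
  at least one for each \<open>k \<le> n + 1\<close>, two consecutive collections coincide; the number of
  their members is the colour of \<open>x\<close>.  For nearby points of the same colour this gap
  forces the collections to be the same.\<close>

lemma cover_imp_coloring:
  assumes \<rho>: "0 < \<rho>"
    and leb: "\<And>x. x \<in> M \<Longrightarrow> \<exists>V\<in>\<V>. mcball x \<rho> \<subseteq> W V"
    and mult: "\<And>x. x \<in> M \<Longrightarrow> finite {V\<in>\<V>. x \<in> W V} \<and> card {V\<in>\<V>. x \<in> W V} \<le> n + 1"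
  obtains C F where "\<And>x. x \<in> M \<Longrightarrow> C x \<le> n" "\<And>x. x \<in> M \<Longrightarrow> F x \<in> \<V> \<and> x \<in> W (F x)"
    "\<And>x y. x \<in> M \<Longrightarrow> y \<in> M \<Longrightarrow> C x = C y \<Longrightarrow> d x y \<le> \<rho> / (n + 2) \<Longrightarrow> F x = F y"
proof -
  \<comment> \<open>The \<open>n + 2\<close> radii \<open>k * \<gamma>\<close> with
    \<open>k \<le> n + 1\<close> stay below \<open>\<rho>\<close>, and consecutive ones differ by
    the distance allowed between the two points.\<close>
  define \<gamma> where "\<gamma> = \<rho> / (n + 2)"
  have \<gamma>: "\<gamma> > 0" using \<rho> by (simp add: \<gamma>_def)
  \<comment> \<open>\<open>\<V>\<close> only indexes the sets \<open>W V\<close>: for a cover of the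
    space \<open>W\<close> is the identity, for a cover of the corona it gives sets in the space
    below.\<close>
  define s where "s k x = {V\<in>\<V>. mcball x (real k * \<gamma>) \<subseteq> W V}" for k x
  have s_sub: "s k x \<subseteq> {V\<in>\<V>. x \<in> W V}" if "x \<in> M" for k x
    using that \<gamma> unfolding s_def by (auto dest!: subsetD[of _ _ x])
  have fin: "finite (s k x)" if "x \<in> M" for k x
    using finite_subset[OF s_sub[OF that]] mult[OF that] by blast
  have anti: "s (Suc k) x \<subseteq> s k x" for k x
  proof -
    have "real k * \<gamma> \<le> real (Suc k) * \<gamma>" using \<gamma> by simp
    then have "mcball x (real k * \<gamma>) \<subseteq> mcball x (real (Suc k) * \<gamma>)" by auto
    then show ?thesis unfolding s_def by auto
  qed
  have top: "s (n + 1) x \<noteq> {}" if "x \<in> M" for x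
  proof -
    have "real (n + 1) * \<gamma> \<le> \<rho>" using \<rho> by (simp add: \<gamma>_def field_simps)
    then have "mcball x (real (n + 1) * \<gamma>) \<subseteq> mcball x \<rho>" by auto
    then show ?thesis using leb[OF that] unfolding s_def by blast
  qed
  have "\<exists>k\<le>n. s (Suc k) x = s k x" if x: "x \<in> M" for x
  proof (rule ccontr)
    assume "\<not> ?thesis"
    then have ne: "s (Suc k) x \<subset> s k x" if "k \<le> n" for k using anti that by blast
    have "card (s k x) + k \<le> n + 1" if "k \<le> n + 1" for k
      using that
    proof (induction k)
      case 0
      show ?case using card_mono[OF _ s_sub[OF x, of 0]] mult[OF x] by simp
    next
      case (Suc k)
      then have "card (s (Suc k) x) < card (s k x)" by (intro psubset_card_mono fin x ne) auto
      then show ?case using Suc by simp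
    qed
    from this[of "n + 1"] show False using top[OF x] fin[OF x] by simp
  qed
  then obtain k where k: "\<And>x. x \<in> M \<Longrightarrow> k x \<le> n \<and> s (Suc (k x)) x = s (k x) x" by metis
  define \<sigma> where "\<sigma> x = s (k x) x" for x
  have ne: "\<sigma> x \<noteq> {}" if x: "x \<in> M" for x
  proof -
    have "s (n + 1) x \<subseteq> s (k x) x"
      using lift_Suc_antimono_le[of "\<lambda>k. s k x"] anti k[OF x] by simp
    then show ?thesis using top[OF x] unfolding \<sigma>_def by auto
  qed
  have \<sigma>_eq: "\<sigma> x = \<sigma> y"
    if x: "x \<in> M" and y: "y \<in> M" and c: "card (\<sigma> x) = card (\<sigma> y)" and d: "d x y \<le> \<gamma>" for x y
  proof (rule ccontr)
    assume neq: "\<sigma> x \<noteq> \<sigma> y"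
    \<comment> \<open>If \<open>U\<close> witnesses the difference, the ball around \<open>y\<close>
      is not inside the enlarged ball around \<open>x\<close>. Equal cardinalities give a witness in
      each direction, and the sum of the two inequalities is \<gamma> <
      \<open>d x y\<close>.\<close>
    have key: "real (Suc (k x)) * \<gamma> < real (k y) * \<gamma> + d x y"
      if x: "x \<in> M" and y: "y \<in> M" and U: "U \<in> \<sigma> x" "U \<notin> \<sigma> y" for x y U
    proof (rule ccontr)
      assume *: "\<not> ?thesis"
      have "mcball y (real (k y) * \<gamma>) \<subseteq> mcball x (real (Suc (k x)) * \<gamma>)"
        using * x commute[of x y] by (intro mcball_subset) auto
      moreover have "mcball x (real (Suc (k x)) * \<gamma>) \<subseteq> W U" "U \<in> \<V>"
        using U(1) k[OF x] unfolding \<sigma>_def s_def by auto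
      ultimately show False using U(2) unfolding \<sigma>_def s_def by auto
    qed
    have f: "finite (\<sigma> x)" "finite (\<sigma> y)" using fin x y by (auto simp: \<sigma>_def)
    obtain U where U: "U \<in> \<sigma> x" "U \<notin> \<sigma> y" using neq c f by (metis card_subset_eq subsetI)
    obtain V where V: "V \<in> \<sigma> y" "V \<notin> \<sigma> x" using neq c f by (metis card_subset_eq subsetI)
    show False using key[OF x y U] key[OF y x V] d commute[of x y] by (simp add: algebra_simps)
  qed
  \<comment> \<open>The collections have between 1 and \<open>n + 1\<close> members; subtracting 1
    gives colours from 0 to \<open>n\<close>.\<close>
  show thesis
  proof (rule that[of "\<lambda>x. card (\<sigma> x) - 1" "\<lambda>x. SOME V. V \<in> \<sigma> x"])
    fix x assume x: "x \<in> M"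
    have "card (\<sigma> x) \<le> n + 1"
      using card_mono[OF _ s_sub[OF x, of "k x"]] mult[OF x] unfolding \<sigma>_def by simp
    then show "card (\<sigma> x) - 1 \<le> n" by simp
    have "(SOME V. V \<in> \<sigma> x) \<in> \<sigma> x" using ne[OF x] by (simp add: some_in_eq)
    then show "(SOME V. V \<in> \<sigma> x) \<in> \<V> \<and> x \<in> W (SOME V. V \<in> \<sigma> x)"
      using s_sub[OF x] unfolding \<sigma>_def by blast
  next
    fix x y assume xy: "x \<in> M" "y \<in> M" "card (\<sigma> x) - 1 = card (\<sigma> y) - 1" "d x y \<le> \<rho> / real (n + 2)"
    have "card (\<sigma> x) > 0" "card (\<sigma> y) > 0" using ne xy fin by (auto simp: \<sigma>_def card_gt_0_iff)
    then have "\<sigma> x = \<sigma> y" using xy \<sigma>_eq[of x y] by (auto simp: \<gamma>_def)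
    then show "(SOME V. V \<in> \<sigma> x) = (SOME V. V \<in> \<sigma> y)" by simp
  qed
qed

text \<open>Each chain class has diameter at most \<open>\<delta>\<close>, so the set containing the
  \<open>\<epsilon>\<close>-ball of one of its points contains the \<open>\<eta>\<close>-balls of
  all of them; that set becomes the owner of the class. Classes of one colour are more than
  \<open>\<eta>\<close> apart, so they can be thickened by \<open>\<eta> / 2\<close>, which restores
  a Lebesgue number, and sets of one colour with different owners stay disjoint.\<close>

lemma coloring_refines_cover:
  assumes \<eta>: "0 < \<eta>" and col: "chain_colorable d n \<eta> \<delta> M"
    and leb: "\<And>x. x \<in> M \<Longrightarrow> \<exists>V\<in>\<V>. mcball x \<epsilon> \<subseteq> W V" and le: "\<delta> + \<eta> \<le> \<epsilon>"
  obtains I where "\<And>i V. V \<in> \<V> \<Longrightarrow> I i V \<subseteq> W V"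
    "\<And>x. x \<in> M \<Longrightarrow> \<exists>i\<le>n. \<exists>V\<in>\<V>. mcball x (\<eta> / 2) \<subseteq> I i V"
    "\<And>i U V. U \<noteq> V \<Longrightarrow> I i U \<inter> I i V = {}"
proof -
  obtain C where C: "\<And>x. x \<in> M \<Longrightarrow> C x \<le> n"
    "\<And>i. i \<le> n \<Longrightarrow> chain_bounded d \<eta> \<delta> {x \<in> M. C x = i}"
    using chain_colorableE[OF col] by blast
  define K where "K x = {y. (x, y) \<in> (chain_step d \<eta> {z \<in> M. C z = C x})\<^sup>*}" for x
  \<comment> \<open>The choice depends on \<open>x\<close> only through its class
    \<open>K x\<close>, so all points of a class have the same owner.\<close>
  define own where "own x = (SOME V. V \<in> \<V> \<and> (\<exists>y\<in>K x. mcball y \<epsilon> \<subseteq> W V))" for x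
  have K_eq: "K x = K y" if "x \<in> M" "y \<in> M" "C x = C y" "d x y \<le> \<eta>" for x y
  proof -
    have "(x, y) \<in> chain_step d \<eta> {z \<in> M. C z = C y}" using that by (auto simp: chain_step_def)
    from chain_class_eq[OF this] show ?thesis unfolding K_def that(3) .
  qed
  have own: "own x \<in> \<V> \<and> (\<exists>y\<in>K x. mcball y \<epsilon> \<subseteq> W (own x))" if x: "x \<in> M" for x
  proof -
    have "x \<in> K x" by (simp add: K_def)
    then have "\<exists>V. V \<in> \<V> \<and> (\<exists>y\<in>K x. mcball y \<epsilon> \<subseteq> W V)" using leb[OF x] by blast
    then show ?thesis unfolding own_def by (rule someI_ex)
  qed
  have own_sub: "mcball x \<eta> \<subseteq> W (own x)" if x: "x \<in> M" for x
  proof -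
    obtain y where y: "y \<in> K x" "mcball y \<epsilon> \<subseteq> W (own x)" using own[OF x] by blast
    have "y \<in> M" using y(1) chain_end[of x y] x unfolding K_def by blast
    have "d x y \<le> \<delta>" using chain_boundedD[OF C(2)[OF C(1)[OF x]], of x y] x y(1) by (auto simp: K_def)
    then have "mcball x \<eta> \<subseteq> mcball y \<epsilon>"
      using le x \<open>y \<in> M\<close> by (intro mcball_subset) (auto simp: commute)
    then show ?thesis using y(2) by blast
  qed
  define I where "I i V = {y \<in> M. \<exists>x\<in>M. C x = i \<and> own x = V \<and> d x y \<le> \<eta> / 2}" for i V
  show thesis
  proof (rule that[of I])
    fix i V assume "V \<in> \<V>"
    show "I i V \<subseteq> W V"
    proof
      fix y assume "y \<in> I i V"
      then obtain x where x: "y \<in> M" "x \<in> M" "own x = V" "d x y \<le> \<eta> / 2" by (auto simp: I_def)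
      then have "y \<in> mcball x \<eta>" using \<eta> by auto
      then show "y \<in> W V" using own_sub[OF x(2)] x(3) by blast
    qed
  next
    fix x assume x: "x \<in> M"
    have "mcball x (\<eta> / 2) \<subseteq> I (C x) (own x)" using x by (auto simp: I_def)
    then show "\<exists>i\<le>n. \<exists>V\<in>\<V>. mcball x (\<eta> / 2) \<subseteq> I i V" using C(1)[OF x] own[OF x] by blast
  next
    fix i U V assume neq: "U \<noteq> (V :: 'b)"
    show "I i U \<inter> I i V = {}"
    proof (rule ccontr)
      assume "I i U \<inter> I i V \<noteq> {}"
      then obtain y where "y \<in> I i U" "y \<in> I i V" by blast
      then obtain u v where uv: "y \<in> M" "u \<in> M" "C u = i" "own u = U" "d u y \<le> \<eta> / 2"
        "v \<in> M" "C v = i" "own v = V" "d v y \<le> \<eta> / 2" unfolding I_def by blast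
      have "d u v \<le> \<eta>" using triangle[of u y v] uv commute[of v y] by simp
      then have "K u = K v" using K_eq uv by simp
      then have "own u = own v" by (simp add: own_def)
      then show False using neq uv by simp
    qed
  qed
qed

end

lemma ex2I: "P a \<Longrightarrow> Q b \<Longrightarrow> R a b \<Longrightarrow> \<exists>x. P x \<and> (\<exists>y. Q y \<and> R x y)"
  by blast

text \<open>Membership in infinitely many sets is excluded too: any \<open>m + 1\<close> of them
  would be a forbidden subfamily.\<close>

lemma mult_leD:
  assumes "mult_le \<U> m"
  shows "finite {U\<in>\<U>. x \<in> U} \<and> card {U\<in>\<U>. x \<in> U} \<le> m"
proof (rule ccontr)
  assume neg: "\<not> ?thesis"
  let ?T = "{U\<in>\<U>. x \<in> U}"
  have "\<exists>\<V>\<subseteq>?T. finite \<V> \<and> card \<V> = m + 1"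
  proof (cases "finite ?T")
    case True
    then have "m + 1 \<le> card ?T" using neg by auto
    from obtain_subset_with_card_n[OF this] show ?thesis by blast
  next
    case False
    from infinite_arbitrarily_large[OF this] show ?thesis by blast
  qed
  then obtain \<V> where \<V>: "\<V> \<subseteq> ?T" "finite \<V>" "card \<V> = m + 1" by blast
  then have "\<Inter>\<V> = {}" using assms unfolding mult_le_def by blast
  moreover have "x \<in> \<Inter>\<V>" using \<V>(1) by blast
  ultimately show False by blast
qed

lemma mult_leI:
  assumes "\<And>x. x \<in> \<Union>\<U> \<Longrightarrow> finite {U\<in>\<U>. x \<in> U} \<and> card {U\<in>\<U>. x \<in> U} \<le> m"
  shows "mult_le \<U> m"
  unfolding mult_le_def
proof (intro allI impI)
  fix \<V> assume \<V>: "\<V> \<subseteq> \<U>" "finite \<V> \<and> card \<V> = m + 1"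
  show "\<Inter>\<V> = {}"
  proof (rule ccontr)
    assume "\<Inter>\<V> \<noteq> {}"
    then obtain x where x: "x \<in> \<Inter>\<V>" by blast
    have "\<V> \<noteq> {}" using \<V>(2) by auto
    then have "x \<in> \<Union>\<U>" using x \<V>(1) by blast
    then have "finite {U\<in>\<U>. x \<in> U}" "card {U\<in>\<U>. x \<in> U} \<le> m" using assms by auto
    moreover have "\<V> \<subseteq> {U\<in>\<U>. x \<in> U}" using x \<V>(1) by blast
    ultimately have "card \<V> \<le> m" using card_mono by (metis order_trans)
    then show False using \<V>(2) by simp
  qed
qed

section \<open>Assouad-Nagata dimension in terms of colourings\<close>

context Metric_space
begin

text \<open>From a cover, \<open>cover_imp_coloring\<close> labels every point with a member
  containing it, and the mesh bounds the chains. From a colouring, the thickened chain classes form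
  the cover: a point lies in at most one of them for each colour.\<close>

lemma AN_asdim_le_iff:
  "AN_asdim_le n \<longleftrightarrow> (\<exists>c>0. \<exists>r0>0. \<forall>r\<ge>r0. chain_colorable d n r (c * r) M)"
proof
  assume "AN_asdim_le n"
  then obtain c r0 where c: "c > 0" and r0: "r0 > 0" and cov: "\<And>r. r \<ge> r0 \<Longrightarrow> \<exists>\<U>. \<U> \<subseteq> Pow M \<and> \<Union>\<U> = M \<and>
        mesh \<U> \<le> ennreal (c * r) \<and> lebesgue_number \<U> > ennreal r \<and> mult_le \<U> (n + 1)"
    unfolding AN_asdim_le_def by blast
  have col: "chain_colorable d n r (c * (n + 2) * r) M" if r: "r \<ge> r0" for r
  proof -
    \<comment> \<open>\<open>cover_imp_coloring\<close> divides the Lebesgue number by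
      \<open>n + 2\<close>; starting from this multiple of \<open>r\<close> leaves steps of length
      \<open>r\<close>.\<close>
    define \<rho> where "\<rho> = (n + 2) * r"
    have rpos: "r > 0" using r r0 by simp
    have \<rho>0: "\<rho> > 0" using rpos by (simp add: \<rho>_def)
    have "1 * r \<le> (n + 2) * r" using rpos by (intro mult_right_mono) auto
    then have "\<rho> \<ge> r0" using r by (simp add: \<rho>_def)
    from cov[OF this] obtain \<U> where \<U>: "\<U> \<subseteq> Pow M" "\<Union>\<U> = M" "mesh \<U> \<le> ennreal (c * \<rho>)"
      "lebesgue_number \<U> > ennreal \<rho>" "mult_le \<U> (n + 1)" by blast
    have leb: "\<exists>V\<in>\<U>. mcball x \<rho> \<subseteq> id V" if x: "x \<in> M" for x
    proof -
      have "lebesgue_number \<U> \<le> (SUP U\<in>\<U>. esetdist x (M - U))"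
        unfolding lebesgue_number_def using x by (rule INF_lower)
      then have "ennreal \<rho> < (SUP U\<in>\<U>. esetdist x (M - U))" using \<U>(4) by simp
      then obtain U where U: "U \<in> \<U>" "ennreal \<rho> < esetdist x (M - U)" unfolding less_SUP_iff by blast
      have "y \<in> U" if y: "y \<in> mcball x \<rho>" for y
      proof (rule ccontr)
        assume "y \<notin> U"
        then have "esetdist x (M - U) \<le> ennreal (d x y)"
          unfolding esetdist_def using y by (intro INF_lower) auto
        also have "\<dots> \<le> ennreal \<rho>" using y by (intro ennreal_leI) simp
        finally show False using U(2) by simp
      qed
      then show ?thesis using U(1) by (metis id_apply subsetI)
    qed
    have mult: "finite {V\<in>\<U>. x \<in> id V} \<and> card {V\<in>\<U>. x \<in> id V} \<le> n + 1" for x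
      using mult_leD[OF \<U>(5)] by simp
    obtain C F where CF: "\<And>x. x \<in> M \<Longrightarrow> C x \<le> n" "\<And>x. x \<in> M \<Longrightarrow> F x \<in> \<U> \<and> x \<in> id (F x)"
      "\<And>x y. x \<in> M \<Longrightarrow> y \<in> M \<Longrightarrow> C x = C y \<Longrightarrow> d x y \<le> \<rho> / (n + 2) \<Longrightarrow> F x = F y"
      using cover_imp_coloring[OF \<rho>0 leb mult] by blast
    have "d x y \<le> c * (n + 2) * r" if "U \<in> \<U>" "x \<in> U" "y \<in> U" for x y U
    proof -
      have "ennreal (d x y) \<le> ediam U"
        unfolding ediam_def using that by (intro SUP_upper2[of x] SUP_upper) auto
      also have "\<dots> \<le> mesh \<U>" unfolding mesh_def using that by (intro SUP_upper)
      also have "\<dots> \<le> ennreal (c * \<rho>)" by fact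
      finally show ?thesis using c \<rho>0 by (simp add: \<rho>_def mult.assoc)
    qed
    then have diam: "d x y \<le> c * (n + 2) * r" if "x \<in> M" "y \<in> M" "F x = F y" for x y
      using CF(2) that by (metis id_apply)
    show ?thesis
    proof (rule chain_colorableI[where C = C])
      show "chain_bounded d r (c * (n + 2) * r) {x \<in> M. C x = i}" for i
      proof (rule chain_bounded_labels[where lab = F])
        show "F x = F y" if "x \<in> {x \<in> M. C x = i}" "y \<in> {x \<in> M. C x = i}" "d x y \<le> r" for x y
          using that CF(3)[of x y] by (simp add: \<rho>_def)
        show "chain_bounded d r (c * (n + 2) * r) {x \<in> {x \<in> M. C x = i}. F x = l}" for l
          by (rule chain_bounded_diam) (use diam in auto)
      qed
    qed (use CF in auto)
  qed
  show "\<exists>c>0. \<exists>r0>0. \<forall>r\<ge>r0. chain_colorable d n r (c * r) M"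
    by (rule ex2I[where a = "c * (n + 2)" and b = r0]) (use c r0 col in auto)
next
  assume "\<exists>c>0. \<exists>r0>0. \<forall>r\<ge>r0. chain_colorable d n r (c * r) M"
  then obtain c r0 where c: "c > 0" and r0: "r0 > 0"
    and col: "\<And>r. r \<ge> r0 \<Longrightarrow> chain_colorable d n r (c * r) M" by blast
  have cov: "\<exists>\<U>. \<U> \<subseteq> Pow M \<and> \<Union>\<U> = M \<and>
        mesh \<U> \<le> ennreal ((4 * c + 4) * r) \<and> lebesgue_number \<U> > ennreal r \<and> mult_le \<U> (n + 1)"
    if r: "r \<ge> r0" for r
  proof -
    have rpos: "r > 0" using r r0 by simp
    obtain C where C: "\<And>x. x \<in> M \<Longrightarrow> C x \<le> n"
      "\<And>i. i \<le> n \<Longrightarrow> chain_bounded d (4 * r) (c * (4 * r)) {x \<in> M. C x = i}"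
      using chain_colorableE[OF col[of "4 * r"]] r rpos by auto
    define K where "K x = {y. (x, y) \<in> (chain_step d (4 * r) {z \<in> M. C z = C x})\<^sup>*}" for x
    \<comment> \<open>If two thickened classes of one colour meet, they contain points within
      \<open>4 * r\<close> and hence coincide. Thickening by \<open>2 * r\<close> rather than
      \<open>r\<close> secures the strict inequality for the Lebesgue number, which is an
      infimum.\<close>
    define N where "N x = {z \<in> M. \<exists>y\<in>K x. d y z \<le> 2 * r}" for x
    have K_self: "x \<in> K x" for x by (simp add: K_def)
    have K_C: "y \<in> M \<and> C y = C x" if "x \<in> M" "y \<in> K x" for x y
      using chain_end[of x y] that unfolding K_def by blast
    have K_eq: "K y = K x" if "x \<in> M" "y \<in> K x" for x y
    proof -
      have cl: "C y = C x" using K_C that by blast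
      have "sym (chain_step d (4 * r) {z \<in> M. C z = C x})" by (auto simp: sym_def chain_step_def commute)
      then have "(y, x) \<in> (chain_step d (4 * r) {z \<in> M. C z = C x})\<^sup>*"
        using that(2) unfolding K_def by (simp add: sym_rtrancl symD)
      then show ?thesis using that(2) unfolding K_def cl by (auto intro: rtrancl_trans)
    qed
    have K_near: "K x = K y" if "x \<in> M" "y \<in> M" "C x = C y" "d x y \<le> 4 * r" for x y
    proof -
      have "(x, y) \<in> chain_step d (4 * r) {z \<in> M. C z = C y}"
        using that by (auto simp: chain_step_def)
      from chain_class_eq[OF this] show ?thesis unfolding K_def that(3) .
    qed
    have N_eq: "N x = N y" if xy: "x \<in> M" "y \<in> M" "C x = C y" and z: "z \<in> N x" "z \<in> N y" for x y z
    proof -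
      obtain u v where uv: "z \<in> M" "u \<in> K x" "d u z \<le> 2 * r" "v \<in> K y" "d v z \<le> 2 * r"
        using z unfolding N_def by blast
      have uvM: "u \<in> M" "v \<in> M" "C u = C v" using K_C[OF xy(1) uv(2)] K_C[OF xy(2) uv(4)] xy(3) by auto
      have "d u v \<le> 4 * r" using triangle[OF uvM(1) uv(1) uvM(2)] uv(3,5) commute[of v z] by simp
      then have "K u = K v" using K_near uvM by blast
      then have "K x = K y" using K_eq[OF xy(1) uv(2)] K_eq[OF xy(2) uv(4)] by simp
      then show ?thesis by (simp add: N_def)
    qed
    have in_N: "z \<in> N x" if "x \<in> M" "z \<in> M" "d x z \<le> 2 * r" for x z
      using that K_self unfolding N_def by blast
    have diam: "d u v \<le> (4 * c + 4) * r" if x: "x \<in> M" and uv: "u \<in> N x" "v \<in> N x" for x u v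
    proof -
      obtain a b where ab: "u \<in> M" "v \<in> M" "a \<in> K x" "d a u \<le> 2 * r" "b \<in> K x" "d b v \<le> 2 * r"
        using uv unfolding N_def by blast
      have aM: "a \<in> M" "b \<in> M" "C a = C x" using K_C x ab by auto
      have "b \<in> K a" using K_eq x ab by metis
      then have "d a b \<le> c * (4 * r)"
        using chain_boundedD[OF C(2)[OF C(1)[OF aM(1)]], of a b] aM(1) unfolding K_def by auto
      moreover have "d u v \<le> d u a + d a b + d b v"
        using triangle[OF ab(1) aM(1) ab(2)] triangle[OF aM(1,2) ab(2)] by linarith
      ultimately show ?thesis using ab(4,6) commute[of u a] by (simp add: algebra_simps)
    qed
    show ?thesis
    proof (intro exI[of _ "N ` M"] conjI)
      show "N ` M \<subseteq> Pow M" by (auto simp: N_def)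
      show "\<Union>(N ` M) = M"
      proof
        show "M \<subseteq> \<Union>(N ` M)" using in_N rpos by force
      qed (auto simp: N_def)
      show "mesh (N ` M) \<le> ennreal ((4 * c + 4) * r)"
        unfolding mesh_def ediam_def using diam by (intro SUP_least) (auto intro!: ennreal_leI)
      have "ennreal (2 * r) \<le> lebesgue_number (N ` M)"
        unfolding lebesgue_number_def
      proof (rule INF_greatest)
        fix x assume x: "x \<in> M"
        have "ennreal (2 * r) \<le> esetdist x (M - N x)"
          unfolding esetdist_def
        proof (rule INF_greatest)
          fix y assume "y \<in> M - N x"
          then have "2 * r \<le> d x y" using in_N[OF x, of y] by force
          then show "ennreal (2 * r) \<le> ennreal (d x y)" by (rule ennreal_leI)
        qed
        then show "ennreal (2 * r) \<le> (SUP U\<in>N ` M. esetdist x (M - U))"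
          using x by (intro SUP_upper2[of "N x"]) auto
      qed
      moreover have "ennreal r < ennreal (2 * r)" using rpos by (simp add: ennreal_less_iff)
      ultimately show "ennreal r < lebesgue_number (N ` M)" by (rule order_less_le_trans[rotated])
      show "mult_le (N ` M) (n + 1)"
      proof (rule mult_leI)
        fix z
        let ?T = "{U \<in> N ` M. z \<in> U}"
        have "\<forall>U\<in>?T. \<exists>x. x \<in> M \<and> U = N x" by blast
        from bchoice[OF this] obtain g where g: "\<And>U. U \<in> ?T \<Longrightarrow> g U \<in> M \<and> U = N (g U)" by blast
        have inj: "inj_on (C \<circ> g) ?T"
        proof (rule inj_onI)
          fix U V assume UV: "U \<in> ?T" "V \<in> ?T" "(C \<circ> g) U = (C \<circ> g) V"
          then have "z \<in> N (g U)" "z \<in> N (g V)" using g[OF UV(1)] g[OF UV(2)] by blast+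
          then have "N (g U) = N (g V)" using N_eq g UV by (metis comp_apply)
          then show "U = V" using g UV by metis
        qed
        have im: "(C \<circ> g) ` ?T \<subseteq> {..n}" using g C(1) by auto
        show "finite ?T \<and> card ?T \<le> n + 1"
          using card_inj_on_le[OF inj im] inj_on_finite[OF inj im] by simp
      qed
    qed
  qed
  show "AN_asdim_le n"
    unfolding AN_asdim_le_def
    by (rule ex2I[where a = "4 * c + 4" and b = r0]) (use c r0 cov in auto)
qed


end


section \<open>Distances relative to the base point\<close>

context Metric_space
begin

text \<open>This is the distance-ratio metric (the j-metric of quasihyperbolic geometry) of the
  space punctured at \<open>x0\<close>. If one of the points is \<open>x0\<close>, division by 0
  yields the value 0, so it is a metric only away from \<open>x0\<close>.\<close>

definition jdist :: "'a \<Rightarrow> 'a \<Rightarrow> 'a \<Rightarrow> real" where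
  "jdist x0 x y = ln (1 + d x y / min (d x x0) (d y x0))"

definition far :: "'a \<Rightarrow> real \<Rightarrow> 'a set" where
  "far x0 R = {x \<in> M. R \<le> d x x0}"

text \<open>A small-scale dimension of \<open>jdist\<close> near infinity. The radius and the step
  may depend on \<open>\<delta>\<close> arbitrarily; no linear relation is demanded.\<close>

definition conical_dim_le :: "'a \<Rightarrow> nat \<Rightarrow> bool" where
  "conical_dim_le x0 n \<longleftrightarrow>
     (\<forall>\<delta>>0. \<exists>\<eta>>0. \<exists>R>0. chain_colorable (jdist x0) n \<eta> \<delta> (far x0 R))"

lemma jdist_commute: "jdist x0 x y = jdist x0 y x"
  by (simp add: jdist_def commute min.commute)

lemma jdist_nonneg: "0 \<le> jdist x0 x y"
  unfolding jdist_def by (intro ln_ge_zero) auto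

lemma exp_jdist: "exp (jdist x0 x y) = 1 + d x y / min (d x x0) (d y x0)"
proof -
  have "0 \<le> d x y / min (d x x0) (d y x0)" by simp
  then show ?thesis unfolding jdist_def by (intro exp_ln) linarith
qed

lemma jdist_le:
  assumes "0 < m" "m \<le> d x x0" "m \<le> d y x0"
  shows "jdist x0 x y \<le> d x y / m"
proof -
  have "jdist x0 x y \<le> d x y / min (d x x0) (d y x0)"
    unfolding jdist_def by (rule ln_add_one_self_le_self) simp
  also have "\<dots> \<le> d x y / m" using assms by (intro divide_left_mono) auto
  finally show ?thesis .
qed

text \<open>Together with \<open>jdist_le\<close> this makes small values of \<open>jdist\<close>
  comparable to distance divided by norm; \<eta> \<le> 1 is what allows exp \<eta> - 1 to be bounded
  by 2\<eta>.\<close>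

lemma dist_le_jdist:
  assumes j: "jdist x0 x y \<le> \<eta>" "\<eta> \<le> 1" and pos: "0 < d x x0" "0 < d y x0"
  shows "d x y \<le> 2 * \<eta> * min (d x x0) (d y x0)"
proof -
  have \<eta>: "0 \<le> \<eta>" using jdist_nonneg[of x0 x y] j by linarith
  have "1 + d x y / min (d x x0) (d y x0) \<le> exp \<eta>" using j by (simp flip: exp_jdist)
  also have "\<dots> \<le> 1 + \<eta> + \<eta>\<^sup>2" using \<eta> j by (intro exp_bound) auto
  also have "\<dots> \<le> 1 + 2 * \<eta>" using \<eta> j by (simp add: power2_eq_square mult_left_le)
  finally have "d x y / min (d x x0) (d y x0) \<le> 2 * \<eta>" by simp
  moreover have "0 < min (d x x0) (d y x0)" using pos by simp
  ultimately show ?thesis by (simp add: divide_le_eq)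
qed

text \<open>For the triangle inequality let \<open>x\<close> be no farther from \<open>x0\<close>
  than \<open>z\<close>, as symmetry allows. After exponentiation the claim is a product estimate,
  which follows from |y| \<le> |x| + \<open>d x y\<close>.\<close>

lemma Metric_space_jdist:
  assumes x0: "x0 \<in> M"
  shows "Metric_space (M - {x0}) (jdist x0)"
proof
  show "0 \<le> jdist x0 x y" for x y by (rule jdist_nonneg)
  show "jdist x0 x y = jdist x0 y x" for x y by (rule jdist_commute)
  show "jdist x0 x y = 0 \<longleftrightarrow> x = y" if xy: "x \<in> M - {x0}" "y \<in> M - {x0}" for x y
  proof -
    have "min (d x x0) (d y x0) \<noteq> 0" using xy x0 by (auto simp: min_def)
    then have "exp (jdist x0 x y) = 1 \<longleftrightarrow> d x y = 0" unfolding exp_jdist by simp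
    then show ?thesis using xy by simp
  qed
  have le: "jdist x0 x z \<le> jdist x0 x y + jdist x0 y z"
    if xyz: "x \<in> M - {x0}" "y \<in> M - {x0}" "z \<in> M - {x0}" and xz: "d x x0 \<le> d z x0" for x y z
  proof -
    have pos: "0 < d x x0" "0 < d y x0" "0 < d z x0" using xyz x0 by auto
    have y: "d y x0 \<le> d x x0 + d x y" using triangle[of y x x0] commute[of x y] xyz x0 by simp
    have "exp (jdist x0 x z) = 1 + d x z / d x x0" unfolding exp_jdist using xz by simp
    also have "\<dots> \<le> 1 + (d x y + d y z) / d x x0"
      using triangle[of x y z] xyz pos by (simp add: divide_right_mono)
    also have "\<dots> \<le> (1 + d x y / d x x0) * (1 + d y z / d y x0)"
    proof -
      have "d y z * d y x0 \<le> d y z * (d x x0 + d x y)" using y by (intro mult_left_mono) auto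
      then have "d y z / d x x0 \<le> (d x x0 + d x y) * d y z / (d x x0 * d y x0)"
        using pos by (simp add: field_simps)
      also have "\<dots> = (1 + d x y / d x x0) * (d y z / d y x0)"
        using pos by (simp add: field_simps)
      finally show ?thesis by (simp add: algebra_simps add_divide_distrib)
    qed
    also have "\<dots> \<le> exp (jdist x0 x y) * exp (jdist x0 y z)"
      unfolding exp_jdist using pos
      by (intro mult_mono add_left_mono divide_left_mono add_nonneg_nonneg) auto
    finally show ?thesis by (simp flip: exp_add)
  qed
  show "jdist x0 x z \<le> jdist x0 x y + jdist x0 y z"
    if "x \<in> M - {x0}" "y \<in> M - {x0}" "z \<in> M - {x0}" for x y z
    using le[of x y z] le[of z y x] that jdist_commute[of x0 x z] jdist_commute[of x0 y z]
      jdist_commute[of x0 x y] by linarith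
qed

lemma far_mono: "R \<le> R' \<Longrightarrow> far x0 R' \<subseteq> far x0 R"
  by (auto simp: far_def)

text \<open>The dyadic annuli at scale proportional to their size: those of even index are separated from
  each other, as are those of odd index, and the two parts are merged by the union lemma.\<close>

lemma AN_asdim_le_imp_conical_dim_le:
  assumes x0: "x0 \<in> M" and AN: "AN_asdim_le n"
  shows "conical_dim_le x0 n"
proof -
  interpret J: Metric_space "M - {x0}" "jdist x0" by (rule Metric_space_jdist[OF x0])
  obtain c r0 where c: "c > 0" and r0: "r0 > 0"
    and col: "\<And>r. r \<ge> r0 \<Longrightarrow> chain_colorable d n r (c * r) M" using AN unfolding AN_asdim_le_iff by blast
  define k where "k x = \<lfloor>log 2 (d x x0)\<rfloor>" for x
  have k: "2 powr k x \<le> d x x0" "d x x0 < 2 * 2 powr k x" if "0 < d x x0" for x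
    using floor_log_eq_powr_iff[of "d x x0" 2 "k x"] that by (auto simp: k_def powr_add)
  \<comment> \<open>The bound 1/4 gives \<open>d x y\<close> \<le> |x|/2, so norms change by a
    factor of at most 3/2, while different annuli of the same parity contain norms of ratio above
    2.\<close>
  have step: "k x = k y"
    if xy: "x \<in> M" "y \<in> M" "0 < d x x0" "0 < d y x0" and par: "even (k x) = even (k y)"
      and j: "jdist x0 x y \<le> 1/4" for x y
  proof -
    have less: False if xy: "x \<in> M" "y \<in> M" "0 < d x x0" "0 < d y x0" and par: "even (k x) = even (k y)"
      and j: "jdist x0 x y \<le> 1/4" and lt: "k x < k y" for x y
    proof -
      have "k x + 2 \<le> k y" using par lt by presburger
      then have "2 powr (real_of_int (k x) + 2) \<le> 2 powr k y" by (intro powr_mono) auto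
      then have "4 * 2 powr k x \<le> d y x0" using k(1)[OF xy(4)] by (simp add: powr_add)
      moreover have "d x y \<le> 2 * (1/4) * min (d x x0) (d y x0)" by (rule dist_le_jdist[OF j]) (use xy in auto)
      moreover have "d y x0 \<le> d x y + d x x0" using triangle[of y x x0] xy x0 commute[of x y] by simp
      ultimately show False using k(2)[OF xy(3)] xy by (simp add: min_def split: if_splits)
    qed
    show ?thesis using less[of x y] less[of y x] xy par j jdist_commute[of x0 x y] by force
  qed
  have half: "\<exists>R>0. \<forall>p. chain_colorable (jdist x0) n (\<sigma> / 4) (c * \<sigma>) {x \<in> far x0 R. even (k x) = p}"
    if \<sigma>: "0 < \<sigma>" "\<sigma> \<le> 1" for \<sigma>
  proof (intro exI[of _ "2 * r0 / \<sigma>"] conjI allI)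
    \<comment> \<open>This radius forces \<open>r0 \<le> \<sigma> * 2 powr l\<close> on every
      nonempty annulus, so the colouring at that scale is available there.\<close>
    let ?R = "2 * r0 / \<sigma>"
    show R: "0 < ?R" using r0 \<sigma> by simp
    fix p
    show "chain_colorable (jdist x0) n (\<sigma> / 4) (c * \<sigma>) {x \<in> far x0 ?R. even (k x) = p}"
    proof (rule chain_colorable_labels[where lab = k])
      show "k x = k y" if "x \<in> {x \<in> far x0 ?R. even (k x) = p}" "y \<in> {x \<in> far x0 ?R. even (k x) = p}"
        "jdist x0 x y \<le> \<sigma> / 4" for x y
        by (rule step) (use that R \<sigma> in \<open>auto simp: far_def\<close>)
      fix l
      let ?A = "{x \<in> {x \<in> far x0 ?R. even (k x) = p}. k x = l}"
      have A: "x \<in> M" "0 < d x x0" "2 powr l \<le> d x x0" "d x x0 < 2 * 2 powr l" "?R \<le> d x x0" if "x \<in> ?A" for x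
        using that R k[of x] by (auto simp: far_def)
      show "chain_colorable (jdist x0) n (\<sigma> / 4) (c * \<sigma>) ?A"
      proof (cases "?A = {}")
        case False
        then obtain x where "x \<in> ?A" by blast
        then have "?R < 2 * 2 powr l" using A[of x] by linarith
        then have "r0 \<le> \<sigma> * 2 powr l" using \<sigma> by (simp add: field_simps)
        then have "chain_colorable d n (\<sigma> * 2 powr l) (c * (\<sigma> * 2 powr l)) M" by (rule col)
        then show ?thesis
        proof (rule chain_colorable_map[where f = "\<lambda>x. x"])
          fix x y assume x: "x \<in> ?A" and y: "y \<in> ?A"
          show "d x y \<le> \<sigma> * 2 powr l" if j: "jdist x0 x y \<le> \<sigma> / 4"
          proof -
            have "d x y \<le> 2 * (\<sigma> / 4) * min (d x x0) (d y x0)"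
              by (rule dist_le_jdist[OF j]) (use A(2)[OF x] A(2)[OF y] \<sigma> in auto)
            also have "\<dots> \<le> 2 * (\<sigma> / 4) * (2 * 2 powr l)"
              using A[OF x] \<sigma> by (intro mult_left_mono) auto
            finally show ?thesis by simp
          qed
          show "jdist x0 x y \<le> c * \<sigma>" if dd: "d x y \<le> c * (\<sigma> * 2 powr l)"
          proof -
            have "jdist x0 x y \<le> d x y / 2 powr l"
              by (rule jdist_le) (use A[OF x] A[OF y] in auto)
            also have "\<dots> \<le> c * \<sigma>" using dd by (simp add: divide_le_eq mult.assoc)
            finally show ?thesis .
          qed
        qed (use A in auto)
      qed (simp only: chain_colorable_empty)
    qed
  qed
  show ?thesis
    unfolding conical_dim_le_def
  proof (intro allI impI)
    fix \<delta> :: real assume \<delta>: "\<delta> > 0"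
    \<comment> \<open>The union lemma needs c\<sigma>1 + 2(\<sigma>1/4) \<le> \<sigma>2/4, which the
      factor 4c + 2 turns into an equality. The resulting bound is at most (c + 1)\<sigma>2, so
      \<sigma>2 is chosen to keep this below \<delta>.\<close>
    define \<sigma>2 where "\<sigma>2 = min 1 (\<delta> / (c + 1))"
    define \<sigma>1 where "\<sigma>1 = \<sigma>2 / (4 * c + 2)"
    have \<sigma>2: "0 < \<sigma>2" "\<sigma>2 \<le> 1" using \<delta> c by (auto simp: \<sigma>2_def)
    have "\<sigma>2 \<le> \<delta> / (c + 1)" by (simp add: \<sigma>2_def)
    then have \<sigma>2_le: "(c + 1) * \<sigma>2 \<le> \<delta>" using c by (simp add: le_divide_eq mult.commute)
    have \<sigma>1_eq: "4 * c * \<sigma>1 + 2 * \<sigma>1 = \<sigma>2"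
    proof -
      have "\<sigma>1 * (4 * c + 2) = \<sigma>2" using c by (simp add: \<sigma>1_def)
      then show ?thesis by (simp add: algebra_simps)
    qed
    have c\<sigma>1: "0 < c * \<sigma>1" "0 < \<sigma>1" using c \<sigma>2 by (auto simp: \<sigma>1_def)
    obtain R1 where R1: "R1 > 0"
      "\<And>p. chain_colorable (jdist x0) n (\<sigma>1 / 4) (c * \<sigma>1) {x \<in> far x0 R1. even (k x) = p}"
      using half[of \<sigma>1] c\<sigma>1 \<sigma>1_eq \<sigma>2 by force
    obtain R2 where R2: "R2 > 0"
      "\<And>p. chain_colorable (jdist x0) n (\<sigma>2 / 4) (c * \<sigma>2) {x \<in> far x0 R2. even (k x) = p}"
      using half[of \<sigma>2] \<sigma>2 by blast
    have "chain_colorable (jdist x0) n (\<sigma>1 / 4) (c * \<sigma>2 + 2 * (c * \<sigma>1 + \<sigma>1 / 4))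
      ({x \<in> far x0 R1. even (k x) = True} \<union> {x \<in> far x0 R2. even (k x) = False})"
      by (rule J.chain_colorable_union[OF _ _ R1(2) R2(2)])
         (use R1(1) R2(1) c\<sigma>1 \<sigma>1_eq c \<sigma>2 x0 in \<open>auto simp: far_def\<close>)
    moreover have "c * \<sigma>2 + 2 * (c * \<sigma>1 + \<sigma>1 / 4) \<le> \<delta>"
      using \<sigma>2_le \<sigma>2(1) \<sigma>1_eq c\<sigma>1 by (simp add: algebra_simps)
    moreover have "far x0 (max R1 R2) \<subseteq>
      {x \<in> far x0 R1. even (k x) = True} \<union> {x \<in> far x0 R2. even (k x) = False}"
      by (auto simp: far_def)
    ultimately have "chain_colorable (jdist x0) n (\<sigma>1 / 4) \<delta> (far x0 (max R1 R2))"
      by (rule chain_colorable_mono[OF _ order_refl])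
    then show "\<exists>\<eta>>0. \<exists>R>0. chain_colorable (jdist x0) n \<eta> \<delta> (far x0 R)"
      using c\<sigma>1 R1(1) by (intro ex2I[where a = "\<sigma>1 / 4" and b = "max R1 R2"]) auto
  qed
qed

text \<open>A ball of radius \<open>r\<close> is moved to distance about \<open>2r\<close> from the base point, where \<^const>\<open>jdist\<close> is
  comparable to \<open>d / r\<close>.  The finitely many colour classes of a colouring that witnesses
  \<open>AN_asdim_le N\<close> are then refined and merged one at a time, each at a
  scale that is much larger than the previous one.\<close>

lemma conical_dim_le_imp_AN_asdim_le:
  assumes con: "conical_dim_le x0 n" and AN: "AN_asdim_le N"
    and hom: "\<And>r x. r > 0 \<Longrightarrow> x \<in> M \<Longrightarrow> \<exists>\<phi>. \<phi> ` M \<subseteq> M \<and>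
      (\<forall>y\<in>M. \<forall>z\<in>M. d (\<phi> y) (\<phi> z) = d y z) \<and> 2 * r \<le> d (\<phi> x) x0 \<and> d (\<phi> x) x0 \<le> 2 * r + 1"
    and x0: "x0 \<in> M"
  shows "AN_asdim_le n"
proof -
  have local: "\<exists>\<eta>>0. \<exists>R>0. \<forall>r\<ge>R. \<forall>x\<in>M. chain_colorable d n (\<eta> * r) (\<delta> * r) (mcball x r)"
    if \<delta>: "\<delta> > 0" for \<delta>
  proof -
    \<comment> \<open>On the translated ball norms are at most \<open>4 * r\<close>, so
      \<open>dist_le_jdist\<close> gives \<open>8 * \<delta>' * r\<close>; the cap 1 is the
      hypothesis of that lemma.\<close>
    define \<delta>' where "\<delta>' = min 1 (\<delta> / 8)"
    have \<delta>': "0 < \<delta>'" "\<delta>' \<le> 1" "8 * \<delta>' \<le> \<delta>" using \<delta> by (auto simp: \<delta>'_def)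
    obtain \<eta> R where \<eta>: "\<eta> > 0" and R: "R > 0" and col: "chain_colorable (jdist x0) n \<eta> \<delta>' (far x0 R)"
      using con[unfolded conical_dim_le_def, rule_format, OF \<delta>'(1)] by blast
    have loc: "chain_colorable d n (\<eta> * r) (\<delta> * r) (mcball x r)" if r: "r \<ge> max 1 R" and x: "x \<in> M" for r x
    proof -
      have r1: "r \<ge> 1" "r \<ge> R" using r by auto
      have "r > 0" using r1 by simp
      from hom[OF this x] obtain \<phi> where \<phi>0: "\<phi> ` M \<subseteq> M" "\<forall>y\<in>M. \<forall>z\<in>M. d (\<phi> y) (\<phi> z) = d y z"
        and \<phi>r: "2 * r \<le> d (\<phi> x) x0" "d (\<phi> x) x0 \<le> 2 * r + 1" by blast
      have \<phi>: "\<phi> y \<in> M" "z \<in> M \<Longrightarrow> d (\<phi> y) (\<phi> z) = d y z" if "y \<in> M" for y z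
        using \<phi>0 that by auto
      \<comment> \<open>The centre has norm between 2r and 2r + 1, hence the ball has norms between
        r and 3r + 1, and r \<ge> 1 absorbs the 1.\<close>
      have b: "y \<in> M" "\<phi> y \<in> M" "r \<le> d (\<phi> y) x0" "d (\<phi> y) x0 \<le> 4 * r" if y: "y \<in> mcball x r" for y
      proof -
        have *: "y \<in> M" "\<phi> y \<in> M" "\<phi> x \<in> M" "d (\<phi> x) (\<phi> y) \<le> r"
          using y x \<phi>(1)[of y] \<phi>(1)[OF x] \<phi>(2)[OF x, of y] by simp_all
        then show "y \<in> M" "\<phi> y \<in> M" "r \<le> d (\<phi> y) x0" "d (\<phi> y) x0 \<le> 4 * r"
          using triangle[of "\<phi> x" "\<phi> y" x0] triangle[of "\<phi> y" "\<phi> x" x0] commute[of "\<phi> x" "\<phi> y"] x0 \<phi>r r1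
          by simp_all
      qed
      from col show ?thesis
      proof (rule chain_colorable_map[where f = \<phi>])
        fix y z assume y: "y \<in> mcball x r" and z: "z \<in> mcball x r"
        show "jdist x0 (\<phi> y) (\<phi> z) \<le> \<eta>" if "d y z \<le> \<eta> * r"
        proof -
          have "jdist x0 (\<phi> y) (\<phi> z) \<le> d (\<phi> y) (\<phi> z) / r"
            by (rule jdist_le) (use b[OF y] b[OF z] r1 in auto)
          also have "\<dots> \<le> \<eta>" using that b[OF y] b[OF z] r1 \<phi>(2)[of y z] by (simp add: divide_le_eq)
          finally show ?thesis .
        qed
        show "d y z \<le> \<delta> * r" if j: "jdist x0 (\<phi> y) (\<phi> z) \<le> \<delta>'"
        proof -
          have "d (\<phi> y) (\<phi> z) \<le> 2 * \<delta>' * min (d (\<phi> y) x0) (d (\<phi> z) x0)"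
            by (rule dist_le_jdist[OF j \<delta>'(2)]) (use b(3)[OF y] b(3)[OF z] r1 in auto)
          also have "\<dots> \<le> 2 * \<delta>' * (4 * r)" using b(4)[OF y] \<delta>' by (intro mult_left_mono) auto
          also have "\<dots> = 8 * \<delta>' * r" by simp
          also have "\<dots> \<le> \<delta> * r" using \<delta>' r1 by (intro mult_right_mono) auto
          finally show ?thesis using \<phi>(2)[OF b(1)[OF y] b(1)[OF z]] by simp
        qed
      next
        show "\<phi> ` mcball x r \<subseteq> far x0 R"
        proof
          fix w assume "w \<in> \<phi> ` mcball x r"
          then obtain y where "y \<in> mcball x r" "w = \<phi> y" by blast
          then show "w \<in> far x0 R" using b(2,3)[of y] r1 by (simp add: far_def)
        qed
      qed
    qed
    show ?thesis
      by (rule ex2I[where a = \<eta> and b = "max 1 R"]) (use \<eta> loc in auto)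
  qed
  obtain c s0 where c: "c > 0" and s0: "s0 > 0"
    and col: "\<And>s. s \<ge> s0 \<Longrightarrow> chain_colorable d N s (c * s) M" using AN unfolding AN_asdim_le_iff by blast
  \<comment> \<open>One colouring is fixed for each scale, so that all classes merged at scale
    \<open>s\<close> belong to the same colouring.\<close>
  have "\<forall>s. \<exists>A. s \<ge> s0 \<longrightarrow> (\<forall>x\<in>M. A x \<le> N) \<and> (\<forall>i\<le>N. chain_bounded d s (c * s) {x \<in> M. A x = i})"
    using col unfolding chain_colorable_def by blast
  from choice[OF this] obtain A where A: "\<And>s x. s \<ge> s0 \<Longrightarrow> x \<in> M \<Longrightarrow> A s x \<le> N"
    "\<And>s i. s \<ge> s0 \<Longrightarrow> i \<le> N \<Longrightarrow> chain_bounded d s (c * s) {x \<in> M. A s x = i}" by blast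
  have piece: "\<exists>\<eta>>0. \<exists>S\<ge>s0. \<forall>s\<ge>S. \<forall>i\<le>N. chain_colorable d n (\<eta> * s) (\<delta> * s) {x \<in> M. A s x = i}"
    if \<delta>: "\<delta> > 0" for \<delta>
  proof -
    obtain \<eta> R where \<eta>: "\<eta> > 0" and R: "R > 0"
      and lc: "\<And>r x. r \<ge> R \<Longrightarrow> x \<in> M \<Longrightarrow> chain_colorable d n (\<eta> * r) (\<delta> / c * r) (mcball x r)"
      using local[of "\<delta> / c"] \<delta> c by auto
    \<comment> \<open>The cap 1 keeps the short steps inside chain classes at scale
      \<open>s\<close>. Each class lies in a ball of radius \<open>c * s\<close>, where the local
      colouring applies.\<close>
    define \<eta>' where "\<eta>' = min 1 (\<eta> * c)"
    have \<eta>': "0 < \<eta>'" "\<eta>' \<le> 1" "\<eta>' \<le> \<eta> * c" using \<eta> c by (auto simp: \<eta>'_def)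
    have col': "chain_colorable d n (\<eta>' * s) (\<delta> * s) {x \<in> M. A s x = i}"
      if s: "s \<ge> max s0 (R / c)" and i: "i \<le> N" for s i
    proof -
      have s1: "s \<ge> s0" "R \<le> c * s" "s > 0" using s s0 c by (auto simp: field_simps)
      define K where "K x = {y. (x, y) \<in> (chain_step d s {z \<in> M. A s z = i})\<^sup>*}" for x
      show ?thesis
      proof (rule chain_colorable_labels[where lab = K])
        fix x y assume "x \<in> {x \<in> M. A s x = i}" "y \<in> {x \<in> M. A s x = i}" "d x y \<le> \<eta>' * s"
        moreover have "\<eta>' * s \<le> 1 * s" using \<eta>' s1 by (intro mult_right_mono) auto
        ultimately show "K x = K y"
          unfolding K_def by (intro chain_class_eq) (auto simp: chain_step_def)
      next
        fix l
        let ?B = "{x \<in> {x \<in> M. A s x = i}. K x = l}"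
        show "chain_colorable d n (\<eta>' * s) (\<delta> * s) ?B"
        proof (cases "?B = {}")
          case False
          then obtain x where x: "x \<in> ?B" by blast
          have 1: "?B \<subseteq> mcball x (c * s)"
          proof
            fix y assume y: "y \<in> ?B"
            have "y \<in> K y" by (simp add: K_def)
            then have "(x, y) \<in> (chain_step d s {z \<in> M. A s z = i})\<^sup>*"
              using x y by (auto simp: K_def)
            then have "d x y \<le> c * s" using chain_boundedD[OF A(2)[OF s1(1) i]] x by blast
            then show "y \<in> mcball x (c * s)" using x y by simp
          qed
          have 2: "chain_colorable d n (\<eta> * (c * s)) (\<delta> / c * (c * s)) (mcball x (c * s))"
            using lc s1 x by blast
          have 3: "\<eta>' * s \<le> \<eta> * (c * s)"
            using mult_right_mono[OF \<eta>'(3), of s] s1 by (simp add: mult.assoc)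
          have "\<delta> / c * (c * s) \<le> \<delta> * s" using c by simp
          then show ?thesis by (rule chain_colorable_mono[OF 2 3 _ 1])
        qed (simp only: chain_colorable_empty)
      qed
    qed
    show ?thesis
      by (rule ex2I[where a = \<eta>' and b = "max s0 (R / c)"]) (use \<eta>'(1) col' in auto)
  qed
  \<comment> \<open>The bound is quantified inside the induction: it must be made small for the
    first \<open>m\<close> classes after the step of the next class is known.\<close>
  have merged: "\<forall>\<delta>>0. \<exists>\<eta>>0. \<exists>S\<ge>s0. \<forall>s\<ge>S. chain_colorable d n (\<eta> * s) (\<delta> * s) {x \<in> M. A s x < m}"
    if "m \<le> N + 1" for m
    using that
  proof (induction m)
    case 0
    show ?case by (auto simp: chain_colorable_empty intro: zero_less_one)
  next
    case (Suc m)
    show ?case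
    proof (intro allI impI)
      fix \<delta> :: real assume \<delta>: "\<delta> > 0"
      obtain \<eta>1 S1 where \<eta>1: "\<eta>1 > 0" and S1: "S1 \<ge> s0"
        and c1: "\<And>s i. s \<ge> S1 \<Longrightarrow> i \<le> N \<Longrightarrow> chain_colorable d n (\<eta>1 * s) (\<delta> / 2 * s) {x \<in> M. A s x = i}"
        using piece[of "\<delta> / 2"] \<delta> by auto
      \<comment> \<open>With \<eta> \<le> \<delta>', the third of \<open>\<eta>1\<close> yields the
        scale gap \<delta>' + 2\<eta> \<le> \<open>\<eta>1\<close>, and the eighth of \<delta>
        yields \<delta>/2 + 2(\<delta>' + \<eta>) \<le> \<delta>.\<close>
      define \<delta>' where "\<delta>' = min (\<delta> / 8) (\<eta>1 / 3)"
      have \<delta>': "\<delta>' > 0" "8 * \<delta>' \<le> \<delta>" "3 * \<delta>' \<le> \<eta>1" using \<delta> \<eta>1 by (auto simp: \<delta>'_def)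
      obtain \<eta>2 S2 where \<eta>2: "\<eta>2 > 0" and S2: "S2 \<ge> s0"
        and c2: "\<And>s. s \<ge> S2 \<Longrightarrow> chain_colorable d n (\<eta>2 * s) (\<delta>' * s) {x \<in> M. A s x < m}"
        using Suc.IH[OF Suc_leD[OF Suc.prems], rule_format, OF \<delta>'(1)] by blast
      define \<eta> where "\<eta> = min \<eta>2 \<delta>'"
      have \<eta>: "\<eta> > 0" "\<eta> \<le> \<eta>2" "\<eta> \<le> \<delta>'" using \<eta>2 \<delta>' by (auto simp: \<eta>_def)
      have col': "chain_colorable d n (\<eta> * s) (\<delta> * s) {x \<in> M. A s x < Suc m}" if s: "s \<ge> max S1 S2" for s
      proof -
        have s1: "s \<ge> S1" "s \<ge> S2" "s > 0" using s S1 s0 by auto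
        have X: "chain_colorable d n (\<eta> * s) (\<delta>' * s) {x \<in> M. A s x < m}"
          by (rule chain_colorable_mono[OF c2[OF s1(2)]]) (use \<eta> s1 in \<open>auto intro: mult_right_mono\<close>)
        have Y: "chain_colorable d n (\<eta>1 * s) (\<delta> / 2 * s) {x \<in> M. A s x = m}"
          using c1[OF s1(1)] Suc.prems by simp
        have "\<delta>' + 2 * \<eta> \<le> \<eta>1" using \<eta> \<delta>' by linarith
        moreover have "\<delta> / 2 + 2 * (\<delta>' + \<eta>) \<le> \<delta>"
          using \<eta>(3) \<delta>'(2) by (simp add: distrib_left)
        ultimately have "(\<delta>' + 2 * \<eta>) * s \<le> \<eta>1 * s" "(\<delta> / 2 + 2 * (\<delta>' + \<eta>)) * s \<le> \<delta> * s"
          using s1 by (simp_all add: mult_right_mono)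
        then have le: "\<delta>' * s + 2 * (\<eta> * s) \<le> \<eta>1 * s"
          "\<delta> / 2 * s + 2 * (\<delta>' * s + \<eta> * s) \<le> \<delta> * s" by (simp_all add: algebra_simps)
        have "chain_colorable d n (\<eta> * s) (\<delta> / 2 * s + 2 * (\<delta>' * s + \<eta> * s))
           ({x \<in> M. A s x < m} \<union> {x \<in> M. A s x = m})"
          by (rule chain_colorable_union[OF _ _ X Y le(1)]) (use s1 \<eta> \<delta>' \<delta> in auto)
        then show ?thesis by (rule chain_colorable_mono) (use le(2) in auto)
      qed
      show "\<exists>\<eta>>0. \<exists>S\<ge>s0. \<forall>s\<ge>S. chain_colorable d n (\<eta> * s) (\<delta> * s) {x \<in> M. A s x < Suc m}"
        by (rule ex2I[where a = \<eta> and b = "max S1 S2"]) (use \<eta>(1) S1 col' in auto)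
    qed
  qed
  \<comment> \<open>A single bound suffices now: steps \<eta>s with bound s, read at r = \<eta>s,
    give linear control with constant 1/\<eta>.\<close>
  obtain \<eta> S where \<eta>: "\<eta> > 0" and S: "S \<ge> s0"
    and fin: "\<And>s. s \<ge> S \<Longrightarrow> chain_colorable d n (\<eta> * s) (1 * s) {x \<in> M. A s x < N + 1}"
    using merged[OF order_refl, rule_format, OF zero_less_one] by blast
  have colr: "chain_colorable d n r (1 / \<eta> * r) M" if r: "r \<ge> \<eta> * S" for r
  proof -
    have rS: "r / \<eta> \<ge> S" using r \<eta> by (simp add: field_simps)
    have "{x \<in> M. A (r / \<eta>) x < N + 1} = M" using A(1)[of "r / \<eta>"] rS S by force
    then show ?thesis using fin[OF rS] \<eta> by simp
  qed
  show ?thesis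
    unfolding AN_asdim_le_iff
    by (rule ex2I[where a = "1 / \<eta>" and b = "\<eta> * S"]) (use \<eta> S s0 colr in auto)
qed

end

section \<open>The sublinear Higson corona\<close>

locale higson_corona = Metric_space M d for M :: "'a set" and d +
  fixes x0 :: 'a and Z :: "'z topology" and \<iota> :: "'a \<Rightarrow> 'z"
  assumes x0: "x0 \<in> M"
    and locally_finite: "\<And>K. mbounded K \<Longrightarrow> finite K"
    and compactification: "sublinear_higson_compactification x0 Z \<iota>"
begin

abbreviation corona where "corona \<equiv> topspace Z - \<iota> ` M"

section \<open>Discreteness of the space and the topology of its compactification\<close>

lemma finite_mcball: "finite (mcball x r)"
  by (rule locally_finite) (rule mbounded_mcball)

lemma finite_near: "finite {x \<in> M. d x x0 < R}"
  by (rule finite_subset[OF _ finite_mcball[of x0 R]]) (use x0 commute in auto)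

lemma finite_diff_far: "S \<subseteq> M \<Longrightarrow> finite (S - far x0 R)"
  by (rule finite_subset[OF _ finite_near[of R]]) (auto simp: far_def)

lemma finite_imp_near:
  assumes "finite F"
  obtains R where "R > 0" "far x0 R \<inter> F = {}"
proof (rule that)
  let ?R = "Max (insert 0 ((\<lambda>x. d x x0) ` F)) + 1"
  have le: "d x x0 \<le> Max (insert 0 ((\<lambda>x. d x x0) ` F))" if "x \<in> F" for x
    using that assms by (intro Max_ge) auto
  have "0 \<le> Max (insert 0 ((\<lambda>x. d x x0) ` F))" using assms by (intro Max_ge) auto
  then show "0 < ?R" by simp
  show "far x0 ?R \<inter> F = {}" using le by (fastforce simp: far_def)
qed

lemma openin_subset_M:
  assumes "S \<subseteq> M" shows "openin mtopology S"
  unfolding openin_mtopology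
proof (intro conjI allI impI)
  fix x assume x: "x \<in> S"
  define F where "F = mcball x 1 - {x}"
  define r where "r = Min (insert 1 (d x ` F))"
  have F: "finite F" by (simp add: F_def finite_mcball)
  have "d x y > 0" if "y \<in> F" for y using that by (auto simp: F_def)
  then have "r > 0" using F by (simp add: r_def)
  moreover have "y = x" if "y \<in> mball x r" for y
  proof (rule ccontr)
    assume "y \<noteq> x"
    have "r \<le> 1" using F by (simp add: r_def)
    then have "y \<in> F" using that \<open>y \<noteq> x\<close> by (auto simp: F_def)
    then have "r \<le> d x y" using F by (simp add: r_def)
    then show False using that by simp
  qed
  ultimately show "\<exists>r>0. mball x r \<subseteq> S" using x by blast
qed (use assms in auto)

lemma continuous_map_M: "continuous_map mtopology euclidean f"
  by (auto simp: continuous_map_def intro: openin_subset_M)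

lemma bounded_continuous_iff: "f \<in> bounded_continuous \<longleftrightarrow> bounded (f ` M)"
  by (simp add: bounded_continuous_def continuous_map_M)

lemma compact_Z: "compact_space Z" and Hausdorff_Z: "Hausdorff_space Z"
  and embedding: "embedding_map mtopology Z \<iota>" and dense_image: "Z closure_of (\<iota> ` M) = topspace Z"
  using compactification by (auto simp: sublinear_higson_compactification_def compactification_def)

lemma extends_iff_higson:
  "bounded (f ` M) \<Longrightarrow> (\<exists>g. continuous_map Z euclidean g \<and> (\<forall>x\<in>M. g (\<iota> x) = f x)) \<longleftrightarrow>
     f \<in> higson_functions (sublinear_coarse_structure x0)"
  using compactification by (simp add: sublinear_higson_compactification_def bounded_continuous_iff)

lemma embedding_homeo: "homeomorphic_map mtopology (subtopology Z (\<iota> ` M)) \<iota>"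
  using embedding by (simp add: embedding_map_def)

lemma inj_\<iota>: "inj_on \<iota> M"
  using homeomorphic_imp_injective_map[OF embedding_homeo] by simp

lemma image_subset_Z: "S \<subseteq> M \<Longrightarrow> \<iota> ` S \<subseteq> topspace Z"
  using homeomorphic_imp_surjective_map[OF embedding_homeo] by auto

text \<open>An open set of \<open>Z\<close> that traces only this point on the dense image has
  nothing else in it, because the rest would be open and miss the image.\<close>

lemma openin_singleton:
  assumes x: "x \<in> M" shows "openin Z {\<iota> x}"
proof -
  have "openin (subtopology Z (\<iota> ` M)) (\<iota> ` {x})"
    using homeomorphic_map_openness[OF embedding_homeo, of "{x}"] openin_subset_M[of "{x}"] x by simp
  then obtain T where T: "openin Z T" "{\<iota> x} = T \<inter> \<iota> ` M" by (auto simp: openin_subtopology)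
  have "closedin Z {\<iota> x}"
    using Hausdorff_Z image_subset_Z[of "{x}"] x by (intro closedin_Hausdorff_finite) auto
  then have o: "openin Z (T - {\<iota> x})" using T(1) by (simp add: openin_diff)
  have "T - {\<iota> x} = {}"
    using dense_image o T(2) unfolding dense_intersects_open by blast
  then have "T = {\<iota> x}" using T(2) by blast
  then show ?thesis using T(1) by simp
qed

lemma openin_image:
  assumes "S \<subseteq> M" shows "openin Z (\<iota> ` S)"
proof -
  have "\<iota> ` S = (\<Union>x\<in>S. {\<iota> x})" by blast
  moreover have "openin Z (\<Union>x\<in>S. {\<iota> x})" using assms openin_singleton by blast
  ultimately show ?thesis by simp
qed

lemma closedin_corona: "closedin Z corona"
  using openin_image[of M] by (simp add: closedin_def Diff_Diff_Int inf.absorb2 image_subset_Z)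

lemma closure_of_finite_image: "S \<subseteq> M \<Longrightarrow> finite S \<Longrightarrow> Z closure_of (\<iota> ` S) = \<iota> ` S"
  by (intro closure_of_closedin closedin_Hausdorff_finite Hausdorff_Z image_subset_Z) auto

text \<open>The closure is then a compact set covered by open singletons. This turns inclusions
  between subsets of the corona into inclusions outside a ball.\<close>

lemma finite_of_closure_avoids_corona:
  assumes S: "S \<subseteq> M" and cl: "Z closure_of (\<iota> ` S) \<inter> corona = {}"
  shows "finite S"
proof -
  let ?C = "Z closure_of (\<iota> ` S)"
  have C: "?C \<subseteq> \<iota> ` M" using cl closure_of_subset_topspace[of Z "\<iota> ` S"] by blast
  have "compactin Z ?C" using compact_Z by (intro closedin_compact_space) auto
  then obtain \<F> where F: "finite \<F>" "\<F> \<subseteq> (\<lambda>x. {\<iota> x}) ` M" "?C \<subseteq> \<Union>\<F>"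
    using compactinD[of Z ?C "(\<lambda>x. {\<iota> x}) ` M"] C openin_singleton by blast
  have "finite (\<Union>\<F>)" using F(1,2) by (intro finite_Union) auto
  then have "finite ?C" using F(3) finite_subset by blast
  moreover have "\<iota> ` S \<subseteq> ?C" by (rule closure_of_subset[OF image_subset_Z[OF S]])
  ultimately have "finite (\<iota> ` S)" using finite_subset by blast
  then show ?thesis using finite_imageD inj_on_subset[OF inj_\<iota> S] by blast
qed

text \<open>The discarded part is finite, so its image is closed and contains no point of the
  corona.\<close>

lemma closure_of_far:
  assumes S: "S \<subseteq> M" and p: "p \<in> corona" "p \<in> Z closure_of (\<iota> ` S)"
  shows "p \<in> Z closure_of (\<iota> ` (S \<inter> far x0 R))"
proof -
  have "\<iota> ` S = \<iota> ` (S \<inter> far x0 R) \<union> \<iota> ` (S - far x0 R)" by blast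
  then have "Z closure_of (\<iota> ` S) = Z closure_of (\<iota> ` (S \<inter> far x0 R)) \<union> \<iota> ` (S - far x0 R)"
    using closure_of_finite_image[of "S - far x0 R"] finite_diff_far[OF S] S
    by (metis Diff_subset closure_of_Un order_trans)
  then show ?thesis using p S by blast
qed

section \<open>Higson functions as functions uniformly continuous at infinity\<close>

lemma eventually_norm_at_infinity:
  "eventually P (norm_at_infinity x0) \<longleftrightarrow> (\<exists>R. \<forall>x\<in>M. R \<le> d x x0 \<longrightarrow> P x)"
  unfolding norm_at_infinity_def eventually_inf_principal eventually_filtercomap_at_top_linorder
  by blast

lemma ennreal_tendsto_0:
  fixes f :: "'b \<Rightarrow> ennreal"
  assumes "\<And>e. e > (0::real) \<Longrightarrow> eventually (\<lambda>x. f x \<le> ennreal e) F"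
  shows "(f \<longlongrightarrow> 0) F"
proof (rule order_tendstoI)
  fix a :: ennreal assume "0 < a"
  then obtain b where b: "0 < b" "b < a" using dense by blast
  then have "b \<noteq> \<infinity>" by (metis ennreal_less_top infinity_ennreal_def less_le_not_le order_less_trans top_greatest)
  then obtain e where e: "b = ennreal e" "0 \<le> e" by (cases b) auto
  then have "e > 0" using b(1) by (cases "e = 0") auto
  then have "eventually (\<lambda>x. f x \<le> b) F" using assms[of e] e by simp
  then show "eventually (\<lambda>x. f x < a) F" by eventually_elim (use b in auto)
qed auto

lemma sublinear_sup_le:
  assumes "0 < c" "0 \<le> e" and "\<And>y. y \<in> A \<Longrightarrow> h y \<le> e * c"
  shows "(SUP y\<in>A. ennreal (h y)) / ennreal c \<le> ennreal e"
proof -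
  have "(SUP y\<in>A. ennreal (h y)) \<le> ennreal (e * c)"
    using assms by (intro SUP_least ennreal_leI) auto
  then have "(SUP y\<in>A. ennreal (h y)) / ennreal c \<le> ennreal (e * c) / ennreal c"
    by (rule divide_right_mono_ennreal)
  also have "\<dots> = ennreal e" using assms by (simp add: divide_ennreal)
  finally show ?thesis .
qed

lemma sublinear_supD:
  assumes "(SUP y\<in>A. ennreal (h y)) / ennreal c < ennreal e" "0 < c" "y \<in> A" "0 \<le> h y"
  shows "h y \<le> e * c"
proof -
  have "ennreal (h y) \<le> (SUP y\<in>A. ennreal (h y))" using assms by (intro SUP_upper)
  then have "ennreal (h y) / ennreal c \<le> (SUP y\<in>A. ennreal (h y)) / ennreal c"
    by (rule divide_right_mono_ennreal)
  then have "ennreal (h y / c) < ennreal e" using assms by (simp add: divide_ennreal)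
  then have "h y / c < e" using assms by (simp add: ennreal_less_iff)
  then show ?thesis using assms by (simp add: divide_less_eq)
qed

text \<open>Far from \<open>x0\<close> only pairs of large index occur, and for these the factor is
  small. It is applied to a sequence of pairs and to its reversal, giving the two limits of the
  coarse structure.\<close>

lemma sublinear_limit_of_pairs:
  assumes P: "\<And>k. d (P k) (Q k) \<le> 2 / real (Suc k) * d (Q k) x0"
  shows "((\<lambda>x. (SUP y\<in>{y. \<exists>k. y = P k \<and> x = Q k}. ennreal (d y x)) / ennreal (d x x0)) \<longlongrightarrow> 0)
     (norm_at_infinity x0)"
proof (rule ennreal_tendsto_0)
  fix e :: real assume e: "e > 0"
  obtain N :: nat where N: "2 / e < real N" using reals_Archimedean2 by blast
  obtain R where R: "R > 0" "far x0 R \<inter> Q ` {..<N} = {}" using finite_imp_near[of "Q ` {..<N}"] by auto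
  show "eventually (\<lambda>x. (SUP y\<in>{y. \<exists>k. y = P k \<and> x = Q k}. ennreal (d y x)) / ennreal (d x x0)
      \<le> ennreal e) (norm_at_infinity x0)"
    unfolding eventually_norm_at_infinity
  proof (intro exI ballI impI)
    fix x assume x: "x \<in> M" "R \<le> d x x0"
    show "(SUP y\<in>{y. \<exists>k. y = P k \<and> x = Q k}. ennreal (d y x)) / ennreal (d x x0) \<le> ennreal e"
    proof (rule sublinear_sup_le)
      show "0 < d x x0" using x R by simp
      show "0 \<le> e" using e by simp
      fix y assume "y \<in> {y. \<exists>k. y = P k \<and> x = Q k}"
      then obtain k where k: "y = P k" "x = Q k" by blast
      have "k \<ge> N" using R(2) x k by (force simp: far_def)
      then have "2 / e < real (Suc k)" using N by simp
      then have "2 / real (Suc k) \<le> e" using e by (simp add: field_simps)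
      then have "2 / real (Suc k) * d x x0 \<le> e * d x x0" by (intro mult_right_mono) auto
      then show "d y x \<le> e * d x x0" using P[of k] k by simp
    qed
  qed
qed

text \<open>On pairs of a sublinear set that leave all balls, \<open>jdist\<close> tends to 0.
  Conversely, a sequence of pairs going to infinity with \<open>jdist\<close> tending to 0 is itself
  a sublinear set, so a failure of uniformity along it contradicts the Higson condition.\<close>

lemma higson_iff:
  assumes bd: "bounded (f ` M)"
  shows "f \<in> higson_functions (sublinear_coarse_structure x0) \<longleftrightarrow>
    (\<forall>e>0. \<exists>\<delta>>0. \<exists>R>0. \<forall>x\<in>far x0 R. \<forall>y\<in>far x0 R. jdist x0 x y \<le> \<delta> \<longrightarrow> cmod (f x - f y) < e)"
proof
  assume R: "\<forall>e>0. \<exists>\<delta>>0. \<exists>R>0. \<forall>x\<in>far x0 R. \<forall>y\<in>far x0 R. jdist x0 x y \<le> \<delta> \<longrightarrow> cmod (f x - f y) < e"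
  show "f \<in> higson_functions (sublinear_coarse_structure x0)"
  proof (rule higsonI)
    show "f \<in> bounded_continuous" using bd by (simp add: bounded_continuous_iff)
    fix E and e :: real assume E: "E \<in> sublinear_coarse_structure x0" and e: "e > 0"
    obtain \<delta>1 R1 where \<delta>1: "\<delta>1 > 0" and R1: "R1 > 0"
      and f: "\<And>x y. x \<in> far x0 R1 \<Longrightarrow> y \<in> far x0 R1 \<Longrightarrow> jdist x0 x y \<le> \<delta>1 \<Longrightarrow> cmod (f x - f y) < e"
      using R[rule_format, OF e] by blast
    \<comment> \<open>\<delta> \<le> 1/2 keeps |y| \<ge> |x|/2, so that \<open>jdist\<close> is at
      most 2\<delta>; for the same reason the radius below is at least
      \<open>2 * R1\<close>.\<close>
    define \<delta> where "\<delta> = min 1 \<delta>1 / 2"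
    have \<delta>: "\<delta> > 0" "\<delta> \<le> 1/2" "2 * \<delta> \<le> \<delta>1" using \<delta>1 by (auto simp: \<delta>_def)
    have EM: "E \<subseteq> M \<times> M"
      and lim: "((\<lambda>x. (SUP y\<in>coarse_section E {x}. ennreal (d y x)) / ennreal (d x x0)) \<longlongrightarrow> 0) (norm_at_infinity x0)"
       "((\<lambda>x. (SUP y\<in>coarse_section (E\<inverse>) {x}. ennreal (d x y)) / ennreal (d x x0)) \<longlongrightarrow> 0) (norm_at_infinity x0)"
      using E by (auto simp: sublinear_coarse_structure_def)
    have "0 < ennreal \<delta>" using \<delta> by simp
    from order_tendstoD(2)[OF lim(1) this] order_tendstoD(2)[OF lim(2) this]
    obtain R2 R3 where R2: "\<And>x. x \<in> M \<Longrightarrow> R2 \<le> d x x0 \<Longrightarrow>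
        (SUP y\<in>coarse_section E {x}. ennreal (d y x)) / ennreal (d x x0) < ennreal \<delta>"
      and R3: "\<And>x. x \<in> M \<Longrightarrow> R3 \<le> d x x0 \<Longrightarrow>
        (SUP y\<in>coarse_section (E\<inverse>) {x}. ennreal (d x y)) / ennreal (d x x0) < ennreal \<delta>"
      unfolding eventually_norm_at_infinity by blast
    define R where "R = Max {2 * R1, R2, R3}"
    have R: "2 * R1 \<le> R" "R2 \<le> R" "R3 \<le> R" by (auto simp: R_def)
    have close: "cmod (f x - f y) < e"
      if xy: "x \<in> M" "y \<in> M" "d x y \<le> \<delta> * d x x0" "R \<le> d x x0" for x y
    proof -
      have "\<delta> * d x x0 \<le> 1/2 * d x x0" using \<delta> by (intro mult_right_mono) auto
      then have y: "d x x0 / 2 \<le> d y x0" using triangle[of x y x0] xy x0 by simp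
      have pos: "d x x0 > 0" using xy R R1 by simp
      have "jdist x0 x y \<le> d x y / (d x x0 / 2)" by (rule jdist_le) (use pos y in auto)
      also have "\<dots> \<le> 2 * \<delta>" using xy pos by (simp add: divide_le_eq)
      also have "\<dots> \<le> \<delta>1" by fact
      finally show ?thesis using f[of x y] xy y R R1 by (simp add: far_def)
    qed
    show "\<exists>K. compactin mtopology K \<and> (\<forall>x y. (y, x) \<in> E - K \<times> K \<longrightarrow> cmod (f x - f y) < e)"
    proof (intro exI conjI allI impI)
      show "compactin mtopology {x \<in> M. d x x0 < R}"
        by (rule finite_imp_compactin) (use finite_near in auto)
      fix x y assume yx: "(y, x) \<in> E - {x \<in> M. d x x0 < R} \<times> {x \<in> M. d x x0 < R}"
      then have M: "x \<in> M" "y \<in> M" using EM by auto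
      \<comment> \<open>A pair outside the square of a ball may have only one far component, and
        either limit may be the one that applies.\<close>
      consider "R \<le> d x x0" | "R \<le> d y x0" using yx M by force
      then show "cmod (f x - f y) < e"
      proof cases
        case 1
        have "y \<in> coarse_section E {x}" using yx by (auto simp: coarse_section_def)
        from sublinear_supD[OF R2[OF M(1)] _ this] have "d y x \<le> \<delta> * d x x0" using 1 R R1 by simp
        then show ?thesis using close[OF M] 1 commute by simp
      next
        case 2
        have "x \<in> coarse_section (E\<inverse>) {y}" using yx by (auto simp: coarse_section_def)
        from sublinear_supD[OF R3[OF M(2)] _ this] have "d y x \<le> \<delta> * d y x0" using 2 R R1 by simp
        then show ?thesis using close[OF M(2,1)] 2 by (simp add: norm_minus_commute)
      qed
    qed
  qed
next
  assume f: "f \<in> higson_functions (sublinear_coarse_structure x0)"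
  show "\<forall>e>0. \<exists>\<delta>>0. \<exists>R>0. \<forall>x\<in>far x0 R. \<forall>y\<in>far x0 R. jdist x0 x y \<le> \<delta> \<longrightarrow> cmod (f x - f y) < e"
  proof (rule ccontr)
    assume "\<not> ?thesis"
    then obtain e where e: "e > 0" and neg: "\<And>\<delta> R. \<delta> > 0 \<Longrightarrow> R > 0 \<Longrightarrow>
        \<exists>x\<in>far x0 R. \<exists>y\<in>far x0 R. jdist x0 x y \<le> \<delta> \<and> e \<le> cmod (f x - f y)"
      by (meson not_less)
    have "\<forall>k. \<exists>p. fst p \<in> far x0 (real (Suc k)) \<and> snd p \<in> far x0 (real (Suc k)) \<and>
       jdist x0 (fst p) (snd p) \<le> 1 / real (Suc k) \<and> e \<le> cmod (f (fst p) - f (snd p))"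
    proof
      fix k
      obtain x y where "x\<in>far x0 (real (Suc k))" "y\<in>far x0 (real (Suc k))"
        "jdist x0 x y \<le> 1 / real (Suc k)" "e \<le> cmod (f x - f y)"
        using neg[of "1 / real (Suc k)" "real (Suc k)"] by auto
      then show "\<exists>p. fst p \<in> far x0 (real (Suc k)) \<and> snd p \<in> far x0 (real (Suc k)) \<and>
        jdist x0 (fst p) (snd p) \<le> 1 / real (Suc k) \<and> e \<le> cmod (f (fst p) - f (snd p))"
        by (intro exI[of _ "(x, y)"]) simp
    qed
    from choice[OF this] obtain p where p: "\<And>k. fst (p k) \<in> far x0 (real (Suc k)) \<and> snd (p k) \<in> far x0 (real (Suc k)) \<and>
       jdist x0 (fst (p k)) (snd (p k)) \<le> 1 / real (Suc k) \<and> e \<le> cmod (f (fst (p k)) - f (snd (p k)))"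
      by blast
    define X where "X k = fst (p k)" for k
    define Y where "Y k = snd (p k)" for k
    have XY: "X k \<in> M" "Y k \<in> M" "real (Suc k) \<le> d (X k) x0" "real (Suc k) \<le> d (Y k) x0"
      "jdist x0 (X k) (Y k) \<le> 1 / real (Suc k)" "e \<le> cmod (f (X k) - f (Y k))" for k
      using p[of k] by (auto simp: X_def Y_def far_def)
    have dXY: "d (X k) (Y k) \<le> 2 / real (Suc k) * min (d (X k) x0) (d (Y k) x0)" for k
      using dist_le_jdist[OF XY(5), of k] XY(3,4)[of k] by simp
    have dX: "d (Y k) (X k) \<le> 2 / real (Suc k) * d (X k) x0" for k
      using dXY[of k] by (rule order_trans[OF eq_refl[OF commute] order_trans]) (intro mult_left_mono; simp)
    have dY: "d (X k) (Y k) \<le> 2 / real (Suc k) * d (Y k) x0" for k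
      using dXY[of k] by (rule order_trans) (intro mult_left_mono; simp)
    \<comment> \<open>The order of the components matches the pairs \<open>(y, x)\<close> in the
      definition of Higson functions.\<close>
    define E where "E = range (\<lambda>k. (Y k, X k))"
    have bounded_of: "\<exists>N. \<forall>k. W k \<in> K \<longrightarrow> k < N"
      if W: "\<And>k. real (Suc k) \<le> d (W k) x0" and K: "rel_compact K" for W :: "nat \<Rightarrow> 'a" and K
    proof -
      obtain K' where K': "compactin mtopology K'" "K \<subseteq> K'" using rel_compactD[OF K] by blast
      have "finite K'" using K'(1) by (intro locally_finite compactin_imp_mbounded)
      then have "finite K" using K'(2) finite_subset by blast
      then obtain R where R: "far x0 R \<inter> K = {}" using finite_imp_near by blast
      obtain N :: nat where N: "R < real N" using reals_Archimedean2 by blast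
      have KM: "K \<subseteq> M" using K by (simp add: rel_compact_def)
      have "k < N" if k: "W k \<in> K" for k
      proof (rule ccontr)
        assume "\<not> k < N"
        then have "W k \<in> far x0 R" using W[of k] N KM k by (auto simp: far_def)
        then show False using R k by blast
      qed
      then show ?thesis by blast
    qed
    have rc: "rel_compact F" if "finite F" "F \<subseteq> M" for F
      using that by (intro rel_compact_compactin finite_imp_compactin) auto
    have "E \<in> sublinear_coarse_structure x0"
      unfolding sublinear_coarse_structure_def
    proof (intro CollectI conjI)
      show "E \<subseteq> M \<times> M" using XY by (auto simp: E_def)
      show "proper_relation E"
        unfolding proper_relation_def
      proof (intro allI impI conjI)
        fix K assume K: "rel_compact K"
        obtain N where N: "\<And>k. X k \<in> K \<Longrightarrow> k < N" using bounded_of[OF XY(3) K] by blast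
        have "coarse_section E K \<subseteq> Y ` {..<N}" using N by (auto simp: coarse_section_def E_def)
        moreover have "coarse_section E K \<subseteq> M" using XY by (auto simp: coarse_section_def E_def)
        ultimately show "rel_compact (coarse_section E K)" by (meson rc finite_imageI finite_lessThan finite_subset)
        obtain N where N: "\<And>k. Y k \<in> K \<Longrightarrow> k < N" using bounded_of[OF XY(4) K] by blast
        have "coarse_section (E\<inverse>) K \<subseteq> X ` {..<N}" using N by (auto simp: coarse_section_def E_def)
        moreover have "coarse_section (E\<inverse>) K \<subseteq> M" using XY by (auto simp: coarse_section_def E_def)
        ultimately show "rel_compact (coarse_section (E\<inverse>) K)" by (meson rc finite_imageI finite_lessThan finite_subset)
      qed
      have "coarse_section E {x} = {y. \<exists>k. y = Y k \<and> x = X k}" for x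
        by (auto simp: coarse_section_def E_def)
      then show "((\<lambda>x. (SUP y\<in>coarse_section E {x}. ennreal (d y x)) / ennreal (d x x0)) \<longlongrightarrow> 0) (norm_at_infinity x0)"
        using sublinear_limit_of_pairs[OF dX] by simp
      have "coarse_section (E\<inverse>) {x} = {y. \<exists>k. y = X k \<and> x = Y k}" for x
        by (auto simp: coarse_section_def E_def)
      then show "((\<lambda>x. (SUP y\<in>coarse_section (E\<inverse>) {x}. ennreal (d x y)) / ennreal (d x x0)) \<longlongrightarrow> 0) (norm_at_infinity x0)"
        using sublinear_limit_of_pairs[OF dY] by (simp add: commute)
    qed
    then obtain K where K: "compactin mtopology K" "\<And>x y. (y, x) \<in> E - K \<times> K \<Longrightarrow> cmod (f x - f y) < e"
      using higsonE[OF f _ e] by blast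
    obtain N where N: "\<And>k. X k \<in> K \<Longrightarrow> k < N"
      using bounded_of[OF XY(3) rel_compact_compactin[OF K(1)]] by blast
    then have "(Y N, X N) \<in> E - K \<times> K" by (auto simp: E_def)
    then show False using K(2) XY(6)[of N] by force
  qed
qed

section \<open>Extensions to the compactification and covers of the corona\<close>

lemma extension_uniform:
  fixes g :: "'z \<Rightarrow> real"
  assumes g: "continuous_map Z euclideanreal g" and e: "e > 0"
  obtains \<delta> R where "\<delta> > 0" "R > 0" "\<And>x y. x \<in> far x0 R \<Longrightarrow> y \<in> far x0 R \<Longrightarrow> jdist x0 x y \<le> \<delta> \<Longrightarrow>
     \<bar>g (\<iota> x) - g (\<iota> y)\<bar> < e"
proof -
  let ?f = "\<lambda>x. complex_of_real (g (\<iota> x))"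
  have "compact (g ` topspace Z)"
    using image_compactin[OF _ g, of "topspace Z"] compact_Z by (simp add: compact_space_def)
  then have "bounded (g ` topspace Z)" by (rule compact_imp_bounded)
  then obtain B where B: "\<forall>z\<in>topspace Z. \<bar>g z\<bar> \<le> B" unfolding bounded_iff by auto
  have "bounded (?f ` M)" unfolding bounded_iff using B image_subset_Z[of M] by auto
  moreover have "continuous_map Z euclidean (\<lambda>z. complex_of_real (g z))"
    using continuous_map_compose[OF g, of euclidean complex_of_real] by (simp add: o_def continuous_intros)
  ultimately have "?f \<in> higson_functions (sublinear_coarse_structure x0)"
    using extends_iff_higson[of ?f] by blast
  then have "\<exists>\<delta>>0. \<exists>R>0. \<forall>x\<in>far x0 R. \<forall>y\<in>far x0 R. jdist x0 x y \<le> \<delta> \<longrightarrow> cmod (?f x - ?f y) < e"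
    using higson_iff[OF \<open>bounded (?f ` M)\<close>] e by blast
  moreover have "cmod (?f x - ?f y) = \<bar>g (\<iota> x) - g (\<iota> y)\<bar>" for x y
    by (metis norm_of_real of_real_diff)
  ultimately show thesis using that by auto
qed

lemma extension_exists:
  fixes f :: "'a \<Rightarrow> real"
  assumes bd: "\<And>x. x \<in> M \<Longrightarrow> \<bar>f x\<bar> \<le> 1"
    and unif: "\<And>e. e > 0 \<Longrightarrow> \<exists>\<delta>>0. \<exists>R>0. \<forall>x\<in>far x0 R. \<forall>y\<in>far x0 R. jdist x0 x y \<le> \<delta> \<longrightarrow> \<bar>f x - f y\<bar> < e"
  obtains g where "continuous_map Z (euclidean :: complex topology) g" "\<And>x. x \<in> M \<Longrightarrow> g (\<iota> x) = of_real (f x)"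
proof -
  let ?f = "\<lambda>x. complex_of_real (f x)"
  have b: "bounded (?f ` M)" unfolding bounded_iff using bd by auto
  have "cmod (?f x - ?f y) = \<bar>f x - f y\<bar>" for x y by (metis norm_of_real of_real_diff)
  then have "?f \<in> higson_functions (sublinear_coarse_structure x0)"
    using unif higson_iff[OF b] by simp
  then show thesis using extends_iff_higson[OF b] that by blast
qed

text \<open>The truncated \<open>jdist\<close>-distance to \<open>B\<close>, divided by
  \<open>\<epsilon>\<close>, is Lipschitz far out and hence extends to \<open>Z\<close>; its
  extension is 0 on the closure of the far part of \<open>B\<close> and 1 on that of
  \<open>A\<close>.\<close>

lemma separated_closures_disjoint:
  assumes AB: "A \<subseteq> M" "B \<subseteq> M" and \<epsilon>: "\<epsilon> > 0"
    and sep: "\<And>x y. x \<in> A \<inter> far x0 R \<Longrightarrow> y \<in> B \<inter> far x0 R \<Longrightarrow> \<epsilon> < jdist x0 x y"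
    and R: "R > 0" and p: "p \<in> corona"
  shows "p \<notin> Z closure_of (\<iota> ` A) \<or> p \<notin> Z closure_of (\<iota> ` B)"
proof (rule ccontr)
  assume "\<not> ?thesis"
  then have pA: "p \<in> Z closure_of (\<iota> ` (A \<inter> far x0 R))" and pB: "p \<in> Z closure_of (\<iota> ` (B \<inter> far x0 R))"
    using closure_of_far AB p by blast+
  let ?B = "B \<inter> far x0 R"
  \<comment> \<open>The real infimum below is meaningful only over a nonempty set.\<close>
  have "?B \<noteq> {}" using pB by force
  interpret J: Metric_space "M - {x0}" "jdist x0" by (rule Metric_space_jdist[OF x0])
  have farM: "x \<in> M - {x0}" if "x \<in> far x0 R" for x using that R x0 by (auto simp: far_def)
  define D where "D x = (INF b\<in>?B. jdist x0 x b)" for x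
  have bdd: "bdd_below (jdist x0 x ` ?B)" for x by (rule bdd_belowI[of _ 0]) auto
  have Dle: "D x \<le> jdist x0 x b" if "b \<in> ?B" for x b
    unfolding D_def by (rule cINF_lower[OF bdd that])
  have Dge: "t \<le> D x" if "\<And>b. b \<in> ?B \<Longrightarrow> t \<le> jdist x0 x b" for t x
    unfolding D_def by (rule cINF_greatest[OF \<open>?B \<noteq> {}\<close> that])
  have D0: "0 \<le> D x" for x by (rule Dge) simp
  have lip: "D x \<le> jdist x0 x y + D y" if "x \<in> far x0 R" "y \<in> far x0 R" for x y
  proof -
    have "D x - jdist x0 x y \<le> D y"
    proof (rule Dge)
      fix b assume b: "b \<in> ?B"
      have "jdist x0 x b \<le> jdist x0 x y + jdist x0 y b"
        using farM that b by (intro J.triangle) auto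
      then show "D x - jdist x0 x y \<le> jdist x0 y b" using Dle[OF b, of x] by linarith
    qed
    then show ?thesis by simp
  qed
  define f where "f x = min 1 (D x / \<epsilon>)" for x
  have f_lip: "\<bar>f x - f y\<bar> \<le> jdist x0 x y / \<epsilon>" if "x \<in> far x0 R" "y \<in> far x0 R" for x y
  proof -
    have "D x / \<epsilon> \<le> jdist x0 x y / \<epsilon> + D y / \<epsilon>" "D y / \<epsilon> \<le> jdist x0 x y / \<epsilon> + D x / \<epsilon>"
      using lip[OF that] lip[OF that(2,1)] jdist_commute[of x0 x y] \<epsilon>
      by (simp_all add: divide_right_mono flip: add_divide_distrib)
    moreover have "0 \<le> jdist x0 x y / \<epsilon>" using \<epsilon> by simp
    ultimately show ?thesis by (auto simp: f_def min_def abs_if)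
  qed
  obtain g where g: "continuous_map Z (euclidean :: complex topology) g"
    "\<And>x. x \<in> M \<Longrightarrow> g (\<iota> x) = of_real (f x)"
  proof (rule extension_exists[of f])
    show "\<bar>f x\<bar> \<le> 1" for x using D0[of x] \<epsilon> by (simp add: f_def)
    fix e :: real assume e: "e > 0"
    have "\<bar>f x - f y\<bar> < e" if "x \<in> far x0 R" "y \<in> far x0 R" "jdist x0 x y \<le> e * \<epsilon> / 2" for x y
    proof -
      have "jdist x0 x y / \<epsilon> \<le> e / 2" using that(3) \<epsilon> by (simp add: field_simps)
      then show ?thesis using f_lip[OF that(1,2)] e by linarith
    qed
    then show "\<exists>\<delta>>0. \<exists>R>0. \<forall>x\<in>far x0 R. \<forall>y\<in>far x0 R. jdist x0 x y \<le> \<delta> \<longrightarrow> \<bar>f x - f y\<bar> < e"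
      by (intro ex2I[where a = "e * \<epsilon> / 2" and b = R]) (use e \<epsilon> R in auto)
  qed blast
  have closed: "closedin Z {z \<in> topspace Z. g z \<in> {c}}" for c
    by (rule closedin_continuous_map_preimage[OF g(1)]) simp
  have "f x = 0" if "x \<in> ?B" for x
  proof -
    have "jdist x0 x x = 0" using farM that by (intro J.zero[THEN iffD2]) auto
    then have "D x = 0" using Dle[OF that, of x] D0[of x] by linarith
    then show ?thesis by (simp add: f_def)
  qed
  then have "\<iota> ` ?B \<subseteq> {z \<in> topspace Z. g z \<in> {0}}"
    using g(2) AB image_subset_Z[OF AB(2)] by auto
  from closure_of_minimal[OF this closed] have "g p = 0" using pB by auto
  have "f x = 1" if "x \<in> A \<inter> far x0 R" for x
  proof -
    have "\<epsilon> \<le> D x" by (rule Dge) (use sep[OF that] in force)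
    then show ?thesis using \<epsilon> by (simp add: f_def)
  qed
  then have "\<iota> ` (A \<inter> far x0 R) \<subseteq> {z \<in> topspace Z. g z \<in> {1}}"
    using g(2) AB image_subset_Z[OF AB(1)] by auto
  from closure_of_minimal[OF this closed] have "g p = 1" using pA by auto
  then show False using \<open>g p = 0\<close> by simp
qed

text \<open>The complement of the closure of \<open>M - I t\<close> is the open trace of
  \<open>I t\<close> on the corona. Sets with a positive Lebesgue number have traces that cover
  it.\<close>

lemma lebesgue_imp_corona_cover:
  assumes fin: "finite T" and \<epsilon>: "\<epsilon> > 0" and R: "R > 0"
    and leb: "\<And>x. x \<in> far x0 R \<Longrightarrow> \<exists>t\<in>T. \<forall>y\<in>far x0 R. jdist x0 x y \<le> \<epsilon> \<longrightarrow> y \<in> I t"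
    and p: "p \<in> corona"
  shows "\<exists>t\<in>T. p \<notin> Z closure_of (\<iota> ` (M - I t))"
proof -
  \<comment> \<open>The core of \<open>I t\<close>: it is \<open>\<epsilon>\<close>-separated from
    the complement of \<open>I t\<close>. Finitely many cores exhaust the far part, so
    \<open>p\<close> is in the closure of one of them.\<close>
  define A where "A t = {x \<in> far x0 R. \<forall>y\<in>far x0 R. jdist x0 x y \<le> \<epsilon> \<longrightarrow> y \<in> I t}" for t
  have AM: "A t \<subseteq> M" for t by (auto simp: A_def far_def)
  have "p \<in> Z closure_of (\<iota> ` M)" using p dense_image by simp
  then have "p \<in> Z closure_of (\<iota> ` (M \<inter> far x0 R))" by (rule closure_of_far[OF order_refl p])
  moreover have "M \<inter> far x0 R = (\<Union>t\<in>T. A t)" using leb by (auto simp: A_def far_def)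
  then have "\<iota> ` (M \<inter> far x0 R) = (\<Union>t\<in>T. \<iota> ` A t)" by auto
  ultimately obtain t where t: "t \<in> T" "p \<in> Z closure_of (\<iota> ` A t)"
    using closure_of_Union[of "(\<lambda>t. \<iota> ` A t) ` T" Z] fin by auto
  have "p \<notin> Z closure_of (\<iota> ` A t) \<or> p \<notin> Z closure_of (\<iota> ` (M - I t))"
    by (rule separated_closures_disjoint[OF AM _ \<epsilon> _ R p]) (force simp: A_def)+
  then show ?thesis using t by blast
qed

text \<open>Urysohn functions subordinate to the cover extend over \<open>Z\<close>, and their
  uniform continuity at infinity produces the Lebesgue number.\<close>

lemma corona_cover_imp_lebesgue:
  assumes op: "\<And>V. V \<in> \<V> \<Longrightarrow> openin (subtopology Z corona) V" and cov: "\<Union>\<V> = corona"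
  obtains W \<epsilon> R where "\<And>V. V \<in> \<V> \<Longrightarrow> W V \<subseteq> M"
    "\<And>V. V \<in> \<V> \<Longrightarrow> Z closure_of (\<iota> ` W V) \<inter> corona \<subseteq> V" "\<epsilon> > 0" "R > 0"
    "\<And>x. x \<in> far x0 R \<Longrightarrow> \<exists>V\<in>\<V>. \<forall>y\<in>far x0 R. jdist x0 x y \<le> \<epsilon> \<longrightarrow> y \<in> W V"
proof -
  have norm: "normal_space Z" using compact_Z Hausdorff_Z by (intro compact_Hausdorff_or_regular_imp_normal_space) auto
  have "\<forall>p\<in>corona. \<exists>q. fst q \<in> \<V> \<and> continuous_map Z euclideanreal (snd q) \<and> snd q p = 1 \<and>
     (\<forall>z\<in>corona - fst q. snd q z = 0)"
  proof
    fix p assume p: "p \<in> corona"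
    then obtain V where V: "V \<in> \<V>" "p \<in> V" using cov by blast
    have "closedin (subtopology Z corona) (corona - V)"
      using op[OF V(1)] by (simp add: openin_closedin_eq inf.absorb2)
    then have cl: "closedin Z (corona - V)" using closedin_corona closedin_trans_full by blast
    have clp: "closedin Z {p}" using p Hausdorff_Z by (intro closedin_Hausdorff_finite) auto
    obtain g where g: "continuous_map Z (top_of_set {0..1::real}) g" "g ` (corona - V) \<subseteq> {0}" "g ` {p} \<subseteq> {1}"
      using Urysohn_lemma[OF norm cl clp, of 0 1] V(2) by (auto simp: disjnt_def)
    then show "\<exists>q. fst q \<in> \<V> \<and> continuous_map Z euclideanreal (snd q) \<and> snd q p = 1 \<and>
        (\<forall>z\<in>corona - fst q. snd q z = 0)"
      using V(1) continuous_map_into_fulltopology[OF g(1)] by (intro exI[of _ "(V, g)"]) auto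
  qed
  from bchoice[OF this] obtain q where q: "\<And>p. p \<in> corona \<Longrightarrow> fst (q p) \<in> \<V>"
    "\<And>p. p \<in> corona \<Longrightarrow> continuous_map Z euclideanreal (snd (q p))" "\<And>p. p \<in> corona \<Longrightarrow> snd (q p) p = 1"
    "\<And>p z. p \<in> corona \<Longrightarrow> z \<in> corona - fst (q p) \<Longrightarrow> snd (q p) z = 0" by blast
  define v where "v p = fst (q p)" for p
  define g where "g p = snd (q p)" for p
  have g: "continuous_map Z euclideanreal (g p)" if "p \<in> corona" for p using q that by (simp add: g_def)
  have opg: "openin Z {z \<in> topspace Z. g p z \<in> {1/2<..}}" if "p \<in> corona" for p
    by (rule openin_continuous_map_preimage[OF g[OF that]]) simp
  have clg: "closedin Z {z \<in> topspace Z. g p z \<in> {1/4..}}" if "p \<in> corona" for p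
    by (rule closedin_continuous_map_preimage[OF g[OF that]]) simp
  have "compactin Z corona" using compact_Z closedin_corona by (rule closedin_compact_space)
  moreover have "corona \<subseteq> (\<Union>p\<in>corona. {z \<in> topspace Z. g p z \<in> {1/2<..}})"
    using q(3) by (force simp: g_def)
  ultimately obtain \<F> where F: "finite \<F>" "\<F> \<subseteq> (\<lambda>p. {z \<in> topspace Z. g p z \<in> {1/2<..}}) ` corona" "corona \<subseteq> \<Union>\<F>"
    using compactinD[of Z corona "(\<lambda>p. {z \<in> topspace Z. g p z \<in> {1/2<..}}) ` corona"] opg by blast
  from finite_subset_image[OF F(1,2)] obtain P where P: "P \<subseteq> corona" "finite P"
    "\<F> = (\<lambda>p. {z \<in> topspace Z. g p z \<in> {1/2<..}}) ` P" by blast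
  have "\<forall>p\<in>P. \<exists>r. fst r > 0 \<and> snd r > (0::real) \<and> (\<forall>x\<in>far x0 (snd r). \<forall>y\<in>far x0 (snd r).
      jdist x0 x y \<le> fst r \<longrightarrow> \<bar>g p (\<iota> x) - g p (\<iota> y)\<bar> < 1/4)"
  proof
    fix p assume "p \<in> P"
    then have "p \<in> corona" using P by blast
    have "(1/4::real) > 0" by simp
    from extension_uniform[OF g[OF \<open>p \<in> corona\<close>] this] obtain \<delta> R where "\<delta> > 0" "R > 0"
      "\<And>x y. x \<in> far x0 R \<Longrightarrow> y \<in> far x0 R \<Longrightarrow> jdist x0 x y \<le> \<delta> \<Longrightarrow> \<bar>g p (\<iota> x) - g p (\<iota> y)\<bar> < 1/4" by blast
    then show "\<exists>r. fst r > 0 \<and> snd r > (0::real) \<and> (\<forall>x\<in>far x0 (snd r). \<forall>y\<in>far x0 (snd r).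
        jdist x0 x y \<le> fst r \<longrightarrow> \<bar>g p (\<iota> x) - g p (\<iota> y)\<bar> < 1/4)"
      by (intro exI[of _ "(\<delta>, R)"]) simp
  qed
  from bchoice[OF this] obtain r where r: "\<And>p. p \<in> P \<Longrightarrow> fst (r p) > 0"
    "\<And>p x y. p \<in> P \<Longrightarrow> x \<in> far x0 (snd (r p)) \<Longrightarrow> y \<in> far x0 (snd (r p)) \<Longrightarrow> jdist x0 x y \<le> fst (r p) \<Longrightarrow>
       \<bar>g p (\<iota> x) - g p (\<iota> y)\<bar> < 1/4" by blast
  define \<epsilon> where "\<epsilon> = Min (insert 1 ((\<lambda>p. fst (r p)) ` P))"
  have \<epsilon>: "\<epsilon> > 0" using r(1) P(2) by (simp add: \<epsilon>_def)
  have \<epsilon>_le: "\<epsilon> \<le> fst (r p)" if "p \<in> P" for p using that P(2) by (simp add: \<epsilon>_def)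
  define S where "S = {x \<in> M. \<forall>p\<in>P. g p (\<iota> x) \<le> 1/2}"
  have "finite S"
  \<comment> \<open>The open sets where some function exceeds 1/2 cover the corona, so the points of
    the space missed by all of them cannot accumulate there.\<close>
  proof (rule finite_of_closure_avoids_corona)
    show "S \<subseteq> M" by (auto simp: S_def)
    have "\<iota> ` S \<subseteq> topspace Z - \<Union>\<F>"
      using image_subset_Z[of M] by (auto simp: S_def P(3))
    moreover have "closedin Z (topspace Z - \<Union>\<F>)"
      using P opg by (intro closedin_diff openin_Union) auto
    ultimately have "Z closure_of (\<iota> ` S) \<subseteq> topspace Z - \<Union>\<F>" by (rule closure_of_minimal)
    then show "Z closure_of (\<iota> ` S) \<inter> corona = {}" using F(3) by blast
  qed
  then obtain R0 where R0: "R0 > 0" "far x0 R0 \<inter> S = {}" using finite_imp_near by blast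
  define R where "R = Max (insert R0 ((\<lambda>p. snd (r p)) ` P))"
  have R: "R0 \<le> R" "\<And>p. p \<in> P \<Longrightarrow> snd (r p) \<le> R" using P(2) by (auto simp: R_def)
  \<comment> \<open>The lower threshold leaves room for an oscillation of 1/4 around a point with
    value above 1/2. It is closed and positive, so limit points in the corona have a nonzero value
    and lie in \<open>V\<close>.\<close>
  define W where "W V = {x \<in> M. \<exists>p\<in>P. v p = V \<and> 1/4 \<le> g p (\<iota> x)}" for V
  show thesis
  proof (rule that[of W \<epsilon> R])
    show "W V \<subseteq> M" for V by (auto simp: W_def)
    show "\<epsilon> > 0" by fact
    show "R > 0" using R0 R by simp
    fix V assume V: "V \<in> \<V>"
    let ?C = "\<Union>p\<in>{p \<in> P. v p = V}. {z \<in> topspace Z. g p z \<in> {1/4..}}"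
    have "closedin Z ?C" using P clg by (intro closedin_Union) auto
    moreover have "\<iota> ` W V \<subseteq> ?C" using image_subset_Z[of M] by (auto simp: W_def)
    ultimately have "Z closure_of (\<iota> ` W V) \<subseteq> ?C" by (simp add: closure_of_minimal)
    moreover have "z \<in> V" if z: "z \<in> corona" and zC: "z \<in> ?C" for z
    proof (rule ccontr)
      assume "z \<notin> V"
      obtain p where "p \<in> P" "v p = V" "1/4 \<le> g p z" using zC by auto
      then show False using q(4)[of p z] P z \<open>z \<notin> V\<close> by (auto simp: v_def g_def)
    qed
    ultimately show "Z closure_of (\<iota> ` W V) \<inter> corona \<subseteq> V" by blast
  next
    fix x assume x: "x \<in> far x0 R"
    then have "x \<in> M" "x \<notin> S" using R0 R(1) by (auto simp: far_def)
    then obtain p where p: "p \<in> P" "g p (\<iota> x) > 1/2" by (force simp: S_def)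
    show "\<exists>V\<in>\<V>. \<forall>y\<in>far x0 R. jdist x0 x y \<le> \<epsilon> \<longrightarrow> y \<in> W V"
    proof (intro bexI[of _ "v p"] ballI impI)
      show "v p \<in> \<V>" using q(1) p P by (auto simp: v_def)
      fix y assume y: "y \<in> far x0 R" "jdist x0 x y \<le> \<epsilon>"
      have "\<bar>g p (\<iota> x) - g p (\<iota> y)\<bar> < 1/4"
        using r(2)[OF p(1), of x y] x y far_mono[OF R(2)[OF p(1)]] \<epsilon>_le[OF p(1)] by auto
      then have "1/4 \<le> g p (\<iota> y)" using p(2) by linarith
      then show "y \<in> W (v p)" using y p(1) by (auto simp: W_def far_def)
    qed
  qed
qed

section \<open>Covering dimension of the corona against colourings at infinity\<close>

lemma remainder_eq: "remainder mtopology Z \<iota> = subtopology Z corona"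
  by (simp add: remainder_def)

lemma topspace_corona [simp]: "topspace (subtopology Z corona) = corona"
  by auto

lemma openin_trace: "openin (subtopology Z corona) (corona - Z closure_of S)"
  by (metis Diff_Int_distrib Int_Diff closedin_closure_of inf.idem inf_commute openin_diff openin_subtopology_Int2 openin_topspace
      closedin_subtopology_Int_closed topspace_corona openin_closedin_eq Diff_subset)

lemma far_jdist_Metric: "R > 0 \<Longrightarrow> Metric_space (far x0 R) (jdist x0)"
  by (rule Metric_space.subspace[OF Metric_space_jdist[OF x0]]) (use x0 in \<open>auto simp: far_def\<close>)

text \<open>The cover is moved to the space, refined there by \<open>n + 1\<close> families of
  disjoint sets, and moved back by traces. Each colour contributes at most one set through a
  point.\<close>

lemma conical_dim_le_imp_covering_dim_le:
  assumes con: "conical_dim_le x0 n"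
  shows "covering_dim_le (remainder mtopology Z \<iota>) n"
  unfolding covering_dim_le_def remainder_eq topspace_corona
proof (intro allI impI)
  fix \<U> assume U: "finite \<U> \<and> (\<forall>U\<in>\<U>. openin (subtopology Z corona) U) \<and> \<Union>\<U> = corona"
  then have op: "\<And>U. U \<in> \<U> \<Longrightarrow> openin (subtopology Z corona) U" and cov: "\<Union>\<U> = corona" and fin: "finite \<U>" by auto
  obtain W \<epsilon> R where W: "\<And>V. V \<in> \<U> \<Longrightarrow> W V \<subseteq> M"
    "\<And>V. V \<in> \<U> \<Longrightarrow> Z closure_of (\<iota> ` W V) \<inter> corona \<subseteq> V" "\<epsilon> > 0" "R > 0"
    "\<And>x. x \<in> far x0 R \<Longrightarrow> \<exists>V\<in>\<U>. \<forall>y\<in>far x0 R. jdist x0 x y \<le> \<epsilon> \<longrightarrow> y \<in> W V"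
    using corona_cover_imp_lebesgue[OF op cov] by blast
  have "\<epsilon> / 2 > 0" using W(3) by simp
  from con[unfolded conical_dim_le_def, rule_format, OF this]
  obtain \<eta>' R' where \<eta>': "\<eta>' > 0" and R': "R' > 0" and col': "chain_colorable (jdist x0) n \<eta>' (\<epsilon> / 2) (far x0 R')"
    by blast
  define \<eta> where "\<eta> = min \<eta>' (\<epsilon> / 2)"
  have \<eta>: "0 < \<eta>" "\<eta> \<le> \<eta>'" "\<epsilon> / 2 + \<eta> \<le> \<epsilon>" using \<eta>' W(3) by (auto simp: \<eta>_def)
  define R1 where "R1 = max R R'"
  have R1: "R1 > 0" "R \<le> R1" "R' \<le> R1" using R' by (auto simp: R1_def)
  interpret J: Metric_space "far x0 R1" "jdist x0" by (rule far_jdist_Metric[OF R1(1)])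
  have col: "chain_colorable (jdist x0) n \<eta> (\<epsilon> / 2) (far x0 R1)"
    by (rule chain_colorable_mono[OF col' \<eta>(2) order_refl far_mono[OF R1(3)]])
  have leb: "\<exists>V\<in>\<U>. J.mcball x \<epsilon> \<subseteq> W V" if x: "x \<in> far x0 R1" for x
  proof -
    obtain V where V: "V \<in> \<U>" "\<forall>y\<in>far x0 R. jdist x0 x y \<le> \<epsilon> \<longrightarrow> y \<in> W V"
      using W(5)[of x] x far_mono[OF R1(2)] by blast
    have "J.mcball x \<epsilon> \<subseteq> W V" using V(2) subsetD[OF far_mono[OF R1(2), of x0]] by auto
    then show ?thesis using V(1) by blast
  qed
  obtain I where I: "\<And>i V. V \<in> \<U> \<Longrightarrow> I i V \<subseteq> W V"
    "\<And>x. x \<in> far x0 R1 \<Longrightarrow> \<exists>i\<le>n. \<exists>V\<in>\<U>. J.mcball x (\<eta> / 2) \<subseteq> I i V"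
    "\<And>i U V. U \<noteq> V \<Longrightarrow> I i U \<inter> I i V = {}"
    using J.coloring_refines_cover[OF \<eta>(1) col leb \<eta>(3)] by blast
  define T where "T t = corona - Z closure_of (\<iota> ` (M - I (fst t) (snd t)))" for t
  let ?V = "T ` ({..n} \<times> \<U>)"
  \<comment> \<open>The complements of two disjoint sets cover \<open>M\<close>, so their closures
    cover \<open>Z\<close> and no point lies in both traces.\<close>
  have disj: "T (i, U) \<inter> T (i, V) = {}" if "U \<noteq> V" for i U V
  proof -
    have "M = (M - I i U) \<union> (M - I i V)" using I(3)[OF that, of i] by blast
    then have "topspace Z = Z closure_of (\<iota> ` ((M - I i U) \<union> (M - I i V)))" using dense_image by simp
    then show ?thesis by (auto simp: T_def image_Un)
  qed
  show "\<exists>\<V>. finite \<V> \<and> (\<forall>V\<in>\<V>. openin (subtopology Z corona) V) \<and> \<Union>\<V> = corona \<and>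
      (\<forall>V\<in>\<V>. \<exists>U\<in>\<U>. V \<subseteq> U) \<and> mult_le \<V> (n + 1)"
  proof (intro exI[of _ ?V] conjI ballI)
    show "finite ?V" using fin by simp
    show "openin (subtopology Z corona) V" if "V \<in> ?V" for V using that openin_trace by (auto simp: T_def)
    show "\<Union>?V = corona"
    proof
      show "corona \<subseteq> \<Union>?V"
      proof
        fix p assume p: "p \<in> corona"
        have "\<exists>t\<in>{..n} \<times> \<U>. p \<notin> Z closure_of (\<iota> ` (M - I (fst t) (snd t)))"
        proof (rule lebesgue_imp_corona_cover[OF _ _ R1(1) _ p])
          show "finite ({..n} \<times> \<U>)" using fin by simp
          show "\<eta> / 2 > 0" using \<eta> by simp
          fix x assume x: "x \<in> far x0 R1"
          obtain i V where iV: "i \<le> n" "V \<in> \<U>" "J.mcball x (\<eta> / 2) \<subseteq> I i V" using I(2)[OF x] by blast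
          then have "\<forall>y\<in>far x0 R1. jdist x0 x y \<le> \<eta> / 2 \<longrightarrow> y \<in> I i V" using x by auto
          then show "\<exists>t\<in>{..n} \<times> \<U>. \<forall>y\<in>far x0 R1. jdist x0 x y \<le> \<eta> / 2 \<longrightarrow> y \<in> I (fst t) (snd t)"
            using iV by (intro bexI[of _ "(i, V)"]) auto
        qed
        then show "p \<in> \<Union>?V" using p by (auto simp: T_def)
      qed
    qed (auto simp: T_def)
    show "\<exists>U\<in>\<U>. V \<subseteq> U" if V: "V \<in> ?V" for V
    proof -
      obtain i U where iU: "i \<le> n" "U \<in> \<U>" "V = T (i, U)" using V by blast
      have "V \<subseteq> U"
      proof
        fix p assume "p \<in> V"
        then have p: "p \<in> corona" "p \<notin> Z closure_of (\<iota> ` (M - I i U))" using iU by (auto simp: T_def)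
        \<comment> \<open>By density a point outside the closure of the complement is in the closure
          of \<open>I i U\<close>, hence in that of \<open>W U\<close>.\<close>
        have "\<iota> ` M = \<iota> ` (M - I i U) \<union> \<iota> ` (M \<inter> I i U)" by blast
        then have "p \<in> Z closure_of (\<iota> ` (M \<inter> I i U))" using p dense_image by auto
        moreover have "\<iota> ` (M \<inter> I i U) \<subseteq> \<iota> ` W U" using I(1)[OF iU(2), of i] by blast
        ultimately have "p \<in> Z closure_of (\<iota> ` W U)" using closure_of_mono by blast
        then show "p \<in> U" using W(2)[OF iU(2)] p(1) by blast
      qed
      then show ?thesis using iU(2) by blast
    qed
    show "mult_le ?V (n + 1)"
    proof (rule mult_leI)
      fix p
      let ?S = "{V \<in> ?V. p \<in> V}"
      \<comment> \<open>Different index pairs may give the same trace, so one index is chosen for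
        each set before colours are compared.\<close>
      have "\<forall>V\<in>?S. \<exists>t. t \<in> {..n} \<times> \<U> \<and> V = T t" by blast
      from bchoice[OF this] obtain t where t: "\<And>V. V \<in> ?S \<Longrightarrow> t V \<in> {..n} \<times> \<U> \<and> V = T (t V)" by blast
      have inj: "inj_on (\<lambda>V. fst (t V)) ?S"
      proof (rule inj_onI)
        fix V V' assume V: "V \<in> ?S" "V' \<in> ?S" "fst (t V) = fst (t V')"
        have e: "t V = (fst (t V), snd (t V))" "t V' = (fst (t V), snd (t V'))"
          using V(3) by (simp_all only: prod_eq_iff fst_conv snd_conv)
        have "p \<in> T (fst (t V), snd (t V))" "p \<in> T (fst (t V), snd (t V'))"
          using t[OF V(1)] t[OF V(2)] V(1,2) e by auto
        then have "snd (t V) = snd (t V')" using disj by blast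
        then have "t V = t V'" using e by simp
        then show "V = V'" using t[OF V(1)] t[OF V(2)] by simp
      qed
      have im: "(\<lambda>V. fst (t V)) ` ?S \<subseteq> {..n}"
      proof (rule image_subsetI)
        fix V assume "V \<in> ?S"
        then show "fst (t V) \<in> {..n}" using t[THEN conjunct1, of V] by (simp add: mem_Times_iff)
      qed
      show "finite ?S \<and> card ?S \<le> n + 1"
        using card_inj_on_le[OF inj im] inj_on_finite[OF inj im] by simp
    qed
  qed
qed

text \<open>Multiplicity comes from the refinement in the corona, smallness from the
  \<open>N + 1\<close> sets it refines: outside a ball each \<open>W V\<close> is contained in one
  of them.\<close>

lemma covering_dim_le_imp_conical_dim_le:
  assumes cd: "covering_dim_le (remainder mtopology Z \<iota>) n" and con: "conical_dim_le x0 N"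
  shows "conical_dim_le x0 n"
  unfolding conical_dim_le_def
proof (intro allI impI)
  fix \<delta> :: real assume \<delta>: "\<delta> > 0"
  have "\<delta> / 2 > 0" using \<delta> by simp
  from con[unfolded conical_dim_le_def, rule_format, OF this]
  obtain \<eta> R where \<eta>: "\<eta> > 0" and R: "R > 0" and "chain_colorable (jdist x0) N \<eta> (\<delta> / 2) (far x0 R)" by blast
  then obtain C where C: "\<And>x. x \<in> far x0 R \<Longrightarrow> C x \<le> N"
    "\<And>i. i \<le> N \<Longrightarrow> chain_bounded (jdist x0) \<eta> (\<delta> / 2) {x \<in> far x0 R. C x = i}"
    using chain_colorableE by blast
  \<comment> \<open>The two bounds are those required by the thickening lemma: steps up to
    \<open>\<eta>\<close> for the original classes, and a final bound of at most
    \<open>\<delta>\<close>.\<close>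
  define \<rho> where "\<rho> = min (\<eta> / 3) (\<delta> / 4)"
  have \<rho>: "\<rho> > 0" "3 * \<rho> \<le> \<eta>" "\<delta> / 2 + 2 * \<rho> \<le> \<delta>" using \<eta> \<delta> by (auto simp: \<rho>_def)
  interpret J: Metric_space "far x0 R" "jdist x0" by (rule far_jdist_Metric[OF R])
  \<comment> \<open>Thickening gives the colour classes a Lebesgue number, so that their traces
    cover the corona.\<close>
  define I where "I i = {y \<in> far x0 R. \<exists>x\<in>{x \<in> far x0 R. C x = i}. jdist x0 x y \<le> \<rho>}" for i
  have I_bd: "chain_bounded (jdist x0) \<rho> \<delta> (I i)" if "i \<le> N" for i
  proof -
    have "chain_bounded (jdist x0) (3 * \<rho>) (\<delta> / 2) {x \<in> far x0 R. C x = i}"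
      by (rule chain_bounded_mono[OF C(2)[OF that] \<rho>(2)]) auto
    then have "chain_bounded (jdist x0) \<rho> (\<delta> / 2 + 2 * \<rho>) (I i)"
      unfolding I_def by (intro J.chain_bounded_thickening) auto
    then show ?thesis by (rule chain_bounded_mono) (use \<rho> in auto)
  qed
  define T where "T i = corona - Z closure_of (\<iota> ` (M - I i))" for i
  have "finite (T ` {..N}) \<and> (\<forall>U\<in>T ` {..N}. openin (subtopology Z corona) U) \<and> \<Union>(T ` {..N}) = corona"
  proof (intro conjI ballI)
    show "openin (subtopology Z corona) U" if "U \<in> T ` {..N}" for U using that openin_trace by (auto simp: T_def)
    show "\<Union>(T ` {..N}) = corona"
    proof
      show "corona \<subseteq> \<Union>(T ` {..N})"
      proof
        fix p assume p: "p \<in> corona"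
        have "\<exists>i\<in>{..N}. p \<notin> Z closure_of (\<iota> ` (M - I i))"
        proof (rule lebesgue_imp_corona_cover[OF _ \<rho>(1) R _ p])
          fix x assume x: "x \<in> far x0 R"
          then show "\<exists>t\<in>{..N}. \<forall>y\<in>far x0 R. jdist x0 x y \<le> \<rho> \<longrightarrow> y \<in> I t"
            using C(1)[OF x] by (intro bexI[of _ "C x"]) (auto simp: I_def)
        qed simp
        then show "p \<in> \<Union>(T ` {..N})" using p by (auto simp: T_def)
      qed
    qed (auto simp: T_def)
  qed simp
  from cd[unfolded covering_dim_le_def remainder_eq topspace_corona, THEN spec, THEN mp, OF this]
  obtain \<V> where \<V>: "finite \<V> \<and> (\<forall>V\<in>\<V>. openin (subtopology Z corona) V) \<and> \<Union>\<V> = corona \<and>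
      (\<forall>V\<in>\<V>. \<exists>U\<in>T ` {..N}. V \<subseteq> U) \<and> mult_le \<V> (n + 1)" ..
  then have fin: "finite \<V>" and op: "\<And>V. V \<in> \<V> \<Longrightarrow> openin (subtopology Z corona) V"
    and cov: "\<Union>\<V> = corona" and ref: "\<forall>V\<in>\<V>. \<exists>U\<in>T ` {..N}. V \<subseteq> U" and mult: "mult_le \<V> (n + 1)"
    by simp_all
  have "\<forall>V\<in>\<V>. \<exists>i. i \<le> N \<and> V \<subseteq> T i" using ref by blast
  from bchoice[OF this] obtain i where i: "\<And>V. V \<in> \<V> \<Longrightarrow> i V \<le> N \<and> V \<subseteq> T (i V)" by blast
  obtain W \<epsilon> R2 where W: "\<And>V. V \<in> \<V> \<Longrightarrow> W V \<subseteq> M"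
    "\<And>V. V \<in> \<V> \<Longrightarrow> Z closure_of (\<iota> ` W V) \<inter> corona \<subseteq> V" "\<epsilon> > 0" "R2 > 0"
    "\<And>x. x \<in> far x0 R2 \<Longrightarrow> \<exists>V\<in>\<V>. \<forall>y\<in>far x0 R2. jdist x0 x y \<le> \<epsilon> \<longrightarrow> y \<in> W V"
    using corona_cover_imp_lebesgue[OF op cov] by blast
  have fin1: "finite (W V - I (i V))" if V: "V \<in> \<V>" for V
  proof (rule finite_of_closure_avoids_corona)
    show "W V - I (i V) \<subseteq> M" using W(1)[OF V] by blast
    have "Z closure_of (\<iota> ` (W V - I (i V))) \<subseteq> Z closure_of (\<iota> ` W V)"
      "Z closure_of (\<iota> ` (W V - I (i V))) \<subseteq> Z closure_of (\<iota> ` (M - I (i V)))"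
      using W(1)[OF V] by (intro closure_of_mono; blast)+
    then show "Z closure_of (\<iota> ` (W V - I (i V))) \<inter> corona = {}"
      using W(2)[OF V] i[OF V] unfolding T_def by blast
  qed
  have fin2: "finite {x \<in> M. \<forall>V\<in>\<J>. x \<in> W V}" if J: "\<J> \<subseteq> \<V>" "\<J> \<noteq> {}" "\<Inter>\<J> = {}" for \<J>
  proof (rule finite_of_closure_avoids_corona)
    show "{x \<in> M. \<forall>V\<in>\<J>. x \<in> W V} \<subseteq> M" by blast
    have "Z closure_of (\<iota> ` {x \<in> M. \<forall>V\<in>\<J>. x \<in> W V}) \<inter> corona \<subseteq> V" if V: "V \<in> \<J>" for V
    proof -
      have "Z closure_of (\<iota> ` {x \<in> M. \<forall>V\<in>\<J>. x \<in> W V}) \<subseteq> Z closure_of (\<iota> ` W V)"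
        using V by (intro closure_of_mono) blast
      then show ?thesis using W(2)[of V] V J(1) by blast
    qed
    then show "Z closure_of (\<iota> ` {x \<in> M. \<forall>V\<in>\<J>. x \<in> W V}) \<inter> corona = {}" using J by blast
  qed
  \<comment> \<open>Refinement and multiplicity are known for closures in the corona, hence for the
    sets \<open>W V\<close> only up to finitely many points. Since \<open>\<V>\<close> is finite, a
    single ball contains all exceptions.\<close>
  define bad where "bad = (\<Union>V\<in>\<V>. W V - I (i V)) \<union>
    (\<Union>\<J>\<in>{\<J>. \<J> \<subseteq> \<V> \<and> \<J> \<noteq> {} \<and> \<Inter>\<J> = {}}. {x \<in> M. \<forall>V\<in>\<J>. x \<in> W V})"
  have "finite {\<J>. \<J> \<subseteq> \<V> \<and> \<J> \<noteq> {} \<and> \<Inter>\<J> = {}}"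
    by (rule finite_subset[of _ "Pow \<V>"]) (use fin in auto)
  then have "finite bad" unfolding bad_def using fin fin1 fin2 by (intro finite_UnI finite_UN_I) auto
  then obtain R0 where R0: "R0 > 0" "far x0 R0 \<inter> bad = {}" using finite_imp_near by blast
  define R3 where "R3 = max R0 (max R R2)"
  have R3: "R0 \<le> R3" "R \<le> R3" "R2 \<le> R3" "R3 > 0" using R by (auto simp: R3_def)
  have nbad: "x \<notin> bad" if "x \<in> far x0 R3" for x using that R0 far_mono[OF R3(1)] by blast
  interpret K: Metric_space "far x0 R3" "jdist x0" by (rule far_jdist_Metric[OF R3(4)])
  have leb: "\<exists>V\<in>\<V>. K.mcball x \<epsilon> \<subseteq> W V" if x: "x \<in> far x0 R3" for x
  proof -
    obtain V where V: "V \<in> \<V>" "\<forall>y\<in>far x0 R2. jdist x0 x y \<le> \<epsilon> \<longrightarrow> y \<in> W V"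
      using W(5)[of x] x far_mono[OF R3(3)] by blast
    have "K.mcball x \<epsilon> \<subseteq> W V" using V(2) subsetD[OF far_mono[OF R3(3), of x0]] by auto
    then show ?thesis using V(1) by blast
  qed
  have mul: "finite {V \<in> \<V>. x \<in> W V} \<and> card {V \<in> \<V>. x \<in> W V} \<le> n + 1" if x: "x \<in> far x0 R3" for x
  proof (rule ccontr)
    assume "\<not> ?thesis"
    then have "n + 2 \<le> card {V \<in> \<V>. x \<in> W V}" using fin by simp
    from obtain_subset_with_card_n[OF this] obtain \<J>
      where J: "\<J> \<subseteq> {V \<in> \<V>. x \<in> W V}" "card \<J> = n + 2" "finite \<J>" by blast
    have "\<J> \<subseteq> \<V>" "\<J> \<noteq> {}" using J by auto
    moreover have "\<Inter>\<J> = {}" using mult J \<open>\<J> \<subseteq> \<V>\<close> unfolding mult_le_def by simp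
    moreover have "x \<in> {x \<in> M. \<forall>V\<in>\<J>. x \<in> W V}" using J x by (auto simp: far_def)
    ultimately have "x \<in> bad" unfolding bad_def by blast
    then show False using nbad x by blast
  qed
  obtain C' F where CF: "\<And>x. x \<in> far x0 R3 \<Longrightarrow> C' x \<le> n" "\<And>x. x \<in> far x0 R3 \<Longrightarrow> F x \<in> \<V> \<and> x \<in> W (F x)"
    "\<And>x y. x \<in> far x0 R3 \<Longrightarrow> y \<in> far x0 R3 \<Longrightarrow> C' x = C' y \<Longrightarrow> jdist x0 x y \<le> \<epsilon> / (n + 2) \<Longrightarrow> F x = F y"
    using K.cover_imp_coloring[OF W(3) leb mul] by blast
  have "chain_colorable (jdist x0) n (min \<rho> (\<epsilon> / (n + 2))) \<delta> (far x0 R3)"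
  proof (rule chain_colorableI[where C = C'])
    fix k
    show "chain_bounded (jdist x0) (min \<rho> (\<epsilon> / (n + 2))) \<delta> {x \<in> far x0 R3. C' x = k}"
    proof (rule chain_bounded_labels[where lab = F])
      show "F x = F y" if "x \<in> {x \<in> far x0 R3. C' x = k}" "y \<in> {x \<in> far x0 R3. C' x = k}"
        "jdist x0 x y \<le> min \<rho> (\<epsilon> / (n + 2))" for x y
        using that CF(3)[of x y] by simp
      fix V
      let ?A = "{x \<in> {x \<in> far x0 R3. C' x = k}. F x = V}"
      show "chain_bounded (jdist x0) (min \<rho> (\<epsilon> / (n + 2))) \<delta> ?A"
      proof (cases "?A = {}")
        case False
        then have V: "V \<in> \<V>" using CF(2) by blast
        \<comment> \<open>\<open>W V\<close> may be large; only its inclusion in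
          \<open>I (i V)\<close> bounds the chains with steps at most \<open>\<rho>\<close>.\<close>
        have "?A \<subseteq> I (i V)"
        proof
          fix x assume x: "x \<in> ?A"
          then have "x \<in> W V" using CF(2) by blast
          then show "x \<in> I (i V)" using nbad[of x] x V unfolding bad_def by blast
        qed
        then show ?thesis using i[OF V] by (intro chain_bounded_mono[OF I_bd[of "i V"]]) auto
      qed (auto simp: chain_bounded_def)
    qed
  qed (use CF in auto)
  then show "\<exists>\<eta>>0. \<exists>R>0. chain_colorable (jdist x0) n \<eta> \<delta> (far x0 R)"
    using \<rho>(1) W(3) R3(4) by (intro ex2I[where a = "min \<rho> (\<epsilon> / (n + 2))" and b = R3]) auto
qed

end

section \<open>Finitely generated groups\<close>

text \<open>A finite group has no distant points to which balls could be translated, so it is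
  treated separately, with a single colour.\<close>

lemma (in Metric_space) finite_imp_AN_asdim_le:
  assumes fin: "finite M"
  shows "AN_asdim_le n"
  unfolding AN_asdim_le_iff
proof (rule ex2I[where b = 1])
  define D where "D = Max (insert 0 ((\<lambda>p. d (fst p) (snd p)) ` (M \<times> M)))"
  have D: "0 \<le> D" "d x y \<le> D" if "x \<in> M" "y \<in> M" for x y
    using fin that unfolding D_def by (auto intro!: Max_ge rev_image_eqI[of "(x, y)"])
  define c where "c = max 1 D"
  show "0 < c" by (simp add: c_def)
  show "(0::real) < 1" by simp
  show "\<forall>r\<ge>1. chain_colorable d n r (c * r) M"
  proof (intro allI impI chain_colorableI[where C = "\<lambda>_. 0"] chain_bounded_diam)
    fix r :: real and i x y
    assume r: "1 \<le> r" and x: "x \<in> {x \<in> M. 0 = i}" and y: "y \<in> {x \<in> M. 0 = i}"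
    have "d x y \<le> c * 1" using D(2)[of x y] x y by (simp add: c_def)
    also have "\<dots> \<le> c * r" using r by (intro mult_left_mono) (auto simp: c_def)
    finally show "d x y \<le> c * r" .
  qed simp
qed

context group
begin

text \<open>Take the prefix of length \<open>k\<close> of a shortest word for a sufficiently long
  element: a shorter expression for the prefix would shorten the whole word.\<close>

lemma exists_word_length:
  assumes S: "S \<subseteq> carrier G" and gen: "generate G S = carrier G" and fin: "finite S"
    and inf: "infinite (carrier G)"
  obtains g where "g \<in> carrier G" "word_length G S g = k"
proof -
  interpret W: Metric_space "carrier G" "word_dist G S" by (rule Metric_space_word_dist[OF S gen])
  have "\<exists>h\<in>carrier G. k \<le> word_length G S h"
  proof (rule ccontr)
    assume "\<not> ?thesis"
    then have "carrier G \<subseteq> W.mcball \<one> k" by (fastforce simp: word_dist_def)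
    then have "W.mbounded (carrier G)" using W.mbounded_mcball W.mbounded_subset by blast
    then show False using word_dist_proper(1)[OF S gen fin] inf by blast
  qed
  then obtain h where h: "h \<in> carrier G" "k \<le> word_length G S h" by blast
  obtain ws where ws: "length ws = word_length G S h" "set ws \<subseteq> S \<union> (\<lambda>s. inv s) ` S" "foldr (\<otimes>) ws \<one> = h"
    using word_length_witness[OF S gen h(1)] .
  have sub: "set (take k ws) \<subseteq> S \<union> (\<lambda>s. inv s) ` S" "set (drop k ws) \<subseteq> S \<union> (\<lambda>s. inv s) ` S"
    using ws(2) set_take_subset[of k ws] set_drop_subset[of k ws] by blast+
  have cl: "set (take k ws) \<subseteq> carrier G" "set (drop k ws) \<subseteq> carrier G"
    using sub letters_carrier[OF S gen] by blast+
  let ?g = "foldr (\<otimes>) (take k ws) \<one>"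
  let ?g' = "foldr (\<otimes>) (drop k ws) \<one>"
  have gM: "?g \<in> carrier G" "?g' \<in> carrier G" using cl foldr_mult_closed by blast+
  have "h = ?g \<otimes> ?g'" using foldr_mult_append[OF cl] ws(3) by simp
  then have "word_length G S h \<le> word_length G S ?g + word_length G S ?g'"
    using word_length_mult[OF S gen gM] by simp
  moreover have "word_length G S ?g' \<le> length ws - k" using word_length_le[OF S gen sub(2)] by simp
  moreover have "word_length G S ?g \<le> k" using word_length_le[OF S gen sub(1)] by simp
  ultimately have "word_length G S ?g = k" using h(2) ws(1) by linarith
  then show thesis using that gM by blast
qed

lemma word_dist_mult_left:
  assumes "c \<in> carrier G" "a \<in> carrier G" "b \<in> carrier G"
  shows "word_dist G S (c \<otimes> a) (c \<otimes> b) = word_dist G S a b"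
proof -
  have "inv (c \<otimes> a) \<otimes> (c \<otimes> b) = inv a \<otimes> (inv c \<otimes> (c \<otimes> b))"
    using assms by (simp add: inv_mult_group m_assoc)
  also have "inv c \<otimes> (c \<otimes> b) = b" using assms by (simp flip: m_assoc)
  finally show ?thesis using assms by (simp add: word_dist_def)
qed

end

theorem mainTheorem4:
  fixes G :: "('a, 'b) monoid_scheme" and S :: "'a set" and x0 :: 'a
    and Z :: "'z topology" and \<iota> :: "'a \<Rightarrow> 'z"
  assumes "group G"
    and "finite S" and "S \<subseteq> carrier G" and "generate G S = carrier G"
    and "x0 \<in> carrier G"
    and "Metric_space.AN_asdim (carrier G) (word_dist G S) < \<infinity>"
    and "Metric_space.sublinear_higson_compactification (carrier G) (word_dist G S) x0 Z \<iota>"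
  shows "Metric_space.AN_asdim (carrier G) (word_dist G S) =
         covering_dim (remainder (Metric_space.mtopology (carrier G) (word_dist G S)) Z \<iota>)"
proof -
  interpret group G by fact
  note gen = assms(3,4)
  interpret W: Metric_space "carrier G" "word_dist G S" by (rule Metric_space_word_dist[OF gen])
  interpret H: higson_corona "carrier G" "word_dist G S" x0 Z \<iota>
    by unfold_locales (use assms(5,7) word_dist_proper(1)[OF gen assms(2)] in auto)
  obtain N where N: "W.AN_asdim_le N"
    using assms(6) unfolding W.AN_asdim_def Inf_less_iff by blast
  \<comment> \<open>Both dimensions are infima over the admissible \<open>n\<close>, so agreement
    for each \<open>n\<close> gives equality.\<close>
  have "W.AN_asdim_le n \<longleftrightarrow> covering_dim_le (remainder W.mtopology Z \<iota>) n" for n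
  proof
    assume "W.AN_asdim_le n"
    then show "covering_dim_le (remainder W.mtopology Z \<iota>) n"
      by (intro H.conical_dim_le_imp_covering_dim_le W.AN_asdim_le_imp_conical_dim_le assms(5))
  next
    assume "covering_dim_le (remainder W.mtopology Z \<iota>) n"
    then have con: "W.conical_dim_le x0 n"
      by (rule H.covering_dim_le_imp_conical_dim_le[OF _ W.AN_asdim_le_imp_conical_dim_le[OF assms(5) N]])
    show "W.AN_asdim_le n"
    proof (cases "finite (carrier G)")
      case True
      then show ?thesis by (rule W.finite_imp_AN_asdim_le)
    next
      case False
      show ?thesis
      proof (rule W.conical_dim_le_imp_AN_asdim_le[OF con N _ assms(5)])
        fix r :: real and x assume r: "0 < r" and x: "x \<in> carrier G"
        obtain g where g: "g \<in> carrier G" "word_length G S g = nat \<lceil>2 * r\<rceil>"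
          using exists_word_length[OF gen assms(2) False] .
        \<comment> \<open>Left multiplication by \<open>c\<close> is an isometry sending
          \<open>x\<close> to \<open>x0\<close> times \<open>g\<close>, whose distance from
          \<open>x0\<close> is the length of \<open>g\<close>, that is 2r rounded up.\<close>
        define c where "c = x0 \<otimes>\<^bsub>G\<^esub> g \<otimes>\<^bsub>G\<^esub> inv\<^bsub>G\<^esub> x"
        have c: "c \<in> carrier G" "c \<otimes>\<^bsub>G\<^esub> x = x0 \<otimes>\<^bsub>G\<^esub> g" using g x assms(5) by (auto simp: c_def m_assoc)
        have "word_dist G S (c \<otimes>\<^bsub>G\<^esub> x) x0 = word_dist G S (x0 \<otimes>\<^bsub>G\<^esub> \<one>\<^bsub>G\<^esub>) (x0 \<otimes>\<^bsub>G\<^esub> g)"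
          using W.commute c(2) assms(5) by simp
        also have "\<dots> = word_dist G S \<one>\<^bsub>G\<^esub> g"
          by (rule word_dist_mult_left) (use g assms(5) in auto)
        also have "\<dots> = real (nat \<lceil>2 * r\<rceil>)" using g by (simp add: word_dist_def)
        finally have "2 * r \<le> word_dist G S (c \<otimes>\<^bsub>G\<^esub> x) x0" "word_dist G S (c \<otimes>\<^bsub>G\<^esub> x) x0 \<le> 2 * r + 1"
          using r by linarith+
        then show "\<exists>\<phi>. \<phi> ` carrier G \<subseteq> carrier G \<and>
            (\<forall>y\<in>carrier G. \<forall>z\<in>carrier G. word_dist G S (\<phi> y) (\<phi> z) = word_dist G S y z) \<and>
            2 * r \<le> word_dist G S (\<phi> x) x0 \<and> word_dist G S (\<phi> x) x0 \<le> 2 * r + 1"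
          using c(1) word_dist_mult_left by (intro exI[of _ "\<lambda>y. c \<otimes>\<^bsub>G\<^esub> y"]) auto
      qed
    qed
  qed
  then show ?thesis by (simp add: W.AN_asdim_def covering_dim_def)
qed

end
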